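(* For $\tau$ large, $$\Phi(\tau)=\frac{\mathbb{E}\left(|L(1,\mathbb{X})|^{2\kappa}\right)(e^\gamma\tau)^{-2\kappa}}{\kappa\sqrt{2\pi\mathcal{L}''(\kappa)}}\left(1+O\left(\sqrt{\frac{\log\kappa}{\kappa}}\right)\right)$$ and $$\Psi(\tau)=\frac{\mathbb{E}\left(|L(1,\mathbb{X})|^{-2\tilde\kappa}\right)\zeta(3)^{\tilde\kappa}}{\tilde\kappa\sqrt{2\pi\widetilde{\mathcal{L}}''(\tilde\kappa)}\,(e^\gamma\tau^2)^{\tilde\kappa}}\left(1+O\left(\sqrt{\frac{\log\tilde\kappa}{\tilde\kappa}}\right)\right),$$ where $\kappa=\kappa(\tau)$ is the unique real solution of $\mathcal{L}'(\kappa)=2(\log\tau+\gamma)$ and $\tilde\kappa=\tilde\kappa(\tau)$ is the unique real solution of $\widetilde{\mathcal{L}}'(\tilde\kappa)=2\log\tau+\gamma-\log\zeta(3)$.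
   Context: The $\mathbb{X}(p)$ ($p$ prime) are independent random variables: for $p\equiv2\pmod3$ or $p=3$, uniform on $\{1,\omega_3,\omega_3^2\}$; for $p\equiv1\pmod3$, equal to $0$ with probability $\frac{2}{p+2}$ and to each of $1,\omega_3,\omega_3^2$ with probability $\frac{p}{3(p+2)}$ ($\omega_3=e^{2\pi i/3}$). $L(1,\mathbb{X})=\prod_p(1-\mathbb{X}(p)/p)^{-1}$. $\Phi(\tau)=\mathbb{P}(|L(1,\mathbb{X})|>e^\gamma\tau)$, $\Psi(\tau)=\mathbb{P}(|L(1,\mathbb{X})|<(\zeta(3)/e^\gamma)^{1/2}\tau^{-1})$. For real $r>0$, $\mathcal{L}(r)=\log\mathbb{E}(|L(1,\mathbb{X})|^{2r})$ and $\widetilde{\mathcal{L}}(r)=\log\mathbb{E}(|L(1,\mathbb{X})|^{-2r})$; derivatives are in $r$. $\gamma$ is Euler's constant. *)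

theory Defs
  imports "HOL-Probability.Probability" "HOL-Library.Landau_Symbols"
begin

definition omega3 :: complex where
  "omega3 = cis (2 * pi / 3)"

text \<open>Probability that X(p) takes the value z (p prime).\<close>
definition xweight :: "nat \<Rightarrow> complex \<Rightarrow> real" where
  "xweight p z =
     (if p mod 3 = 2 \<or> p = 3 then
        (if z \<in> {1, omega3, omega3\<^sup>2} then 1/3 else 0)
      else
        (if z = 0 then 2 / (real p + 2)
         else if z \<in> {1, omega3, omega3\<^sup>2} then real p / (3 * (real p + 2)) else 0))"

definition zeta3 :: real where
  "zeta3 = (\<Sum>n. 1 / (real (Suc n)) ^ 3)"

definition Lone :: "(nat \<Rightarrow> 'a \<Rightarrow> complex) \<Rightarrow> 'a \<Rightarrow> complex" where
  "Lone X \<omega> = lim (\<lambda>N. \<Prod>p\<in>{p. prime p \<and> p \<le> N}. inverse (1 - X p \<omega> / of_nat p))"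

definition Lcal :: "'a measure \<Rightarrow> (nat \<Rightarrow> 'a \<Rightarrow> complex) \<Rightarrow> real \<Rightarrow> real" where
  "Lcal M X r = ln (\<integral>\<omega>. norm (Lone X \<omega>) powr (2 * r) \<partial>M)"

definition Ltil :: "'a measure \<Rightarrow> (nat \<Rightarrow> 'a \<Rightarrow> complex) \<Rightarrow> real \<Rightarrow> real" where
  "Ltil M X r = ln (\<integral>\<omega>. norm (Lone X \<omega>) powr (- 2 * r) \<partial>M)"

definition Phi :: "'a measure \<Rightarrow> (nat \<Rightarrow> 'a \<Rightarrow> complex) \<Rightarrow> real \<Rightarrow> real" where
  "Phi M X \<tau> = measure M {\<omega> \<in> space M. norm (Lone X \<omega>) > exp euler_mascheroni * \<tau>}"

definition Psi :: "'a measure \<Rightarrow> (nat \<Rightarrow> 'a \<Rightarrow> complex) \<Rightarrow> real \<Rightarrow> real" where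
  "Psi M X \<tau> = measure M {\<omega> \<in> space M.
      norm (Lone X \<omega>) < sqrt (zeta3 / exp euler_mascheroni) * inverse \<tau>}"

definition kappa :: "'a measure \<Rightarrow> (nat \<Rightarrow> 'a \<Rightarrow> complex) \<Rightarrow> real \<Rightarrow> real" where
  "kappa M X \<tau> = (THE k. k > 0 \<and> deriv (Lcal M X) k = 2 * (ln \<tau> + euler_mascheroni))"

definition kappat :: "'a measure \<Rightarrow> (nat \<Rightarrow> 'a \<Rightarrow> complex) \<Rightarrow> real \<Rightarrow> real" where
  "kappat M X \<tau> = (THE k. k > 0 \<and>
      deriv (Ltil M X) k = 2 * ln \<tau> + euler_mascheroni - ln zeta3)"

end

theory Submission
  imports Defs "HOL-Real_Asymp.Real_Asymp"
begin

text \<open>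
  Put \<open>W = 2 ln |L(1,X)|\<close> for the upper tail and \<open>W = - 2 ln |L(1,X)|\<close> for the lower one; both are sums of
  independent variables \<open>W\<^sub>p = O(1/p)\<close>. Let \<open>K\<close> be the cumulant generating function of \<open>W\<close>, let
  \<open>K' \<kappa> = a\<close>, and tilt the measure by \<open>exp (\<kappa> W)\<close>. Then \<open>U = W - a\<close> is centred with variance
  \<open>s\<^sup>2 = K'' \<kappa>\<close>, and \<open>P(W > a) = exp (K \<kappa> - \<kappa> a) E[exp (- \<kappa> U); U > 0]\<close> with the expectation taken
  under the tilted law.

  Chebyshev's bounds for primes show that \<open>s\<^sup>2\<close> is at least of order \<open>1/(\<kappa> ln \<kappa>)\<close> while the third absolute
  moments add up to \<open>O(1/(\<kappa>\<^sup>2 ln \<kappa>))\<close>. So the characteristic function of \<open>U\<close> is close to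
  \<open>exp (- s\<^sup>2 t\<^sup>2 / 2)\<close> for \<open>|t| \<le> c \<kappa>\<close>, and the primes much larger than \<open>|t|\<close> make it smaller than \<open>1/t\<^sup>4\<close>
  beyond. Levy inversion then gives \<open>P(0 < U \<le> v) = v/(s sqrt (2 pi))\<close> up to a relative error of
  \<open>O(sqrt (ln \<kappa>/\<kappa>))\<close> and a quadratic term in \<open>v\<close>, and averaging over an exponential variable \<open>v\<close> of
  rate \<open>\<kappa>\<close> yields the theorem; no Edgeworth correction is needed.
\<close>

section \<open>Chebyshev bounds\<close>

text \<open>By the lower bound on s^2, the scale 1/\<kappa> of the exponential variable is smaller
  than s by a factor 1/(\<kappa> s) of at most that order, and the third moments divided by s^3 are
  again of that order. Orders of magnitude thus suffice for all sums over primes, with crude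
  constants. Primes well below \<kappa> are almost frozen by the tilt at their most favourable
  value, primes above \<kappa> are hardly affected; hence max(p,\<kappa>) in all moment bounds, and
  hence the gap below the top value. The obstacle in passing to infinitely many primes is that W_p
  is only O(1/p), which has no summable bound. The means are summable only through cancellation,
  \<open>W\<close> exists only as an almost sure limit, and expectations pass to the limit through
  bounded second moments instead of domination. Both tails are treated at once by a sign; they
  differ in where W_p is largest, at 1 or at the two other cube roots of unity.\<close>

text \<open>
  The entries $1/(k\binom nk)$ of Leibniz's harmonic triangle satisfy $L(n-1,k)=L(n,k)+L(n,k+1)$. Hence
  $n\binom{2n}n$ divides every common multiple of $1,\dots,2n$, which replaces Legendre's formula in
  the Chebyshev lower bound.
\<close>

lemma Leibniz_triangle_Ints:
  fixes P :: nat
  assumes dvd: "\<And>j. 1 \<le> j \<Longrightarrow> j \<le> N \<Longrightarrow> j dvd P"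
  shows "1 \<le> k \<Longrightarrow> n = k + d \<Longrightarrow> n \<le> N \<Longrightarrow> real P / (real k * real (n choose k)) \<in> \<int>"
proof (induction d arbitrary: n k)
  case 0
  then obtain c where "P = k * c" using dvd[of k] by (auto elim: dvdE)
  thus ?case using 0 by (auto simp: Ints_of_nat)
next
  case (Suc d)
  define C where "C = real (n choose k)"
  have n: "n = Suc (k + d)" using Suc.prems by simp
  have Cpos: "C > 0" using n by (auto simp: C_def zero_less_binomial_iff)
  have a: "real (Suc k) * real (n choose Suc k) = real (n - k) * C"
    unfolding C_def using binomial_absorb_comp[of n k] binomial_absorption[of k n]
    by (metis Suc_times_binomial_eq binomial_absorption of_nat_mult diff_Suc_1 n)
  have b: "real n * real ((n - 1) choose k) = real (n - k) * C"
    unfolding C_def using binomial_absorb_comp[of n k] by (metis of_nat_mult)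
  \<comment> \<open>The recurrence is solved for the entry (n,k): the entries (n-1,k) and (n,k+1) on
    the right are both one step closer to the diagonal, which is why the induction runs on d = n -
    k.\<close>
  have "real P / (real k * C) = real P / (real k * real ((n - 1) choose k))
      - real P / (real (Suc k) * real (n choose Suc k))"
  proof -
    have c: "real ((n - 1) choose k) = real (n - k) * C / real n"
      using b n by (simp add: field_simps)
    have d: "real (n - k) = real n - real k" "real n - real k > 0" using n by simp_all
    have "P' / (k' * C) = P' / (k' * ((n' - k') * C / n')) - P' / ((n' - k') * C)"
      if "k' > 0" "n' - k' > 0" for P' k' n' :: real
    proof -
      have "P' / (k' * ((n' - k') * C / n')) = P' * n' / (k' * (n' - k') * C)" by simp
      moreover have "P' / ((n' - k') * C) = P' * k' / (k' * (n' - k') * C)" using that by simp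
      moreover have "P' / (k' * C) = P' * (n' - k') / (k' * (n' - k') * C)" using that by simp
      ultimately show ?thesis by (simp add: diff_divide_distrib right_diff_distrib)
    qed
    thus ?thesis unfolding a c d(1) using d(2) Suc.prems(1) by simp
  qed
  moreover have "real P / (real k * real ((n - 1) choose k)) \<in> \<int>"
    using Suc.IH[of k "n - 1"] Suc.prems n by simp
  moreover have "real P / (real (Suc k) * real (n choose Suc k)) \<in> \<int>"
    using Suc.IH[of "Suc k" n] Suc.prems n by simp
  ultimately show ?case unfolding C_def by (metis Ints_diff)
qed

definition prime_count :: "nat \<Rightarrow> nat" where
  "prime_count n = card {p. prime p \<and> p \<le> n}"

lemma finite_primes_le [simp]: "finite {p::nat. prime p \<and> p \<le> n}"
  by (rule finite_subset[of _ "{..n}"]) auto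

lemma prime_count_mono: "m \<le> n \<Longrightarrow> prime_count m \<le> prime_count n"
  unfolding prime_count_def by (intro card_mono) auto

text \<open>The witness is the least common multiple of 1, ..., m: it collects for each prime the
  largest power \<open>p ^ e p\<close> not exceeding m, so each of its \<open>prime_count m\<close>
  factors is at most m.\<close>

lemma common_multiple_le_power_prime_count:
  assumes "m \<ge> 1"
  obtains P :: nat where "\<And>j. 1 \<le> j \<Longrightarrow> j \<le> m \<Longrightarrow> j dvd P" "P \<ge> 1" "P \<le> m ^ prime_count m"
proof -
  have "\<exists>e. p ^ e \<le> m \<and> m < p ^ Suc e" if "prime p" for p :: nat
    using ex_power_ivl1[of p m] prime_ge_2_nat[OF that] assms by auto
  then obtain e where e: "\<And>p. prime p \<Longrightarrow> p ^ e p \<le> m" "\<And>p. prime p \<Longrightarrow> m < p ^ Suc (e p)"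
    by metis
  define A where "A = {p. prime p \<and> p \<le> m}"
  define P where "P = (\<Prod>p\<in>A. p ^ e p)"
  have A: "finite A" "\<And>p. p \<in> A \<Longrightarrow> prime p" by (auto simp: A_def)
  have P0: "P \<noteq> 0" using A(1) A(2)[of 0] by (auto simp: P_def prod_zero_iff)
  have dvd: "j dvd P" if j: "1 \<le> j" "j \<le> m" for j
  proof (rule multiplicity_le_imp_dvd)
    show "j \<noteq> 0" using j by auto
    fix p :: nat assume p: "prime p"
    show "multiplicity p j \<le> multiplicity p P"
    proof (cases "p \<in> A")
      case True
      have "p ^ multiplicity p j dvd j" by (rule multiplicity_dvd)
      hence "p ^ multiplicity p j \<le> m" using j dvd_imp_le[of "p ^ multiplicity p j" j] by simp
      hence "p ^ multiplicity p j < p ^ Suc (e p)" using e(2)[OF p] by simp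
      hence "multiplicity p j < Suc (e p)"
        by (rule power_less_imp_less_exp[OF prime_gt_1_nat[OF p]])
      hence "multiplicity p j \<le> e p" by simp
      moreover have "p ^ e p dvd P" unfolding P_def using A(1) True by (rule dvd_prodI)
      hence "e p \<le> multiplicity p P"
        using P0 p by (intro multiplicity_geI) auto
      ultimately show ?thesis by simp
    next
      case False
      hence "\<not> p dvd j" using p j unfolding A_def using dvd_imp_le[of p j] by auto
      thus ?thesis by (simp add: not_dvd_imp_multiplicity_0)
    qed
  qed
  have "P \<le> (\<Prod>p\<in>A. m)" unfolding P_def using e A by (intro prod_mono) auto
  also have "\<dots> = m ^ prime_count m" by (simp add: prime_count_def A_def)
  finally show ?thesis using that[of P] dvd P0 by auto
qed

text \<open>The common multiple is at least n binom(2n,n) >= 4^n/2 and at most (2n)^(prime_count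
  (2n)). Logarithms leave 2n - 1 copies of ln 2, of which n are kept.\<close>

lemma prime_count_lower:
  assumes "n \<ge> 1"
  shows "real n * ln 2 \<le> real (prime_count (2 * n)) * ln (real (2 * n))"
proof -
  obtain P where P: "\<And>j. 1 \<le> j \<Longrightarrow> j \<le> 2 * n \<Longrightarrow> j dvd P" "P \<ge> 1"
    "P \<le> (2 * n) ^ prime_count (2 * n)"
    using common_multiple_le_power_prime_count[of "2 * n"] assms by auto
  have C: "real ((2 * n) choose n) > 0" by (simp add: zero_less_binomial_iff)
  have "real P / (real n * real ((2 * n) choose n)) \<in> \<int>"
    using Leibniz_triangle_Ints[of "2 * n" P n "2 * n" n] P(1) assms by auto
  moreover have "real P / (real n * real ((2 * n) choose n)) > 0" using P(2) C assms by auto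
  ultimately have "real P / (real n * real ((2 * n) choose n)) \<ge> 1"
    by (auto elim!: Ints_cases)
  hence "real n * real ((2 * n) choose n) \<le> real P"
    using C assms by (simp add: field_simps)
  moreover have "4 ^ n / (2 * real n) \<le> real ((2 * n) choose n)"
    using central_binomial_lower_bound[of n] assms by simp
  ultimately have "4 ^ n / 2 \<le> real P" using assms by (simp add: field_simps)
  also have "real P \<le> real (2 * n) ^ prime_count (2 * n)" using P(3) by (metis of_nat_le_iff of_nat_power)
  finally have "ln (4 ^ n / 2) \<le> ln (real (2 * n) ^ prime_count (2 * n))"
    using assms by (subst ln_le_cancel_iff) auto
  hence "ln (4 ^ n / 2) \<le> real (prime_count (2 * n)) * ln (real (2 * n))"
    using assms by (subst (asm) ln_realpow) auto
  moreover have "ln (4 ^ n / 2 :: real) = 2 * real n * ln 2 - ln 2"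
    using ln_realpow[of 2 2] by (simp add: ln_div ln_realpow)
  moreover have "(real n - 1) * ln 2 \<ge> 0" using assms by simp
  ultimately show ?thesis by (simp only: left_diff_distrib)
qed

lemma prod_primes_dvd_nat:
  fixes N :: nat
  assumes "finite A" "\<And>p. p \<in> A \<Longrightarrow> prime p" "\<And>p. p \<in> A \<Longrightarrow> p dvd N"
  shows "\<Prod>A dvd N"
  using assms
proof (induction A rule: finite_induct)
  case (insert p A)
  have "coprime p (\<Prod>A)"
    using insert by (intro prod_coprime_right) (auto intro!: primes_coprime)
  thus ?case using insert by (auto intro!: divides_mult)
qed auto

text \<open>With n = 2^k, the primes in (n,2n] all divide binom(2n,n), so n to the power of their
  number is at most 4^n.\<close>

lemma prime_count_dyadic_step:
  "k * prime_count (2 ^ Suc k) \<le> k * prime_count (2 ^ k) + 2 * 2 ^ k"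
proof -
  define n :: nat where "n = 2 ^ k"
  define A where "A = {p. prime p \<and> n < p \<and> p \<le> 2 * n}"
  have fA: "finite A" by (rule finite_subset[of _ "{..2 * n}"]) (auto simp: A_def)
  have "p dvd ((2 * n) choose n)" if "p \<in> A" for p
  proof -
    have p: "prime p" "n < p" "p \<le> 2 * n" using that by (auto simp: A_def)
    have "p dvd fact (2 * n)" using p by (simp add: prime_dvd_fact_iff)
    moreover have "fact (2 * n) = fact n * fact n * ((2 * n) choose n)"
      using binomial_fact_lemma[of n "2 * n"] by (simp add: mult_2)
    ultimately show ?thesis using p by (auto simp: prime_dvd_mult_iff prime_dvd_fact_iff)
  qed
  hence "\<Prod>A dvd ((2 * n) choose n)" using fA by (intro prod_primes_dvd_nat) (auto simp: A_def)
  hence "\<Prod>A \<le> ((2 * n) choose n)" by (intro dvd_imp_le) (auto simp: zero_less_binomial_iff)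
  also have "\<dots> \<le> 2 ^ (2 * n)" by (rule binomial_le_pow2)
  finally have 1: "\<Prod>A \<le> 2 ^ (2 * n)" .
  have "n ^ card A = (\<Prod>p\<in>A. n)" by simp
  also have "\<dots> \<le> \<Prod>A" by (intro prod_mono) (auto simp: A_def)
  finally have "(2::nat) ^ (k * card A) \<le> 2 ^ (2 * n)" using 1 by (simp add: n_def power_mult)
  hence 2: "k * card A \<le> 2 * n" by simp
  have "{p. prime p \<and> p \<le> 2 * n} = {p. prime p \<and> p \<le> n} \<union> A" by (auto simp: A_def)
  hence "prime_count (2 * n) \<le> prime_count n + card A"
    unfolding prime_count_def by (metis card_Un_le)
  hence "k * prime_count (2 * n) \<le> k * prime_count n + k * card A"
    by (metis add_mult_distrib2 mult_le_mono2)
  thus ?thesis using 2 by (simp add: n_def)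
qed

lemma prime_count_power2: "k * prime_count (2 ^ k) \<le> 6 * 2 ^ k"
proof (induction k)
  case (Suc k)
  show ?case
  proof (cases "k < 2")
    case True
    have "prime_count (2 ^ Suc k) \<le> card {1..2 ^ Suc k :: nat}"
      unfolding prime_count_def by (intro card_mono) (auto dest: prime_ge_1_nat)
    hence "Suc k * prime_count (2 ^ Suc k) \<le> Suc k * 2 ^ Suc k" by (intro mult_le_mono2) simp
    also have "\<dots> \<le> 6 * 2 ^ Suc k" using True by simp
    finally show ?thesis .
  next
    case False
    define c where "c = prime_count (2 ^ Suc k)"
    \<comment> \<open>Here 8 = 6 + 2. As k >= 2, also c <= 4 * 2^k, and 8 + 4 = 2 * 6 closes the
      induction; this determines the constant 6.\<close>
    have "k * c \<le> 8 * 2 ^ k" unfolding c_def using prime_count_dyadic_step[of k] Suc by linarith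
    moreover have "2 * c \<le> k * c" using False by (intro mult_le_mono1) simp
    ultimately have "c + k * c \<le> 6 * 2 ^ Suc k" unfolding power_Suc by linarith
    thus ?thesis unfolding c_def[symmetric] by simp
  qed
qed auto

text \<open>The factor ln 2 is retained because this bound is later subtracted from a lower bound 13
  x ln 2 / ln x, and the two must be comparable exactly.\<close>

lemma prime_count_upper:
  assumes "x \<ge> 2" "real n \<le> x"
  shows "real (prime_count n) \<le> 12 * x * ln 2 / ln x"
proof -
  let ?y = "nat \<lfloor>x\<rfloor>"
  obtain k where k: "2 ^ k \<le> ?y" "?y < 2 ^ Suc k"
    using ex_power_ivl1[of 2 "?y"] assms by (force simp: le_nat_floor)
  have x1: "x < 2 ^ Suc k"
  proof -
    have "?y + 1 \<le> 2 ^ Suc k" using k by simp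
    hence "real (?y + 1) \<le> real (2 ^ Suc k)" by (rule of_nat_mono)
    moreover have "x < real (?y + 1)" using assms by linarith
    ultimately show ?thesis by simp
  qed
  have x2: "2 ^ k \<le> x"
  proof -
    have "real (2 ^ k) \<le> real ?y" using k(1) by (rule of_nat_mono)
    also have "\<dots> \<le> x" using assms by simp
    finally show ?thesis by simp
  qed
  have "real n < real (2 ^ Suc k)" using x1 assms by simp
  hence "prime_count n \<le> prime_count (2 ^ Suc k)"
    by (intro prime_count_mono) (metis of_nat_less_iff less_imp_le)
  hence "Suc k * prime_count n \<le> 6 * 2 ^ Suc k"
    using prime_count_power2[of "Suc k"] by (meson le_trans mult_le_mono2)
  hence "real (Suc k * prime_count n) \<le> real (6 * 2 ^ Suc k)" by (rule of_nat_mono)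
  hence *: "real (Suc k) * real (prime_count n) \<le> 12 * x" using x2 by (simp only: of_nat_mult) simp
  have "ln x \<le> ln (2 ^ Suc k)" using x1 assms by simp
  also have "\<dots> = real (Suc k) * ln 2" by (subst ln_realpow) auto
  finally have "ln x * real (prime_count n) \<le> real (Suc k) * ln 2 * real (prime_count n)"
    by (intro mult_right_mono) auto
  also have "\<dots> = real (Suc k) * real (prime_count n) * ln 2" by simp
  also have "\<dots> \<le> 12 * x * ln 2" using * by (intro mult_right_mono) auto
  finally show ?thesis using assms by (simp add: field_simps)
qed

lemma prime_count_upper_simple:
  assumes "x \<ge> 2" "real n \<le> x"
  shows "real (prime_count n) \<le> 12 * x / ln x"
proof -
  have "12 * x * ln 2 / ln x \<le> 12 * x * 1 / ln x"
    using assms ln_2_less_1 by (intro divide_right_mono mult_left_mono) auto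
  thus ?thesis using prime_count_upper[OF assms] by simp
qed

section \<open>Sums over primes: max(p,x)^(-3), and p^(-2) beyond x\<close>

lemma sum_primes_max_cube_dyadic:
  fixes x :: real
  assumes "x \<ge> 2"
  shows "(\<Sum>p | prime p \<and> real p \<le> 2 ^ J * x. 1 / (max (real p) x) ^ 3)
          \<le> 12 / (x\<^sup>2 * ln x) * (4 - 3 / 4 ^ J)"
proof (induction J)
  case 0
  have eq: "{p. prime p \<and> real p \<le> x} = {p. prime p \<and> p \<le> nat \<lfloor>x\<rfloor>}"
    using assms by (auto simp: le_nat_floor) linarith
  have "(\<Sum>p | prime p \<and> real p \<le> x. 1 / (max (real p) x) ^ 3) =
      (\<Sum>p | prime p \<and> real p \<le> x. 1 / x ^ 3)" by (intro sum.cong) (auto simp: max_def)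
  also have "\<dots> = real (prime_count (nat \<lfloor>x\<rfloor>)) * (1 / x ^ 3)"
    unfolding eq by (simp add: prime_count_def)
  also have "\<dots> \<le> 12 * x / ln x * (1 / x ^ 3)"
    using assms by (intro mult_right_mono prime_count_upper_simple) auto
  also have "\<dots> = 12 / (x\<^sup>2 * ln x)" using assms
    by (simp add: power2_eq_square power3_eq_cube)
  finally show ?case by simp
next
  case (Suc J)
  define y where "y = 2 ^ J * x"
  have y: "y \<ge> x" using assms by (simp add: y_def)
  have fin: "finite {p::nat. prime p \<and> real p \<le> z}" for z
    by (rule finite_subset[of _ "{..nat \<lfloor>z\<rfloor>}"]) (auto simp: le_nat_floor)
  define A where "A = {p. prime p \<and> real p \<le> 2 * y} - {p. prime p \<and> real p \<le> y}"
  have "card A \<le> prime_count (nat \<lfloor>2 * y\<rfloor>)"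
    unfolding prime_count_def A_def by (intro card_mono) (auto simp: le_nat_floor)
  hence "real (card A) \<le> real (prime_count (nat \<lfloor>2 * y\<rfloor>))" by simp
  also have "\<dots> \<le> 12 * (2 * y) / ln (2 * y)"
    using y assms by (intro prime_count_upper_simple) auto
  also have "\<dots> \<le> 12 * (2 * y) / ln x"
    using y assms by (intro divide_left_mono) auto
  finally have card: "real (card A) \<le> 12 * (2 * y) / ln x" .
  have "(\<Sum>p\<in>A. 1 / (max (real p) x) ^ 3) \<le> (\<Sum>p\<in>A. 1 / y ^ 3)"
    using y assms by (intro sum_mono divide_left_mono power_mono) (auto simp: A_def)
  also have "\<dots> = real (card A) * (1 / y ^ 3)" by simp
  also have "\<dots> \<le> 12 * (2 * y) / ln x * (1 / y ^ 3)"
    using card y assms by (intro mult_right_mono) auto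
  also have "\<dots> = 24 / (y\<^sup>2 * ln x)" using y assms
    by (simp add: power2_eq_square power3_eq_cube)
  also have "y\<^sup>2 = 4 ^ J * x\<^sup>2"
  proof -
    have "(4::real) ^ J = (2 * 2) ^ J" by simp
    thus ?thesis unfolding y_def power_mult_distrib power2_eq_square by simp
  qed
  finally have A: "(\<Sum>p\<in>A. 1 / (max (real p) x) ^ 3) \<le> 12 / (x\<^sup>2 * ln x) * (2 / 4 ^ J)"
    by (simp add: mult_ac)
  have "(\<Sum>p | prime p \<and> real p \<le> 2 * y. 1 / (max (real p) x) ^ 3) =
      (\<Sum>p\<in>A. 1 / (max (real p) x) ^ 3) + (\<Sum>p | prime p \<and> real p \<le> y. 1 / (max (real p) x) ^ 3)"
    unfolding A_def using fin y assms by (intro sum.subset_diff) auto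
  also have "\<dots> \<le> 12 / (x\<^sup>2 * ln x) * (2 / 4 ^ J) + 12 / (x\<^sup>2 * ln x) * (4 - 3 / 4 ^ J)"
    using A Suc unfolding y_def by simp
  \<comment> \<open>In units of 12/(x^2 ln x) the block (2^J x, 2^(J+1) x] costs 2/4^J, while
    passing from 4 - 3/4^J to 4 - 3/4^(J+1) allows 9/4 times 1/4^J.\<close>
  also have "\<dots> \<le> 12 / (x\<^sup>2 * ln x) * (4 - 3 / 4 ^ Suc J)"
    using assms unfolding distrib_left[symmetric]
    by (intro mult_left_mono) (auto simp: field_simps)
  finally show ?case by (simp add: y_def mult_ac)
qed

text \<open>Applied with x = r: under the tilt r the third absolute moment at p is at most a
  constant over max(p,r)^3, and every partial sum has to be bounded. Primes up to x contribute their
  number over x^3, larger ones a geometric series of dyadic blocks.\<close>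

lemma sum_primes_max_cube:
  fixes x :: real
  assumes "x \<ge> 2" "finite A" "\<And>p. p \<in> A \<Longrightarrow> prime p"
  shows "(\<Sum>p\<in>A. 1 / (max (real p) x) ^ 3) \<le> 48 / (x\<^sup>2 * ln x)"
proof -
  obtain J where J: "real (Max (insert 0 A)) < 2 ^ J" using real_arch_pow[of 2 "real (Max (insert 0 A))"] by auto
  have "real p \<le> 2 ^ J * x" if "p \<in> A" for p
  proof -
    have "real p \<le> real (Max (insert 0 A))" using that assms by simp
    also have "\<dots> \<le> 2 ^ J * 1" using J by simp
    also have "\<dots> \<le> 2 ^ J * x" using assms by (intro mult_left_mono) auto
    finally show ?thesis .
  qed
  moreover have "finite {p::nat. prime p \<and> real p \<le> 2 ^ J * x}"
    by (rule finite_subset[of _ "{..nat \<lfloor>2 ^ J * x\<rfloor>}"]) (auto simp: le_nat_floor)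
  ultimately have "(\<Sum>p\<in>A. 1 / (max (real p) x) ^ 3) \<le>
      (\<Sum>p | prime p \<and> real p \<le> 2 ^ J * x. 1 / (max (real p) x) ^ 3)"
    using assms by (intro sum_mono2) auto
  also have "\<dots> \<le> 12 / (x\<^sup>2 * ln x) * (4 - 3 / 4 ^ J)"
    by (rule sum_primes_max_cube_dyadic[OF assms(1)])
  also have "\<dots> \<le> 12 / (x\<^sup>2 * ln x) * 4" using assms(1) by (intro mult_left_mono) auto
  finally show ?thesis by simp
qed

text \<open>The two Chebyshev bounds guarantee primes only in a long interval. With n = 26 ceil(x),
  the primes up to 2n number at least 13 x ln 2 / ln x (half of 26, because 2n <= 104 x <= x^2),
  those up to x at most 12 x ln 2 / ln x. So (x, 104 x] contains at least x ln 2 / ln x primes, each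
  contributing at least 1/(104 x)^2. The hypothesis x >= 104 gives 104 x <= x^2.\<close>

lemma sum_primes_square_tail_lower:
  fixes x :: real
  assumes x: "x \<ge> 104"
  obtains F :: "nat set" where "finite F" "\<And>p. p \<in> F \<Longrightarrow> prime p \<and> x < real p"
    "1 / (104\<^sup>2 * 2 * (x * ln x)) \<le> (\<Sum>p\<in>F. 1 / (real p)\<^sup>2)"
proof -
  define n where "n = 26 * nat \<lceil>x\<rceil>"
  have n: "26 * x \<le> real n" "real n \<le> 52 * x" "n \<ge> 1" using x unfolding n_def by linarith+
  define F where "F = {p. prime p \<and> p \<le> 2 * n} - {p. prime p \<and> p \<le> nat \<lfloor>x\<rfloor>}"
  have F: "finite F" "\<And>p. p \<in> F \<Longrightarrow> prime p \<and> x < real p \<and> real p \<le> 104 * x"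
    using n x by (auto simp: F_def nat_le_iff) linarith+
  have l: "ln x > 0" using x by simp
  have "26 * x * ln 2 \<le> real n * ln 2" using n by simp
  also have "\<dots> \<le> real (prime_count (2 * n)) * ln (real (2 * n))" by (rule prime_count_lower[OF n(3)])
  also have "\<dots> \<le> real (prime_count (2 * n)) * (2 * ln x)"
  proof (intro mult_left_mono)
    have "ln (real (2 * n)) \<le> ln (x * x)"
      using n x by (subst ln_le_cancel_iff) (auto intro: order.trans[of _ "104 * x"])
    thus "ln (real (2 * n)) \<le> 2 * ln x" using x by (simp add: ln_mult)
  qed auto
  finally have 1: "13 * x * ln 2 / ln x \<le> real (prime_count (2 * n))" using l by (simp add: field_simps)
  have 2: "real (prime_count (nat \<lfloor>x\<rfloor>)) \<le> 12 * x * ln 2 / ln x"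
    using x by (intro prime_count_upper) auto
  have "card F = prime_count (2 * n) - prime_count (nat \<lfloor>x\<rfloor>)"
    unfolding F_def prime_count_def
  proof (intro card_Diff_subset)
    have "nat \<lfloor>x\<rfloor> \<le> 2 * n" using n x by linarith
    thus "{p. prime p \<and> p \<le> nat \<lfloor>x\<rfloor>} \<subseteq> {p. prime p \<and> p \<le> 2 * n}" by auto
  qed auto
  hence "real (card F) \<ge> 13 * x * ln 2 / ln x - 12 * x * ln 2 / ln x" 
    using 1 2 by (simp add: of_nat_diff) 
  also have "13 * x * ln 2 / ln x - 12 * x * ln 2 / ln x = x * ln 2 / ln x"
    by (simp add: field_simps)
  finally have "real (card F) \<ge> x * ln 2 / ln x" .
  moreover have "x * (1/2) / ln x \<le> x * ln 2 / ln x"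
    using l x ln2_ge_two_thirds by (intro divide_right_mono mult_left_mono) auto
  ultimately have 3: "real (card F) \<ge> x / (2 * ln x)" by simp
  have "1 / (104\<^sup>2 * 2 * (x * ln x)) = x / (2 * ln x) * (1 / (104 * x)\<^sup>2)"
    using x l by (simp add: field_simps power2_eq_square)
  also have "\<dots> \<le> real (card F) * (1 / (104 * x)\<^sup>2)" using 3 by (intro mult_right_mono) auto
  also have "\<dots> = (\<Sum>p\<in>F. 1 / (104 * x)\<^sup>2)" by simp
  also have "\<dots> \<le> (\<Sum>p\<in>F. 1 / (real p)\<^sup>2)"
  proof (intro sum_mono divide_left_mono power_mono)
    fix p assume "p \<in> F"
    hence "x < real p" "real p \<le> 104 * x" using F by auto
    thus "real p \<le> 104 * x" "0 < (104 * x)\<^sup>2 * (real p)\<^sup>2" using x by auto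
  qed auto
  finally show ?thesis using that F by blast
qed

section \<open>Fourier inversion near the origin\<close>

lemma norm_Levy_kernel_mult_le:
  fixes a b t :: real
  assumes "a \<le> b"
  shows "cmod ((iexp (-(t * a)) - iexp (-(t * b))) / (\<i> * t) * z) \<le> (b - a) * cmod z"
proof -
  have "cmod ((iexp (-(t * a)) - iexp (-(t * b))) / (\<i> * t)) \<le> b - a"
  proof (cases "t = 0")
    case False
    thus ?thesis using Levy_Inversion_aux2[of "-b" "-a" t] assms by simp
  qed (use assms in auto)
  thus ?thesis by (subst norm_mult) (rule mult_right_mono, auto)
qed

context real_distribution
begin

text \<open>Integrability of the characteristic function dominates the truncated integrals in Levy's
  formula by (b - a) |char|, so their limit is a Lebesgue integral over the whole line.\<close>

lemma measure_Ioc_Fourier_inversion: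
  assumes int: "integrable lborel (char M)"
    and "a \<le> b" "measure M {a} = 0" "measure M {b} = 0"
  shows "complex_of_real (measure M {a<..b}) =
    1 / (2 * pi) * (CLBINT t. (iexp (-(t * a)) - iexp (-(t * b))) / (\<i> * t) * char M t)"
proof -
  let ?F = "\<lambda>t::real. (iexp (-(t * a)) - iexp (-(t * b))) / (\<i> * t)"
  have "(\<lambda>n::nat. CLBINT t. indicator {- real n<..<real n} t *\<^sub>R (?F t * char M t))
      \<longlonglongrightarrow> (CLBINT t. ?F t * char M t)"
  proof (rule integral_dominated_convergence[where w = "\<lambda>t. (b - a) * cmod (char M t)"])
    show "integrable lborel (\<lambda>t. (b - a) * cmod (char M t))" using int by auto
    show "AE x in lborel. (\<lambda>n. indicator {- real n<..<real n} x *\<^sub>R (?F x * char M x))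
        \<longlonglongrightarrow> ?F x * char M x"
    proof (intro AE_I2 tendsto_eventually)
      fix x :: real
      have "eventually (\<lambda>n. \<bar>x\<bar> < real n) sequentially" by real_asymp
      thus "eventually (\<lambda>n. indicator {- real n<..<real n} x *\<^sub>R (?F x * char M x)
          = ?F x * char M x) sequentially"
        by eventually_elim (auto simp: indicator_def)
    qed
    show "AE x in lborel. cmod (indicator {- real n<..<real n} x *\<^sub>R (?F x * char M x))
        \<le> (b - a) * cmod (char M x)" for n
      using norm_Levy_kernel_mult_le[OF \<open>a \<le> b\<close>] \<open>a \<le> b\<close>
      by (intro AE_I2) (simp add: indicator_def del: times_divide_eq_left times_divide_eq_right)
  qed auto
  moreover have "(CLBINT t. indicator {- real n<..<real n} t *\<^sub>R (?F t * char M t))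
      = (CLBINT t=-real n..real n. ?F t * char M t)" for n
    by (simp add: interval_lebesgue_integral_def set_lebesgue_integral_def)
  ultimately have "(\<lambda>n::nat. 1 / (2 * pi) * (CLBINT t=-real n..real n. ?F t * char M t))
      \<longlonglongrightarrow> 1 / (2 * pi) * (CLBINT t. ?F t * char M t)"
    by (intro tendsto_intros) simp
  moreover have "(\<lambda>n::nat. 1 / (2 * pi) * (CLBINT t=-real n..real n. ?F t * char M t))
      \<longlonglongrightarrow> complex_of_real (measure M {a<..b})"
    using Levy_Inversion[of a b] assms by simp
  ultimately show ?thesis by (rule LIMSEQ_unique[rotated])
qed

text \<open>Inversion applies only at endpoints that are not atoms, but atoms are countable:
  endpoints without mass exist within h on either side of x, and the resulting bound h I tends to 0
  with h. Afterwards inversion is available at all endpoints.\<close>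

lemma measure_singleton_eq_0:
  assumes int: "integrable lborel (char M)"
  shows "measure M {x} = 0"
proof -
  define I where "I = (LBINT t. cmod (char M t))"
  have I: "I \<ge> 0" unfolding I_def by simp
  have "measure M {x} \<le> h * I" if h: "h > 0" for h
  proof -
    have cnt: "countable {x. measure M {x} \<noteq> 0}" using countable_support by simp
    obtain a where a: "x - h < a" "a < x" "measure M {a} = 0"
      using open_minus_countable[OF cnt, of "{x - h<..<x}"] h by auto
    obtain b where b: "x < b" "b < x + h" "measure M {b} = 0"
      using open_minus_countable[OF cnt, of "{x<..<x + h}"] h by auto
    let ?F = "\<lambda>t::real. (iexp (-(t * a)) - iexp (-(t * b))) / (\<i> * t)"
    have ab: "a \<le> b" using a b by simp
    have intF: "integrable lborel (\<lambda>t. ?F t * char M t)"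
    proof (rule Bochner_Integration.integrable_bound[where f = "\<lambda>t. (b - a) * cmod (char M t)"])
      show "AE x in lborel. cmod (?F x * char M x) \<le> norm ((b - a) * cmod (char M x))"
        using norm_Levy_kernel_mult_le[OF ab] ab
        by (intro AE_I2) (simp add: abs_mult del: times_divide_eq_left times_divide_eq_right)
    qed (use int in auto)
    have "measure M {x} \<le> measure M {a<..b}"
      using a b by (intro finite_measure_mono) auto
    also have "\<dots> = cmod (complex_of_real (measure M {a<..b}))" by simp
    also have "\<dots> = 1 / (2 * pi) * cmod (CLBINT t. ?F t * char M t)"
      by (subst measure_Ioc_Fourier_inversion[OF int]) (use a b in \<open>auto simp: norm_mult norm_divide\<close>)
    also have "cmod (CLBINT t. ?F t * char M t) \<le> (LBINT t. cmod (?F t * char M t))"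
      by (rule integral_norm_bound)
    also have "\<dots> \<le> (LBINT t. (b - a) * cmod (char M t))"
      using intF int by (intro integral_mono norm_Levy_kernel_mult_le[OF ab]) auto
    also have "\<dots> = (b - a) * I" by (simp add: I_def)
    finally have "measure M {x} \<le> 1 / (2 * pi) * ((b - a) * I)" by (simp add: divide_right_mono)
    also have "\<dots> \<le> 1 / 2 * (2 * h * I)"
      using a b I pi_gt3 by (intro mult_mono mult_right_mono mult_nonneg_nonneg) (auto simp: field_simps)
    finally show ?thesis by simp
  qed
  hence "((\<lambda>h. h * I) \<longlongrightarrow> 0 * I) (at_right 0) \<Longrightarrow> measure M {x} \<le> 0 * I"
    by (intro tendsto_lowerbound[of "\<lambda>h. h * I"]) (auto simp: eventually_at_right_less intro: eventually_mono[OF eventually_at_right_less])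
  moreover have "((\<lambda>h. h * I) \<longlongrightarrow> 0 * I) (at_right 0)" by (intro tendsto_intros)
  ultimately show ?thesis by (simp add: measure_le_0_iff)
qed

end

section \<open>Gaussian approximation of short intervals, and its exponential average\<close>

lemma has_bochner_integral_gaussian:
  assumes "s > (0::real)"
  shows "has_bochner_integral lborel (\<lambda>t. exp (- (s\<^sup>2 * t\<^sup>2 / 2))) (sqrt (2 * pi) / s)"
proof -
  have "has_bochner_integral lborel (\<lambda>t. sqrt (2 * pi) / s * normal_density 0 (1 / s) t) (sqrt (2 * pi) / s * 1)"
    using assms by (intro has_bochner_integral_mult_right)
      (auto simp: has_bochner_integral_iff integrable_normal_density)
  moreover have "sqrt (2 * pi) / s * normal_density 0 (1 / s) t = exp (- (s\<^sup>2 * t\<^sup>2 / 2))" for t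
    using assms by (simp add: normal_density_def real_sqrt_divide field_simps real_sqrt_mult power2_eq_square)
  ultimately show ?thesis by simp
qed

context real_distribution
begin

text \<open>The main term is v times the Gaussian density at 0. With F the Levy kernel and g the
  Gaussian, the integrand differs from v g by v (char - g) + (F - v) char, and |F - v| <= v^2 |t|/2
  because v is the limit of F at t = 0.\<close>

lemma measure_Ioc_gaussian_approx:
  assumes int: "integrable lborel (char M)" and int1: "integrable lborel (\<lambda>t. \<bar>t\<bar> * cmod (char M t))"
    and s: "s > 0" and v: "v \<ge> 0"
  shows "\<bar>measure M {0<..v} - v / (s * sqrt (2 * pi))\<bar> \<le>
     v / (2 * pi) * (LBINT t. cmod (char M t - exp (- (s\<^sup>2 * t\<^sup>2 / 2))))
     + v\<^sup>2 / (4 * pi) * (LBINT t. \<bar>t\<bar> * cmod (char M t))"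
proof -
  define g where "g = (\<lambda>t::real. exp (- (s\<^sup>2 * t\<^sup>2 / 2)))"
  let ?F = "\<lambda>t::real. (iexp (-(t * 0)) - iexp (-(t * v))) / (\<i> * t)"
  have g: "integrable lborel g" "(LBINT t. g t) = sqrt (2 * pi) / s"
    using has_bochner_integral_gaussian[OF s] by (auto simp: g_def has_bochner_integral_iff)
  have gc: "integrable lborel (\<lambda>t. complex_of_real (g t))" using g by simp
  have bound2: "cmod (?F t - v) \<le> v\<^sup>2 / 2 * \<bar>t\<bar>" if t: "t \<noteq> 0" for t
  proof -
    have "?F t - v = - (iexp (-(t * v)) - (1 + \<i> * -(t * v))) / (\<i> * t)"
      using t by (simp add: field_simps)
    hence "cmod (?F t - v) = cmod (iexp (-(t * v)) - (1 + \<i> * -(t * v))) / \<bar>t\<bar>"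
      by (simp add: norm_divide norm_mult norm_minus_commute)
    also have "\<dots> \<le> (t * v)\<^sup>2 / 2 / \<bar>t\<bar>"
      using iexp_approx1 [of "-(t * v)" 1]
      by (intro divide_right_mono abs_ge_zero) (auto simp: field_simps eval_nat_numeral)
    also have "\<dots> = v\<^sup>2 / 2 * \<bar>t\<bar>"
      using t by (cases "t > 0") (auto simp: field_simps power2_eq_square)
    finally show ?thesis .
  qed
  have intF: "integrable lborel (\<lambda>t. ?F t * char M t)"
  proof (rule Bochner_Integration.integrable_bound[where f = "\<lambda>t. v * cmod (char M t)"])
    show "AE x in lborel. cmod (?F x * char M x) \<le> norm (v * cmod (char M x))"
      using norm_Levy_kernel_mult_le[OF v] v
      by (intro AE_I2) (simp add: abs_mult del: times_divide_eq_left times_divide_eq_right)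
  qed (use int in auto)
  have D: "integrable lborel (\<lambda>t. cmod (char M t - g t))" using int gc by auto
  have "complex_of_real (measure M {0<..v} - v / (s * sqrt (2 * pi))) =
      1 / (2 * pi) * (CLBINT t. ?F t * char M t) - 1 / (2 * pi) * (CLBINT t. v * g t)"
  proof -
    have "(CLBINT t. v * g t) = complex_of_real (v * (sqrt (2 * pi) / s))"
      using g(2) by (simp flip: of_real_mult)
    moreover have "1 / (2 * pi) * (v * (sqrt (2 * pi) / s)) = v / (s * sqrt (2 * pi))"
    proof -
      have "sqrt (2 * pi) * sqrt (2 * pi) = 2 * pi" by simp
      hence "sqrt (2 * pi) / (2 * pi) = 1 / sqrt (2 * pi)" by (simp add: field_simps)
      thus ?thesis using s by (simp add: field_simps)
    qed
    ultimately have "1 / (2 * pi) * (CLBINT t. v * g t) = complex_of_real (v / (s * sqrt (2 * pi)))"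
      by (metis of_real_mult)
    thus ?thesis using v measure_singleton_eq_0[OF int]
      by (simp only: of_real_diff measure_Ioc_Fourier_inversion[OF int v])
  qed
  also have "\<dots> = 1 / (2 * pi) * ((CLBINT t. ?F t * char M t) - (CLBINT t. v * g t))"
    by (simp add: right_diff_distrib)
  also have "(CLBINT t. ?F t * char M t) - (CLBINT t. v * g t) = (CLBINT t. ?F t * char M t - v * g t)"
    using intF gc by (intro Bochner_Integration.integral_diff[symmetric]) auto
  finally have "\<bar>measure M {0<..v} - v / (s * sqrt (2 * pi))\<bar> =
      cmod (1 / (2 * pi) * (CLBINT t. ?F t * char M t - v * g t))"
    by (metis norm_of_real real_norm_def)
  also have "\<dots> = 1 / (2 * pi) * cmod (CLBINT t. ?F t * char M t - v * g t)"
    by (simp add: norm_mult norm_divide)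
  also have "\<dots> \<le> 1 / (2 * pi) *
      (LBINT t. v * cmod (char M t - g t) + v\<^sup>2 / 2 * (\<bar>t\<bar> * cmod (char M t)))"
  proof (intro mult_left_mono)
    have "cmod (CLBINT t. ?F t * char M t - v * g t) \<le> (LBINT t. cmod (?F t * char M t - v * g t))"
      by (rule integral_norm_bound)
    also have "\<dots> \<le> (LBINT t. v * cmod (char M t - g t) + v\<^sup>2 / 2 * (\<bar>t\<bar> * cmod (char M t)))"
    proof (rule integral_mono_AE)
      show "AE t in lborel. cmod (?F t * char M t - v * g t) \<le>
          v * cmod (char M t - g t) + v\<^sup>2 / 2 * (\<bar>t\<bar> * cmod (char M t))"
      \<comment> \<open>At t = 0 the quotient defining the kernel has the default value 0 instead of
        its limit v; the point is discarded as a null set.\<close>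
      proof (rule AE_mp[OF AE_lborel_singleton[of 0]], intro AE_I2 impI)
        fix t :: real assume t: "t \<noteq> 0"
        have "?F t * char M t - v * g t = v * (char M t - g t) + (?F t - v) * char M t"
          by (simp add: algebra_simps)
        also have "cmod \<dots> \<le> cmod (v * (char M t - g t)) + cmod ((?F t - v) * char M t)"
          by (rule norm_triangle_ineq)
        also have "\<dots> \<le> v * cmod (char M t - g t) + (v\<^sup>2 / 2 * \<bar>t\<bar>) * cmod (char M t)"
          unfolding norm_mult using bound2[OF t] v by (intro add_mono mult_right_mono) auto
        finally show "cmod (?F t * char M t - v * g t) \<le>
          v * cmod (char M t - g t) + v\<^sup>2 / 2 * (\<bar>t\<bar> * cmod (char M t))" by (simp add: mult_ac)
      qed
    qed (use intF gc D int1 in auto)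
    finally show "cmod (CLBINT t. ?F t * char M t - v * g t) \<le> \<dots>" .
  qed auto
  also have "\<dots> = v / (2 * pi) * (LBINT t. cmod (char M t - g t))
     + v\<^sup>2 / (4 * pi) * (LBINT t. \<bar>t\<bar> * cmod (char M t))"
    using D int1
    by (subst Bochner_Integration.integral_add)
       (auto simp only: integral_mult_right_zero intro!: integrable_mult_right, simp add: field_simps)
  finally show ?thesis unfolding g_def .
qed

text \<open>For x > 0, exp (-k x) is the probability that an exponential variable of rate k (density
  \<open>erlang_density 0 k\<close>) is at least x; exchanging the two integrals gives the
  claim.\<close>

lemma integral_exp_Ioi_eq:
  assumes k: "k > 0"
  shows "(\<integral>x. indicator {0<..} x * exp (- (k * x)) \<partial>M) =
    (LBINT v. erlang_density 0 k v * measure M {0<..v})"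
proof -
  let ?f = "\<lambda>v x. ennreal (erlang_density 0 k v) * indicator {0<..} x * indicator {x..} v"
  have meas[measurable]: "(\<lambda>v. measure M {0<..v}) \<in> borel_measurable borel"
    by (intro borel_measurable_mono monoI finite_measure_mono) auto
  have "(\<integral>\<^sup>+x. ennreal (indicator {0<..} x * exp (- (k * x))) \<partial>M) =
      (\<integral>\<^sup>+x. (\<integral>\<^sup>+v. ?f v x \<partial>lborel) \<partial>M)"
  proof (intro nn_integral_cong)
    fix x :: real
    show "ennreal (indicator {0<..} x * exp (- (k * x))) =
      (\<integral>\<^sup>+v. ?f v x \<partial>lborel)"
    proof (cases "x > 0")
      case True
      have "(\<integral>\<^sup>+v. ennreal (k * exp (- (k * v))) * indicator {x..} v \<partial>lborel) =
          ennreal (0 - (- exp (- (k * x))))"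
      proof (rule nn_integral_FTC_atLeast[where F = "\<lambda>v. - exp (- (k * v))"])
        show "((\<lambda>v. - exp (- (k * v))) \<longlongrightarrow> 0) at_top" using k by real_asymp
      qed (use k in \<open>auto intro!: derivative_eq_intros\<close>)
      moreover have "(\<integral>\<^sup>+v. ennreal (k * exp (- (k * v))) * indicator {x..} v \<partial>lborel) =
        (\<integral>\<^sup>+v. ?f v x \<partial>lborel)"
        using True by (intro nn_integral_cong) (auto simp: indicator_def erlang_density_def mult_ac)
      ultimately show ?thesis using True by simp
    qed auto
  qed
  also have "\<dots> = (\<integral>\<^sup>+v. (\<integral>\<^sup>+x. ?f v x \<partial>M) \<partial>lborel)"
  proof -
    interpret P: pair_sigma_finite lborel M ..
    have "(\<lambda>(v, x). ?f v x)
        \<in> borel_measurable (lborel \<Otimes>\<^sub>M M)"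
    proof -
      have "{z::real \<times> real. snd z \<le> fst z} \<in> sets (borel \<Otimes>\<^sub>M borel)"
        unfolding borel_prod by (intro borel_closed closed_Collect_le continuous_intros)
      hence "(\<lambda>z. ennreal (erlang_density 0 k (fst z)) * indicator {0<..} (snd z) * indicator {z. snd z \<le> fst z} z)
          \<in> borel_measurable (borel \<Otimes>\<^sub>M borel)"
        by measurable
      moreover have "(\<lambda>(v, x). ?f v x) =
         (\<lambda>z. ennreal (erlang_density 0 k (fst z)) * indicator {0<..} (snd z) * indicator {z. snd z \<le> fst z} z)"
        by (auto simp: fun_eq_iff indicator_def)
      moreover have "borel_measurable (lborel \<Otimes>\<^sub>M M) =
          (borel_measurable (borel \<Otimes>\<^sub>M borel) :: (real \<times> real \<Rightarrow> ennreal) set)"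
        by (intro measurable_cong_sets sets_pair_measure_cong) auto
      ultimately show ?thesis by simp
    qed
    from P.Fubini'[OF this] show ?thesis by simp
  qed
  also have "\<dots> = (\<integral>\<^sup>+v. ennreal (erlang_density 0 k v * measure M {0<..v}) \<partial>lborel)"
  proof (intro nn_integral_cong)
    fix v :: real
    have "(\<integral>\<^sup>+x. ?f v x \<partial>M) =
        (\<integral>\<^sup>+x. ennreal (erlang_density 0 k v) * indicator {0<..v} x \<partial>M)"
      by (intro nn_integral_cong) (auto simp: indicator_def)
    also have "\<dots> = ennreal (erlang_density 0 k v) * emeasure M {0<..v}"
      by (intro nn_integral_cmult_indicator) auto
    finally show "(\<integral>\<^sup>+x. ?f v x \<partial>M)
        = ennreal (erlang_density 0 k v * measure M {0<..v})"
      using k by (simp add: emeasure_eq_measure ennreal_mult)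
  qed
  finally show ?thesis
    using k by (subst (1 2) integral_eq_nn_integral) (auto intro!: borel_measurable_times)
qed

text \<open>The short-interval estimate is averaged over an exponential variable v, whose moments
  1/k and 2/k^2 turn its linear and quadratic terms into the two errors.\<close>

lemma integral_exp_gaussian_approx:
  assumes int: "integrable lborel (char M)" and int1: "integrable lborel (\<lambda>t. \<bar>t\<bar> * cmod (char M t))"
    and s: "s > 0" and k: "k > 0"
  shows "\<bar>(\<integral>x. indicator {0<..} x * exp (- (k * x)) \<partial>M) - 1 / (k * s * sqrt (2 * pi))\<bar> \<le>
     (LBINT t. cmod (char M t - exp (- (s\<^sup>2 * t\<^sup>2 / 2)))) / (2 * pi * k)
     + (LBINT t. \<bar>t\<bar> * cmod (char M t)) / (2 * pi * k\<^sup>2)"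
proof -
  let ?e = "erlang_density 0 k"
  define D where "D = (LBINT t. cmod (char M t - exp (- (s\<^sup>2 * t\<^sup>2 / 2))))"
  define J where "J = (LBINT t. \<bar>t\<bar> * cmod (char M t))"
  have mom: "has_bochner_integral lborel (\<lambda>x. ?e x * x ^ i) (fact i / k ^ i)" for i
    using nn_integral_erlang_ith_moment[OF k, of 0 i] k
    by (intro has_bochner_integral_nn_integral) (auto intro!: AE_I2 simp: erlang_density_def)
  have [measurable]: "(\<lambda>v. measure M {0<..v}) \<in> borel_measurable borel"
    by (intro borel_measurable_mono monoI finite_measure_mono) auto
  have i0: "integrable lborel (\<lambda>v. ?e v * measure M {0<..v})"
  proof (rule Bochner_Integration.integrable_bound[where f = "\<lambda>v. ?e v * v ^ 0"])
    show "integrable lborel (\<lambda>v. ?e v * v ^ 0)"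
      using mom[of 0] by (simp add: has_bochner_integral_iff)
    show "AE x in lborel. norm (?e x * measure M {0<..x})
        \<le> norm (?e x * x ^ 0)"
      using k by (intro AE_I2) (auto simp: abs_mult intro!: mult_left_le)
  qed auto
  have m1: "integrable lborel (\<lambda>v. ?e v * v)" "(LBINT v. ?e v * v) = 1 / k"
    using mom[of 1] by (auto simp: has_bochner_integral_iff)
  have m2: "integrable lborel (\<lambda>v. ?e v * v\<^sup>2)"
    "(LBINT v. ?e v * v\<^sup>2) = 2 / k\<^sup>2"
    using mom[of 2] by (auto simp: has_bochner_integral_iff)
  define c where "c = 1 / (s * sqrt (2 * pi))"
  have "(\<integral>x. indicator {0<..} x * exp (- (k * x)) \<partial>M) - 1 / (k * s * sqrt (2 * pi)) =
      (LBINT v. ?e v * measure M {0<..v}) - (LBINT v. c * (?e v * v))"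
    unfolding integral_exp_Ioi_eq[OF k] integral_mult_right_zero m1(2) by (simp add: c_def)
  also have "\<dots> = (LBINT v. ?e v * measure M {0<..v} - c * (?e v * v))"
    using i0 m1 by (intro Bochner_Integration.integral_diff[symmetric]) auto
  finally have "\<bar>(\<integral>x. indicator {0<..} x * exp (- (k * x)) \<partial>M) - 1 / (k * s * sqrt (2 * pi))\<bar> \<le>
     (LBINT v. norm (?e v * measure M {0<..v} - c * (?e v * v)))"
    using integral_norm_bound[of lborel "\<lambda>v. ?e v * measure M {0<..v} - c * (?e v * v)"]
    by simp
  also have "\<dots> \<le> (LBINT v. D / (2 * pi) * (?e v * v) + J / (4 * pi) * (?e v * v\<^sup>2))"
  proof (rule integral_mono_AE)
    show "AE v in lborel. norm (?e v * measure M {0<..v} - c * (?e v * v)) \<le>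
        D / (2 * pi) * (?e v * v) + J / (4 * pi) * (?e v * v\<^sup>2)"
    proof (intro AE_I2)
      fix v :: real
      show "norm (?e v * measure M {0<..v} - c * (?e v * v)) \<le>
        D / (2 * pi) * (?e v * v) + J / (4 * pi) * (?e v * v\<^sup>2)"
      proof (cases "v \<ge> 0")
        case True
        have "norm (?e v * measure M {0<..v} - c * (?e v * v)) =
          norm (?e v * (measure M {0<..v} - v / (s * sqrt (2 * pi))))"
          by (simp add: c_def algebra_simps)
        also have "\<dots> = ?e v * \<bar>measure M {0<..v} - v / (s * sqrt (2 * pi))\<bar>"
          using k by (simp add: abs_mult)
        also have "\<dots> \<le> ?e v * (v / (2 * pi) * D + v\<^sup>2 / (4 * pi) * J)"
          unfolding D_def J_def using k True
          by (intro mult_left_mono measure_Ioc_gaussian_approx int int1 s) auto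
        finally show ?thesis by (simp add: algebra_simps)
      qed (auto simp: erlang_density_def)
    qed
  qed (use i0 m1 m2 in auto)
  also have "\<dots> = D / (2 * pi) * (1 / k) + J / (4 * pi) * (2 / k\<^sup>2)"
    using m1(1) m2(1)
    by (subst Bochner_Integration.integral_add) (auto simp only: integral_mult_right_zero m1(2) m2(2)
        intro!: integrable_mult_right)
  finally show ?thesis unfolding D_def J_def by (simp add: mult_ac)
qed

end

section \<open>Exponential tilting of finite laws\<close>

lemma iexp_Taylor2: "cmod (iexp y - (1 + \<i> * y - y\<^sup>2 / 2)) \<le> \<bar>y\<bar> ^ 3 / 6"
proof -
  have "(\<Sum>k\<le>2. (\<i> * complex_of_real y) ^ k / fact k) = 1 + \<i> * y - y\<^sup>2 / 2"
    unfolding numeral_2_eq_2 sum.atMost_Suc by (simp add: fact_numeral mult_ac)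
  thus ?thesis using iexp_approx1[of y 2] by (simp add: fact_numeral numeral_3_eq_3)
qed

locale finite_law =
  fixes S :: "'b set" and q w :: "'b \<Rightarrow> real"
  assumes finite_S: "finite S" and q_nonneg: "\<And>x. x \<in> S \<Longrightarrow> q x \<ge> 0" and q_sum: "(\<Sum>x\<in>S. q x) = 1"
begin

definition mgf :: "real \<Rightarrow> real" where
  "mgf r = (\<Sum>x\<in>S. q x * exp (r * w x))"

definition tilt :: "real \<Rightarrow> 'b \<Rightarrow> real" where
  "tilt r x = q x * exp (r * w x) / mgf r"

definition tmean :: "real \<Rightarrow> real" where
  "tmean r = (\<Sum>x\<in>S. tilt r x * w x)"

definition tvar :: "real \<Rightarrow> real" where
  "tvar r = (\<Sum>x\<in>S. tilt r x * (w x - tmean r)\<^sup>2)"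

definition tabs3 :: "real \<Rightarrow> real" where
  "tabs3 r = (\<Sum>x\<in>S. tilt r x * \<bar>w x - tmean r\<bar> ^ 3)"

definition tchar :: "real \<Rightarrow> real \<Rightarrow> complex" where
  "tchar r t = (\<Sum>x\<in>S. tilt r x * iexp (t * (w x - tmean r)))"

lemma mgf_pos: "mgf r > 0"
proof -
  obtain x where x: "x \<in> S" "q x > 0"
    using q_sum q_nonneg by (metis less_eq_real_def sum.neutral zero_neq_one)
  have "0 < q x * exp (r * w x)" using x by simp
  also have "\<dots> \<le> mgf r"
    unfolding mgf_def using finite_S q_nonneg x by (intro member_le_sum) auto
  finally show ?thesis .
qed

lemma tilt_nonneg: "x \<in> S \<Longrightarrow> tilt r x \<ge> 0"
  unfolding tilt_def using mgf_pos[of r] q_nonneg by simp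

lemma tilt_sum: "(\<Sum>x\<in>S. tilt r x) = 1"
proof -
  have "(\<Sum>x\<in>S. tilt r x) = mgf r / mgf r" unfolding tilt_def mgf_def sum_divide_distrib ..
  thus ?thesis using mgf_pos[of r] by simp
qed

lemma tilt_0: "tilt 0 x = q x"
  by (simp add: tilt_def mgf_def q_sum)

lemma mgf_0: "mgf 0 = 1"
  by (simp add: mgf_def q_sum)

lemma has_derivative_mgf: "(mgf has_field_derivative (\<Sum>x\<in>S. q x * w x * exp (r * w x))) (at r)"
  unfolding mgf_def by (auto intro!: derivative_eq_intros sum.cong)

lemma tmean_eq: "tmean r = (\<Sum>x\<in>S. q x * w x * exp (r * w x)) / mgf r"
  unfolding tmean_def tilt_def sum_divide_distrib by (intro sum.cong) auto

lemma has_derivative_ln_mgf: "((\<lambda>r. ln (mgf r)) has_field_derivative tmean r) (at r)"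
  unfolding tmean_eq using mgf_pos[of r] has_derivative_mgf[of r]
  by (auto intro!: derivative_eq_intros simp: field_simps)

lemma tvar_eq: "tvar r = (\<Sum>x\<in>S. tilt r x * (w x)\<^sup>2) - (tmean r)\<^sup>2"
proof -
  have "tvar r = (\<Sum>x\<in>S. tilt r x * (w x)\<^sup>2 - 2 * tmean r * (tilt r x * w x) + (tmean r)\<^sup>2 * tilt r x)"
    unfolding tvar_def by (intro sum.cong) (auto simp: power2_eq_square algebra_simps)
  also have "\<dots> = (\<Sum>x\<in>S. tilt r x * (w x)\<^sup>2) - 2 * tmean r * tmean r + (tmean r)\<^sup>2 * 1"
    unfolding sum.distrib sum_subtractf sum_distrib_left[symmetric] tilt_sum tmean_def[symmetric] ..
  finally show ?thesis by (simp add: power2_eq_square)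
qed

lemma has_derivative_tmean: "(tmean has_field_derivative tvar r) (at r)"
proof -
  define N where "N = (\<lambda>r. \<Sum>x\<in>S. q x * w x * exp (r * w x))"
  have N: "(N has_field_derivative (\<Sum>x\<in>S. q x * (w x)\<^sup>2 * exp (r * w x))) (at r)"
    unfolding N_def by (auto intro!: derivative_eq_intros sum.cong simp: power2_eq_square)
  have "((\<lambda>r. N r / mgf r) has_field_derivative
      ((\<Sum>x\<in>S. q x * (w x)\<^sup>2 * exp (r * w x)) * mgf r - N r * N r) / (mgf r * mgf r)) (at r)"
    using mgf_pos[of r] has_derivative_mgf[of r, folded N_def] N unfolding N_def
    by (intro DERIV_divide) (auto simp: N_def)
  also have "((\<Sum>x\<in>S. q x * (w x)\<^sup>2 * exp (r * w x)) * mgf r - N r * N r) / (mgf r * mgf r) = 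
      (\<Sum>x\<in>S. q x * (w x)\<^sup>2 * exp (r * w x)) / mgf r - (N r / mgf r)\<^sup>2"
    using mgf_pos[of r] by (simp add: diff_divide_distrib power2_eq_square)
  also have "N r / mgf r = tmean r" by (simp add: tmean_eq N_def)
  also have "(\<Sum>x\<in>S. q x * (w x)\<^sup>2 * exp (r * w x)) / mgf r = (\<Sum>x\<in>S. tilt r x * (w x)\<^sup>2)"
    unfolding tilt_def sum_divide_distrib by (intro sum.cong) auto
  also have "(\<lambda>r. N r / mgf r) = tmean" by (auto simp: tmean_eq N_def)
  finally show ?thesis by (simp add: tvar_eq)
qed

lemma tvar_nonneg: "tvar r \<ge> 0"
  unfolding tvar_def by (intro sum_nonneg mult_nonneg_nonneg tilt_nonneg) auto

lemma tvar_le: "tvar r \<le> (\<Sum>x\<in>S. tilt r x * (w x - c)\<^sup>2)"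
proof -
  have "(\<Sum>x\<in>S. tilt r x * (w x - c)\<^sup>2) =
      (\<Sum>x\<in>S. tilt r x * (w x)\<^sup>2 - 2 * c * (tilt r x * w x) + c\<^sup>2 * tilt r x)"
    by (intro sum.cong) (auto simp: power2_eq_square algebra_simps)
  also have "\<dots> = (\<Sum>x\<in>S. tilt r x * (w x)\<^sup>2) - 2 * c * tmean r + c\<^sup>2 * 1"
    unfolding sum.distrib sum_subtractf sum_distrib_left[symmetric] tilt_sum tmean_def[symmetric] ..
  also have "\<dots> = tvar r + (tmean r - c)\<^sup>2" unfolding tvar_eq by (simp add: power2_eq_square algebra_simps)
  finally show ?thesis by simp
qed

lemma cmod_tchar_le_1: "cmod (tchar r t) \<le> 1"
proof -
  have "cmod (tchar r t) \<le> (\<Sum>x\<in>S. cmod (tilt r x * iexp (t * (w x - tmean r))))"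
    unfolding tchar_def by (rule norm_sum)
  also have "\<dots> = (\<Sum>x\<in>S. tilt r x)" using tilt_nonneg by (intro sum.cong) (auto simp: norm_mult)
  finally show ?thesis by (simp add: tilt_sum)
qed

text \<open>Centring at \<open>tmean r\<close> removes the linear term, so the second-order
  expansion of exp (i y) leaves only the variance and a third absolute moment.\<close>

lemma tchar_Taylor: "cmod (tchar r t - (1 - tvar r * t\<^sup>2 / 2)) \<le> tabs3 r * \<bar>t\<bar> ^ 3 / 6"
proof -
  let ?y = "\<lambda>x. w x - tmean r"
  have 0: "(\<Sum>x\<in>S. tilt r x * ?y x) = 0"
  proof -
    have "(\<Sum>x\<in>S. tilt r x * ?y x) = (\<Sum>x\<in>S. tilt r x * w x - tmean r * tilt r x)"
      by (intro sum.cong) (auto simp: algebra_simps)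
    also have "\<dots> = tmean r - tmean r * 1"
      unfolding sum_subtractf sum_distrib_left[symmetric] tilt_sum tmean_def[symmetric] ..
    finally show ?thesis by simp
  qed
  define Y :: "'b \<Rightarrow> real" where "Y = (\<lambda>x. t * ?y x)"
  have 1: "(\<Sum>x\<in>S. tilt r x * Y x) = 0"
    using 0 unfolding Y_def by (simp add: mult.left_commute flip: sum_distrib_left)
  have 2: "(\<Sum>x\<in>S. tilt r x * ((Y x)\<^sup>2 / 2)) = tvar r * t\<^sup>2 / 2"
    unfolding Y_def tvar_def sum_distrib_right sum_divide_distrib
    by (intro sum.cong) (auto simp: power_mult_distrib)
  have "(\<Sum>x\<in>S. tilt r x * (1 + \<i> * Y x - of_real ((Y x)\<^sup>2 / 2))) =
      (\<Sum>x\<in>S. of_real (tilt r x) + \<i> * of_real (tilt r x * Y x) - of_real (tilt r x * ((Y x)\<^sup>2 / 2)))"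
    by (intro sum.cong refl) (simp only: of_real_mult ring_distribs mult_1_right mult.left_commute)
  also have "\<dots> = of_real (\<Sum>x\<in>S. tilt r x) + \<i> * of_real (\<Sum>x\<in>S. tilt r x * Y x)
      - of_real (\<Sum>x\<in>S. tilt r x * ((Y x)\<^sup>2 / 2))"
    by (simp only: sum.distrib sum_subtractf sum_distrib_left of_real_sum)
  also have "\<dots> = 1 - tvar r * t\<^sup>2 / 2" unfolding 1 2 tilt_sum by simp
  finally have "tchar r t - (1 - tvar r * t\<^sup>2 / 2) =
      (\<Sum>x\<in>S. tilt r x * (iexp (Y x) - (1 + \<i> * Y x - of_real ((Y x)\<^sup>2 / 2))))"
    unfolding tchar_def Y_def[symmetric] right_diff_distrib[of _ "iexp _"] sum_subtractf by (simp add: Y_def)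
  also have "cmod \<dots> \<le> (\<Sum>x\<in>S. cmod (tilt r x * (iexp (Y x) - (1 + \<i> * Y x - of_real ((Y x)\<^sup>2 / 2)))))"
    by (rule norm_sum)
  also have "\<dots> \<le> (\<Sum>x\<in>S. tilt r x * (\<bar>Y x\<bar> ^ 3 / 6))"
  proof (intro sum_mono)
    fix x assume x: "x \<in> S"
    show "cmod (tilt r x * (iexp (Y x) - (1 + \<i> * Y x - of_real ((Y x)\<^sup>2 / 2)))) \<le> tilt r x * (\<bar>Y x\<bar> ^ 3 / 6)"
      unfolding norm_mult norm_of_real abs_of_nonneg[OF tilt_nonneg[OF x]]
      by (intro mult_left_mono iexp_Taylor2 tilt_nonneg[OF x])
  qed
  also have "\<dots> = tabs3 r * \<bar>t\<bar> ^ 3 / 6"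
    unfolding tabs3_def sum_distrib_right sum_divide_distrib Y_def
    by (intro sum.cong) (auto simp: abs_mult power_mult_distrib)
  finally show ?thesis .
qed

text \<open>Through the moment generating function at the complex point r + i t, a product of tilted
  characteristic functions over primes becomes an expectation of the whole random sum.\<close>

lemma tchar_eq: "tchar r t = iexp (- (t * tmean r)) * (\<Sum>x\<in>S. q x * exp (Complex r t * w x)) / mgf r"
proof -
  have "tilt r x * iexp (t * (w x - tmean r)) =
      iexp (- (t * tmean r)) * (q x * exp (Complex r t * w x)) / mgf r" for x
  proof -
    have "exp (Complex r t * w x) = complex_of_real (exp (r * w x)) * iexp (t * w x)"
      by (simp add: Complex_eq algebra_simps exp_add flip: exp_of_real)
    moreover have "iexp (t * (w x - tmean r)) = iexp (t * w x) * iexp (- (t * tmean r))"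
      by (simp add: algebra_simps exp_add exp_diff exp_minus field_simps)
    ultimately show ?thesis by (simp add: tilt_def)
  qed
  thus ?thesis unfolding tchar_def sum_distrib_left sum_divide_distrib by (intro sum.cong) auto
qed

end

section \<open>Variance and third moment bounds from the range and from a gap\<close>

locale bounded_finite_law = finite_law +
  fixes B :: real
  assumes w_bound: "\<And>x. x \<in> S \<Longrightarrow> \<bar>w x\<bar> \<le> B"
begin

lemma B_nonneg: "B \<ge> 0"
proof -
  have "S \<noteq> {}" using q_sum by auto
  thus ?thesis using w_bound by force
qed

lemma abs_tmean_le: "\<bar>tmean r\<bar> \<le> B"
proof -
  have "\<bar>tmean r\<bar> \<le> (\<Sum>x\<in>S. \<bar>tilt r x * w x\<bar>)" unfolding tmean_def by (rule sum_abs)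
  also have "\<dots> \<le> (\<Sum>x\<in>S. tilt r x * B)"
    using w_bound tilt_nonneg by (intro sum_mono) (auto simp: abs_mult intro!: mult_left_mono)
  finally show ?thesis by (simp add: sum_distrib_right[symmetric] tilt_sum)
qed

lemma tvar_le_square: "tvar r \<le> B\<^sup>2"
proof -
  have "tvar r \<le> (\<Sum>x\<in>S. tilt r x * (w x - 0)\<^sup>2)" by (rule tvar_le)
  also have "\<dots> \<le> (\<Sum>x\<in>S. tilt r x * B\<^sup>2)"
    using w_bound tilt_nonneg B_nonneg
    by (intro sum_mono mult_left_mono) (auto simp: abs_le_square_iff[symmetric])
  finally show ?thesis by (simp add: sum_distrib_right[symmetric] tilt_sum)
qed

lemma tabs3_le: "tabs3 r \<le> 2 * B * tvar r"
  unfolding tabs3_def tvar_def sum_distrib_left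
proof (intro sum_mono)
  fix x assume x: "x \<in> S"
  have "\<bar>w x - tmean r\<bar> \<le> 2 * B" using w_bound[OF x] abs_tmean_le[of r] by linarith
  hence "\<bar>w x - tmean r\<bar> * (w x - tmean r)\<^sup>2 \<le> 2 * B * (w x - tmean r)\<^sup>2" by (intro mult_right_mono) auto
  hence "\<bar>w x - tmean r\<bar> ^ 3 \<le> 2 * B * (w x - tmean r)\<^sup>2"
    by (simp add: power3_eq_cube power2_eq_square abs_mult[symmetric] mult.assoc[symmetric])
  hence "tilt r x * \<bar>w x - tmean r\<bar> ^ 3 \<le> tilt r x * (2 * B * (w x - tmean r)\<^sup>2)"
    using tilt_nonneg[OF x] by (intro mult_left_mono)
  thus "tilt r x * \<bar>w x - tmean r\<bar> ^ 3 \<le> 2 * B * (tilt r x * (w x - tmean r)\<^sup>2)" by (simp add: mult_ac)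
qed

end

text \<open>
  The gap below the top value \<open>T\<close> makes the law tilted by \<open>exp (r * w)\<close> concentrate at \<open>T\<close>
  exponentially fast in \<open>r * g\<close>.
\<close>

locale gapped_finite_law = bounded_finite_law +
  fixes T g :: real
  assumes gap: "\<And>x. x \<in> S \<Longrightarrow> w x = T \<or> w x \<le> T - g" and g_pos: "g > 0"
    and top_mass: "1 / 6 \<le> (\<Sum>x\<in>{x\<in>S. w x = T}. q x)"
    and rest_mass: "1 / 6 \<le> (\<Sum>x\<in>{x\<in>S. w x \<noteq> T}. q x)"
begin

text \<open>The variance is at most the second moment about T. Values off T carry tilted weight at
  most 6 q exp (-r g), because \<open>mgf r\<close> is at least exp (r T)/6, and they lie within 2B
  of T; 24 = 6 * 4.\<close>

lemma tvar_decay: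
  assumes "r \<ge> 0"
  shows "tvar r \<le> 24 * B\<^sup>2 * exp (- (r * g))"
proof -
  have "1 / 6 * exp (r * T) \<le> (\<Sum>x\<in>{x\<in>S. w x = T}. q x) * exp (r * T)"
    using top_mass by (intro mult_right_mono) auto
  also have "\<dots> = (\<Sum>x\<in>{x\<in>S. w x = T}. q x * exp (r * w x))" unfolding sum_distrib_right
    by (intro sum.cong) auto
  also have "\<dots> \<le> mgf r" unfolding mgf_def using finite_S q_nonneg by (intro sum_mono2) auto
  finally have Z: "exp (r * T) / 6 \<le> mgf r" by simp
  have T: "\<bar>T\<bar> \<le> B"
  proof -
    have "{x\<in>S. w x = T} \<noteq> {}"
    proof
      assume "{x\<in>S. w x = T} = {}"
      thus False using top_mass unfolding \<open>{x\<in>S. w x = T} = {}\<close> by simp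
    qed
    thus ?thesis using w_bound by auto
  qed
  have "tvar r \<le> (\<Sum>x\<in>S. tilt r x * (w x - T)\<^sup>2)" by (rule tvar_le)
  also have "\<dots> \<le> (\<Sum>x\<in>S. q x * (24 * B\<^sup>2 * exp (- (r * g))))"
  proof (intro sum_mono)
    fix x assume x: "x \<in> S"
    show "tilt r x * (w x - T)\<^sup>2 \<le> q x * (24 * B\<^sup>2 * exp (- (r * g)))"
    proof (cases "w x = T")
      case False
      hence "w x \<le> T - g" using gap x by auto
      hence "r * w x \<le> r * T - r * g" using assms mult_left_mono[of "w x" "T - g" r] by (simp add: algebra_simps)
      hence "exp (r * w x) \<le> exp (r * T) * exp (- (r * g))" by (simp flip: exp_add)
      also have "\<dots> \<le> (6 * mgf r) * exp (- (r * g))" using Z by (intro mult_right_mono) auto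
      finally have "exp (r * w x) / mgf r \<le> 6 * exp (- (r * g))"
        using mgf_pos[of r] by (simp add: field_simps)
      moreover have "(w x - T)\<^sup>2 \<le> (2 * B)\<^sup>2"
        using w_bound[OF x] T by (intro power2_le_iff_abs_le[THEN iffD2]) auto
      ultimately have "exp (r * w x) / mgf r * (w x - T)\<^sup>2 \<le> 6 * exp (- (r * g)) * (2 * B)\<^sup>2"
        using mgf_pos[of r] by (intro mult_mono) auto
      hence "q x * (exp (r * w x) / mgf r * (w x - T)\<^sup>2) \<le> q x * (6 * exp (- (r * g)) * (2 * B)\<^sup>2)"
        using q_nonneg[OF x] by (intro mult_left_mono)
      thus ?thesis by (simp add: tilt_def power_mult_distrib mult_ac)
    qed (use q_nonneg[OF x] in simp)
  qed
  also have "\<dots> = 24 * B\<^sup>2 * exp (- (r * g))" by (simp add: sum_distrib_right[symmetric] q_sum)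
  finally show ?thesis .
qed

text \<open>A tilt with |r| B <= \<beta> lowers no weight by more than the factor exp (2 \<beta>).
  The mean cannot be closer than g/2 both to T and to some other value; whichever group stays away
  has original mass at least 1/6 and squared distance at least g^2/4.\<close>

lemma tvar_lower:
  assumes "\<bar>r\<bar> * B \<le> \<beta>"
  shows "exp (- 2 * \<beta>) / 24 * g\<^sup>2 \<le> tvar r"
proof -
  have rw: "\<bar>r * w x\<bar> \<le> \<beta>" if "x \<in> S" for x
    using assms mult_left_mono[OF w_bound[OF that], of "\<bar>r\<bar>"] by (simp add: abs_mult)
  have "mgf r \<le> (\<Sum>x\<in>S. q x * exp \<beta>)"
    unfolding mgf_def using rw q_nonneg by (intro sum_mono mult_left_mono) force+
  hence Z: "mgf r \<le> exp \<beta>" by (simp add: sum_distrib_right[symmetric] q_sum)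
  have tilt: "q x * exp (- 2 * \<beta>) \<le> tilt r x" if x: "x \<in> S" for x
  proof -
    have "exp (- 2 * \<beta>) = exp (- \<beta>) / exp \<beta>" by (simp flip: exp_diff)
    also have "\<dots> \<le> exp (r * w x) / mgf r"
      using Z mgf_pos[of r] rw[OF x] by (intro frac_le) auto
    finally have "q x * exp (- 2 * \<beta>) \<le> q x * (exp (r * w x) / mgf r)"
      using q_nonneg[OF x] by (intro mult_left_mono)
    thus ?thesis by (simp add: tilt_def)
  qed
  have key: "exp (- 2 * \<beta>) / 24 * g\<^sup>2 \<le> tvar r"
    if A: "A \<subseteq> S" "1 / 6 \<le> (\<Sum>x\<in>A. q x)" "\<And>x. x \<in> A \<Longrightarrow> g / 2 \<le> \<bar>w x - tmean r\<bar>" for A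
  proof -
    have "exp (- 2 * \<beta>) / 24 * g\<^sup>2 = 1 / 6 * (exp (- 2 * \<beta>) * (g / 2)\<^sup>2)" by (simp add: power2_eq_square)
    also have "\<dots> \<le> (\<Sum>x\<in>A. q x) * (exp (- 2 * \<beta>) * (g / 2)\<^sup>2)" using A by (intro mult_right_mono) auto
    also have "\<dots> = (\<Sum>x\<in>A. (q x * exp (- 2 * \<beta>)) * (g / 2)\<^sup>2)"
      unfolding sum_distrib_right by (intro sum.cong) auto
    also have "\<dots> \<le> (\<Sum>x\<in>A. tilt r x * (w x - tmean r)\<^sup>2)"
    proof (intro sum_mono mult_mono)
      fix x assume x: "x \<in> A"
      show "q x * exp (- 2 * \<beta>) \<le> tilt r x" using tilt x A by auto
      show "0 \<le> tilt r x" using tilt_nonneg x A by auto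
      have "(g / 2)\<^sup>2 \<le> \<bar>w x - tmean r\<bar>\<^sup>2" using A(3)[OF x] g_pos by (intro power_mono) auto
      thus "(g / 2)\<^sup>2 \<le> (w x - tmean r)\<^sup>2" by simp
    qed auto
    also have "\<dots> \<le> tvar r"
      unfolding tvar_def using finite_S A tilt_nonneg by (intro sum_mono2) auto
    finally show ?thesis .
  qed
  show ?thesis
  proof (cases "tmean r \<le> T - g / 2")
    case True
    show ?thesis
    proof (intro key[of "{x\<in>S. w x = T}"])
      fix x assume "x \<in> {x\<in>S. w x = T}"
      hence "g / 2 \<le> w x - tmean r" using True by auto
      thus "g / 2 \<le> \<bar>w x - tmean r\<bar>" by linarith
    qed (use top_mass in auto)
  next
    case False
    show ?thesis
    proof (intro key[of "{x\<in>S. w x \<noteq> T}"])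
      fix x assume "x \<in> {x\<in>S. w x \<noteq> T}"
      hence "w x \<le> T - g" using gap[of x] by auto
      thus "g / 2 \<le> \<bar>w x - tmean r\<bar>" using False by linarith
    qed (use rest_mass in auto)
  qed
qed

end

section \<open>Sums over primes of independent finite laws\<close>

lemma summable_inverse_squares_scaled:
  fixes c :: real
  shows "summable (\<lambda>n. c / (real n)\<^sup>2)"
  using summable_mult[OF inverse_power_summable[of 2, where 'a = real], of c]
  by (simp add: divide_inverse)

lemma exp_minus_le_inverse_power:
  fixes x :: real
  assumes "x > 0"
  shows "exp (- x) \<le> fact n / x ^ n"
proof -
  have "x ^ n / fact n = (\<Sum>k\<in>{n}. x ^ k /\<^sub>R fact k)" by (simp add: field_simps)
  also have "\<dots> \<le> (\<Sum>k. x ^ k /\<^sub>R fact k)"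
    using assms by (intro sum_le_suminf summable_exp_generic) auto
  also have "\<dots> = exp x" by (simp add: exp_def)
  finally show ?thesis using assms by (simp add: exp_minus field_simps)
qed

text \<open>
  In the application \<open>w p z = \<plusminus>2 ln |1 - z/p|\<close>, and \<open>T p\<close> is its largest value.
\<close>

locale prime_laws =
  fixes S :: "'b set" and q w :: "nat \<Rightarrow> 'b \<Rightarrow> real" and T :: "nat \<Rightarrow> real" and B g :: real
  assumes law: "\<And>p. prime p \<Longrightarrow> gapped_finite_law S (q p) (w p) (B / p) (T p) (g / p)"
    and mean_bound: "\<And>p. prime p \<Longrightarrow> \<bar>\<Sum>x\<in>S. q p x * w p x\<bar> \<le> B / (real p)\<^sup>2"
begin

abbreviation "Z p \<equiv> finite_law.mgf S (q p) (w p)"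
abbreviation "m p \<equiv> finite_law.tmean S (q p) (w p)"
abbreviation "v p \<equiv> finite_law.tvar S (q p) (w p)"
abbreviation "b p \<equiv> finite_law.tabs3 S (q p) (w p)"
abbreviation "\<psi> p \<equiv> finite_law.tchar S (q p) (w p)"

lemma finite_law: "prime p \<Longrightarrow> finite_law S (q p)"
  using law by (simp add: gapped_finite_law_def bounded_finite_law_def)

lemma bounded_law: "prime p \<Longrightarrow> bounded_finite_law S (q p) (w p) (B / p)"
  using law by (simp add: gapped_finite_law_def)

lemma B_nonneg: "B \<ge> 0"
  using bounded_finite_law.B_nonneg[OF bounded_law[of 2]] by simp

lemma g_pos: "g > 0"
  using gapped_finite_law.g_pos[OF law[of 2]] by simp

lemma v_nonneg: "prime p \<Longrightarrow> v p r \<ge> 0"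
  by (rule finite_law.tvar_nonneg[OF finite_law])

lemma v_le: "prime p \<Longrightarrow> v p r \<le> B\<^sup>2 / (real p)\<^sup>2"
  using bounded_finite_law.tvar_le_square[OF bounded_law, of p r] by (simp add: power_divide)

text \<open>The range bound would give only B/p, which is not summable over primes. The mean at r =
  0 is O(1/p^2) by cancellation, and its derivative, the variance, is at most B^2/p^2, so this order
  persists for every fixed r.\<close>

lemma m_le:
  assumes p: "prime p"
  shows "\<bar>m p r\<bar> \<le> (B + \<bar>r\<bar> * B\<^sup>2) / (real p)\<^sup>2"
proof -
  have "norm (m p r - m p 0) \<le> B\<^sup>2 / (real p)\<^sup>2 * norm (r - 0)"
    using finite_law.has_derivative_tmean[OF finite_law[OF p]] v_le[OF p] v_nonneg[OF p]
    by (intro field_differentiable_bound[where S = UNIV and f' = "v p"]) auto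
  moreover have "m p 0 = (\<Sum>x\<in>S. q p x * w p x)"
    by (simp add: finite_law.tmean_def[OF finite_law[OF p]] finite_law.tilt_0[OF finite_law[OF p]])
  ultimately show ?thesis using mean_bound[OF p] by (simp add: add_divide_distrib mult_ac) 
qed

section \<open>The cumulant generating function of the infinite sum and its derivatives\<close>

definition K :: "real \<Rightarrow> real" where
  "K r = (\<Sum>n. if prime n then ln (Z n r) else 0)"

definition K1 :: "real \<Rightarrow> real" where
  "K1 r = (\<Sum>n. if prime n then m n r else 0)"

definition K2 :: "real \<Rightarrow> real" where
  "K2 r = (\<Sum>n. if prime n then v n r else 0)"

lemma summable_m: "summable (\<lambda>n. if prime n then m n r else 0)"
proof (rule summable_comparison_test)
  show "\<exists>N. \<forall>n\<ge>N. norm (if prime n then m n r else 0) \<le> (B + \<bar>r\<bar> * B\<^sup>2) / (real n)\<^sup>2"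
    using m_le B_nonneg by auto
qed (rule summable_inverse_squares_scaled)

lemma summable_v: "summable (\<lambda>n. if prime n then v n r else 0)"
proof (rule summable_comparison_test)
  show "\<exists>N. \<forall>n\<ge>N. norm (if prime n then v n r else 0) \<le> B\<^sup>2 / (real n)\<^sup>2"
    using v_le v_nonneg by auto
qed (rule summable_inverse_squares_scaled)

text \<open>Termwise differentiation on a compact interval around r that contains 0. At 0 every term
  vanishes, which supplies the one point of convergence required; summability at r comes out
  together with the derivative.\<close>

lemma K_has_derivative:
  shows summable_ln_Z: "summable (\<lambda>n. if prime n then ln (Z n r) else 0)"
    and K_deriv: "(K has_field_derivative K1 r) (at r)"
proof -
  define R where "R = \<bar>r\<bar> + 1"
  have 1: "((\<lambda>r. if prime n then ln (Z n r) else 0) has_field_derivative (if prime n then m n x else 0))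
      (at x within {-R..R})" for n x
    using finite_law.has_derivative_ln_mgf[OF finite_law, of n "w n" x]
    by (cases "prime n") (auto intro: DERIV_subset)
  have 2: "uniformly_convergent_on {-R..R} (\<lambda>n x. \<Sum>i<n. if prime i then m i x else 0)"
  proof (rule Weierstrass_m_test'[where M = "\<lambda>n. (B + R * B\<^sup>2) / (real n)\<^sup>2"])
    fix n x assume x: "x \<in> {-R..R}"
    have "(B + \<bar>x\<bar> * B\<^sup>2) / (real n)\<^sup>2 \<le> (B + R * B\<^sup>2) / (real n)\<^sup>2"
      using x by (intro divide_right_mono add_left_mono mult_right_mono) auto
    thus "norm (if prime n then m n x else 0) \<le> (B + R * B\<^sup>2) / (real n)\<^sup>2"
      using m_le[of n x] B_nonneg by (auto simp: R_def)
  qed (rule summable_inverse_squares_scaled)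
  have "(\<lambda>n. if prime n then ln (Z n 0) else 0) = (\<lambda>n. 0)"
    by (auto simp: finite_law.mgf_0[OF finite_law])
  hence 3: "summable (\<lambda>n. if prime n then ln (Z n 0) else 0)" by simp
  have 4: "convex {-R..R}" "0 \<in> {-R..R}" "r \<in> interior {-R..R}" by (auto simp: R_def abs_if)
  note * = has_field_derivative_series'[OF 4(1) 1 2 4(2) 3 4(3)]
  show "summable (\<lambda>n. if prime n then ln (Z n r) else 0)" "(K has_field_derivative K1 r) (at r)"
    using * unfolding K_def[abs_def] K1_def by auto
qed

lemma K1_deriv: "(K1 has_field_derivative K2 r) (at r)"
proof -
  define R where "R = \<bar>r\<bar> + 1"
  have 1: "((\<lambda>r. if prime n then m n r else 0) has_field_derivative (if prime n then v n x else 0))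
      (at x within {-R..R})" for n x
    using finite_law.has_derivative_tmean[OF finite_law, of n "w n" x]
    by (cases "prime n") (auto intro: DERIV_subset)
  have 2: "uniformly_convergent_on {-R..R} (\<lambda>n x. \<Sum>i<n. if prime i then v i x else 0)"
  proof (rule Weierstrass_m_test'[where M = "\<lambda>n. B\<^sup>2 / (real n)\<^sup>2"])
    show "norm (if prime n then v n x else 0) \<le> B\<^sup>2 / (real n)\<^sup>2" for n x
      using v_le[of n x] v_nonneg[of n x] by auto
  qed (rule summable_inverse_squares_scaled)
  have 3: "convex {-R..R}" "0 \<in> {-R..R}" "r \<in> interior {-R..R}" by (auto simp: R_def abs_if)
  show ?thesis
    using has_field_derivative_series'(2)[OF 3(1) 1 2 3(2) summable_m 3(3)]
    unfolding K1_def[abs_def] K2_def by simp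
qed

text \<open>Bounds the variance uniformly in r, so that errors of size 1/r and 1/r^2 stay within the
  target after multiplication by s.\<close>

definition Kbound :: real where "Kbound = (\<Sum>n. B\<^sup>2 / (real n)\<^sup>2)"

lemma K2_le: "K2 r \<le> Kbound"
  unfolding K2_def Kbound_def using v_le
  by (intro suminf_le summable_v summable_inverse_squares_scaled) auto

lemma sum_v_le_K2: "finite F \<Longrightarrow> (\<And>p. p \<in> F \<Longrightarrow> prime p) \<Longrightarrow> (\<Sum>p\<in>F. v p r) \<le> K2 r"
  unfolding K2_def using sum_le_suminf[OF summable_v, of F r] v_nonneg
  by (auto cong: sum.cong)

lemma v_lower:
  assumes "prime p" "0 \<le> r" "r \<le> real p"
  shows "exp (- 2 * B) / 24 * g\<^sup>2 / (real p)\<^sup>2 \<le> v p r"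
proof -
  have p: "real p > 0" using assms prime_gt_0_nat by simp
  have "\<bar>r\<bar> * (B / p) \<le> B" using assms B_nonneg p mult_left_mono[of r "real p" B] by (simp add: field_simps)
  from gapped_finite_law.tvar_lower[OF law[OF assms(1)] this] show ?thesis
    by (simp add: power_divide)
qed

text \<open>Primes p > r alone suffice: there the tilt is bounded, each variance is at least a
  constant over p^2, and the Chebyshev tail sum gives 1/(r ln r). The threshold 104 is inherited
  from that sum.\<close>

lemma K2_lower:
  obtains c where "c > 0" "\<And>r. r \<ge> 104 \<Longrightarrow> c / (r * ln r) \<le> K2 r"
proof -
  define c1 where "c1 = exp (- 2 * B) / 24 * g\<^sup>2"
  have c1: "c1 > 0" using g_pos by (simp add: c1_def)
  have "c1 / (104\<^sup>2 * 2) / (r * ln r) \<le> K2 r" if r: "r \<ge> 104" for r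
  proof -
    obtain F where F: "finite F" "\<And>p. p \<in> F \<Longrightarrow> prime p \<and> r < real p"
      "1 / (104\<^sup>2 * 2 * (r * ln r)) \<le> (\<Sum>p\<in>F. 1 / (real p)\<^sup>2)"
      using sum_primes_square_tail_lower[OF r] by blast
    have "c1 / (104\<^sup>2 * 2) / (r * ln r) = c1 * (1 / (104\<^sup>2 * 2 * (r * ln r)))" by simp
    also have "\<dots> \<le> c1 * (\<Sum>p\<in>F. 1 / (real p)\<^sup>2)" using F c1 by (intro mult_left_mono) auto
    also have "\<dots> = (\<Sum>p\<in>F. c1 / (real p)\<^sup>2)" by (simp add: sum_distrib_left)
    also have "\<dots> \<le> (\<Sum>p\<in>F. v p r)"
    proof (intro sum_mono)
      fix p assume "p \<in> F"
      hence "prime p" "r < real p" using F by auto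
      thus "c1 / (real p)\<^sup>2 \<le> v p r" unfolding c1_def using r by (intro v_lower) auto
    qed
    also have "\<dots> \<le> K2 r" using F by (intro sum_v_le_K2) auto
    finally show ?thesis .
  qed
  thus ?thesis using that[of "c1 / (104\<^sup>2 * 2)"] c1 by auto
qed

text \<open>For p >= r the range bound suffices. For p < r the factor exp (-r g/p) of
  \<open>tvar_decay\<close> is traded for n! (p/(r g))^n, with n = 2 for the variance, which cancels
  the power of p and leaves r^(-2). The third moment carries a further factor 2B/p, hence n = 3.
  This gives the constants 48 = 24 * 2! and 288 = 2 * 24 * 3!.\<close>

lemma v_b_upper:
  obtains C where "C > 0"
    "\<And>p r. prime p \<Longrightarrow> r \<ge> 1 \<Longrightarrow> v p r \<le> C / (max (real p) r)\<^sup>2"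
    "\<And>p r. prime p \<Longrightarrow> r \<ge> 1 \<Longrightarrow> b p r \<le> C / (max (real p) r) ^ 3"
proof -
  define C where "C = 1 + B\<^sup>2 + 48 * B\<^sup>2 / g\<^sup>2 + 2 * B ^ 3 + 288 * B ^ 3 / g ^ 3"
  have nn: "0 \<le> B\<^sup>2" "0 \<le> 48 * B\<^sup>2 / g\<^sup>2" "0 \<le> 2 * B ^ 3" "0 \<le> 288 * B ^ 3 / g ^ 3"
    using B_nonneg g_pos by auto
  have C: "B\<^sup>2 \<le> C" "48 * B\<^sup>2 / g\<^sup>2 \<le> C" "2 * B ^ 3 \<le> C" "288 * B ^ 3 / g ^ 3 \<le> C" "C > 0"
    using nn unfolding C_def by linarith+
  have main: "v p r \<le> C / (max (real p) r)\<^sup>2 \<and> b p r \<le> C / (max (real p) r) ^ 3"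
    if p: "prime p" and r: "r \<ge> 1" for p r
  proof -
    have p0: "real p > 0" using p prime_gt_0_nat by simp
    have b: "b p r \<le> 2 * (B / p) * v p r"
      by (rule bounded_finite_law.tabs3_le[OF bounded_law[OF p]])
    show ?thesis
    proof (cases "r \<le> real p")
      case True
      have "v p r \<le> B\<^sup>2 / (real p)\<^sup>2" by (rule v_le[OF p])
      hence "b p r \<le> 2 * (B / p) * (B\<^sup>2 / (real p)\<^sup>2)"
        using b B_nonneg p0 mult_left_mono[of "v p r" "B\<^sup>2 / (real p)\<^sup>2" "2 * (B / p)"] by simp
      also have "\<dots> = 2 * B ^ 3 / (real p) ^ 3" by (simp add: power2_eq_square power3_eq_cube)
      also have "\<dots> \<le> C / (real p) ^ 3" using C p0 by (intro divide_right_mono) auto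
      finally have "b p r \<le> C / (real p) ^ 3" .
      moreover have "v p r \<le> C / (real p)\<^sup>2"
        using v_le[OF p, of r] C p0 divide_right_mono[of "B\<^sup>2" C "(real p)\<^sup>2"] by simp
      ultimately show ?thesis using True by (simp add: max_absorb1)
    next
      case False
      have y: "r * (g / p) > 0" using r g_pos p0 by simp
      have d: "v p r \<le> 24 * (B / p)\<^sup>2 * exp (- (r * (g / p)))"
        using gapped_finite_law.tvar_decay[OF law[OF p], of r] r by simp
      also have "\<dots> \<le> 24 * (B / p)\<^sup>2 * (fact 2 / (r * (g / p)) ^ 2)"
        by (intro mult_left_mono exp_minus_le_inverse_power y) auto
      also have "\<dots> = 48 * B\<^sup>2 / g\<^sup>2 / r\<^sup>2"
        using p0 g_pos r by (simp add: power2_eq_square field_simps)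
      also have "\<dots> \<le> C / r\<^sup>2" using C by (intro divide_right_mono) auto
      finally have 1: "v p r \<le> C / r\<^sup>2" .
      have "b p r \<le> 2 * (B / p) * (24 * (B / p)\<^sup>2 * exp (- (r * (g / p))))"
        using b d B_nonneg p0 mult_left_mono[OF d, of "2 * (B / p)"] by simp
      also have "\<dots> \<le> 2 * (B / p) * (24 * (B / p)\<^sup>2 * (fact 3 / (r * (g / p)) ^ 3))"
        using B_nonneg p0 by (intro mult_left_mono exp_minus_le_inverse_power y) auto
      also have "\<dots> = 288 * B ^ 3 / g ^ 3 / r ^ 3"
        using p0 g_pos r by (simp add: power2_eq_square power3_eq_cube fact_numeral field_simps)
      also have "\<dots> \<le> C / r ^ 3" using C r by (intro divide_right_mono) auto
      finally show ?thesis using 1 False by (simp add: max_absorb2)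
    qed
  qed
  thus ?thesis using that[of C] C by blast
qed

lemma cmod_\<psi>_le:
  assumes p: "prime p" and "v p r * t\<^sup>2 \<le> 2" "b p r * \<bar>t\<bar> ^ 3 \<le> e"
  shows "cmod (\<psi> p r t) \<le> exp (- (v p r * t\<^sup>2 / 2 - e / 6))"
proof -
  have "cmod (\<psi> p r t) \<le> cmod (complex_of_real (1 - v p r * t\<^sup>2 / 2)) + b p r * \<bar>t\<bar> ^ 3 / 6"
    using finite_law.tchar_Taylor[OF finite_law[OF p], of "w p" r t]
      norm_triangle_ineq2[of "\<psi> p r t" "complex_of_real (1 - v p r * t\<^sup>2 / 2)"] by simp
  \<comment> \<open>The hypothesis v t^2 <= 2 makes this number nonnegative, so it equals its
    modulus.\<close>
  also have "cmod (complex_of_real (1 - v p r * t\<^sup>2 / 2)) = 1 - v p r * t\<^sup>2 / 2"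
    using assms by (simp only: norm_of_real)
  also have "1 - v p r * t\<^sup>2 / 2 + b p r * \<bar>t\<bar> ^ 3 / 6 \<le> 1 + (- (v p r * t\<^sup>2 / 2 - e / 6))"
    using assms by simp
  also have "\<dots> \<le> exp (- (v p r * t\<^sup>2 / 2 - e / 6))" by (rule exp_ge_add_one_self)
  finally show ?thesis .
qed

end

section \<open>The characteristic function of the tilted sum, near and far from the origin\<close>

lemma norm_prod_diff_weighted:
  fixes z u :: "'i \<Rightarrow> complex" and s :: "'i \<Rightarrow> real"
  assumes "\<And>i. i \<in> I \<Longrightarrow> norm (z i) \<le> exp (- s i)" "\<And>i. i \<in> I \<Longrightarrow> norm (u i) \<le> exp (- s i)"
  shows "norm ((\<Prod>i\<in>I. z i) - (\<Prod>i\<in>I. u i)) \<le> exp (- (\<Sum>i\<in>I. s i)) * (\<Sum>i\<in>I. norm (z i - u i) * exp (s i))"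
proof -
  \<comment> \<open>Rescaling by exp (s i) brings all factors into the unit disc, where differences
    of products telescope with weight 1; undoing it restores the common decay, which a direct
    telescoping bound would lose.\<close>
  define z' u' where "z' = (\<lambda>i. z i * of_real (exp (s i)))" and "u' = (\<lambda>i. u i * of_real (exp (s i)))"
  have fin: "(\<Prod>i\<in>I. z' i) = (\<Prod>i\<in>I. z i) * of_real (exp (\<Sum>i\<in>I. s i))"
     "(\<Prod>i\<in>I. u' i) = (\<Prod>i\<in>I. u i) * of_real (exp (\<Sum>i\<in>I. s i))"
    if "finite I" unfolding z'_def u'_def prod.distrib exp_sum[OF that] of_real_prod by simp_all
  have le1: "x * exp y \<le> 1" if "x \<le> exp (- y)" for x y :: real
    using mult_right_mono[OF that, of "exp y"] by (simp flip: exp_add)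
  show ?thesis
  proof (cases "finite I")
    case True
    have "norm ((\<Prod>i\<in>I. z' i) - (\<Prod>i\<in>I. u' i)) \<le> (\<Sum>i\<in>I. norm (z' i - u' i))"
      unfolding z'_def u'_def using assms
      by (intro norm_prod_diff) (auto simp: norm_mult intro!: le1)
    also have "(\<Prod>i\<in>I. z' i) - (\<Prod>i\<in>I. u' i) =
        ((\<Prod>i\<in>I. z i) - (\<Prod>i\<in>I. u i)) * of_real (exp (\<Sum>i\<in>I. s i))"
      by (simp add: fin[OF True] left_diff_distrib)
    also have "norm \<dots> = norm ((\<Prod>i\<in>I. z i) - (\<Prod>i\<in>I. u i)) * exp (\<Sum>i\<in>I. s i)"
      by (simp add: norm_mult)
    also have "(\<Sum>i\<in>I. norm (z' i - u' i)) = (\<Sum>i\<in>I. norm (z i - u i) * exp (s i))"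
      unfolding z'_def u'_def left_diff_distrib[symmetric] norm_mult by simp
    finally show ?thesis by (simp add: exp_minus field_simps)
  qed auto
qed

lemma exp_minus_Taylor1:
  fixes y :: real
  assumes "y \<ge> 0"
  shows "\<bar>exp (- y) - (1 - y)\<bar> \<le> y\<^sup>2 / 2"
proof -
  have "1 + (- y) \<le> exp (- y)" by (rule exp_ge_add_one_self)
  moreover have "exp (- y) \<le> 1 - y + y\<^sup>2 / 2"
  proof -
    have "1 - 0 + 0\<^sup>2 / 2 - exp (- 0) \<le> 1 - y + y\<^sup>2 / 2 - exp (- y)"
    proof (rule DERIV_nonneg_imp_nondecreasing[OF assms])
      fix x :: real assume "0 \<le> x"
      have "((\<lambda>x. 1 - x + x\<^sup>2 / 2 - exp (- x)) has_real_derivative (- 1 + x + exp (- x))) (at x)"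
        by (auto intro!: derivative_eq_intros)
      thus "\<exists>z. ((\<lambda>x. 1 - x + x\<^sup>2 / 2 - exp (- x)) has_real_derivative z) (at x) \<and> 0 \<le> z"
        using exp_ge_add_one_self[of "-x"] by force
    qed
    thus ?thesis by simp
  qed
  ultimately show ?thesis by simp
qed

abbreviation primes_upto :: "nat \<Rightarrow> nat set" where
  "primes_upto N \<equiv> {p. prime p \<and> p \<le> N}"

lemma sum_primes_upto_tendsto:
  fixes f :: "nat \<Rightarrow> 'c::real_normed_vector"
  assumes "summable (\<lambda>n. if prime n then f n else 0)"
  shows "(\<lambda>N. \<Sum>p\<in>primes_upto N. f p) \<longlonglongrightarrow> (\<Sum>n. if prime n then f n else 0)"
proof -
  have "(\<Sum>n\<le>N. if prime n then f n else 0) = (\<Sum>p\<in>primes_upto N. f p)" for N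
  proof -
    have "primes_upto N = {..N} \<inter> Collect prime" by auto
    thus ?thesis by (simp add: sum.inter_restrict)
  qed
  thus ?thesis using summable_LIMSEQ'[OF assms] by simp
qed

context prime_laws
begin

text \<open>With e_p = C |t|^3/max(p,r)^3, both the factor at p and its Gaussian counterpart are at
  most exp (-s_p), where s_p = v t^2/2 - e_p/6. The e_p/6 add up to at most 8 C |t|^3/(r^2 ln r), 8
  = 48/6, and the hypothesis on \<open>K2 r\<close> (32 = 4 * 8) keeps this below a quarter of
  \<open>K2 r\<close> t^2, so that the exponent \<open>K2 r\<close> t^2/4 survives. A difference of
  factors costs C/6 from the third moment and C^2/8 from replacing 1 - y by exp (-y).\<close>

lemma char_prod_near:
  assumes C: "C > 0" "\<And>p r. prime p \<Longrightarrow> r \<ge> 1 \<Longrightarrow> v p r \<le> C / (max (real p) r)\<^sup>2"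
      "\<And>p r. prime p \<Longrightarrow> r \<ge> 1 \<Longrightarrow> b p r \<le> C / (max (real p) r) ^ 3"
    and r: "r \<ge> 2" and t: "\<bar>t\<bar> \<le> r" "C * \<bar>t\<bar> \<le> r"
    and K2: "32 * C * \<bar>t\<bar> / (r\<^sup>2 * ln r) \<le> K2 r"
    and lim: "(\<lambda>N. \<Prod>p\<in>primes_upto N. \<psi> p r t) \<longlonglongrightarrow> L"
  shows "cmod (L - exp (- (K2 r * t\<^sup>2 / 2))) \<le>
      144 * (C / 6 + C\<^sup>2 / 8) * \<bar>t\<bar> ^ 3 / (r\<^sup>2 * ln r) * exp (- (K2 r * t\<^sup>2 / 4))"
    and "cmod L \<le> exp (- (K2 r * t\<^sup>2 / 4))"
proof -
  let ?G = "\<lambda>p. complex_of_real (exp (- (v p r * t\<^sup>2 / 2)))"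
  let ?P = "\<lambda>N. \<Prod>p\<in>primes_upto N. \<psi> p r t"
  define \<mu> where "\<mu> = (\<lambda>p::nat. max (real p) r)"
  have \<mu>: "\<mu> p \<ge> r" "\<mu> p > 0" "\<bar>t\<bar> \<le> \<mu> p" "C * \<bar>t\<bar> \<le> \<mu> p" for p
    using r t by (auto simp: \<mu>_def)
  define e where "e = (\<lambda>p. C / \<mu> p ^ 3 * \<bar>t\<bar> ^ 3)"
  define s where "s = (\<lambda>p. v p r * t\<^sup>2 / 2 - e p / 6)"
  define C4 where "C4 = C / 6 + C\<^sup>2 / 8"
  have C4: "C4 \<ge> 0" using C(1) by (simp add: C4_def)
  have e0: "e p \<ge> 0" for p using C(1) \<mu>(2)[of p] by (simp add: e_def less_imp_le)
  have bt: "b p r * \<bar>t\<bar> ^ 3 \<le> e p" if "prime p" for p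
    unfolding e_def \<mu>_def using C(3)[OF that, of r] r by (intro mult_right_mono) auto
  have vt1: "v p r * t\<^sup>2 \<le> C * (t / \<mu> p)\<^sup>2" if "prime p" for p
  proof -
    have "v p r * t\<^sup>2 \<le> C / (\<mu> p)\<^sup>2 * t\<^sup>2"
      unfolding \<mu>_def using C(2)[OF that, of r] r by (intro mult_right_mono) auto
    thus ?thesis by (simp add: power_divide)
  qed
  have vt2: "v p r * t\<^sup>2 \<le> 1" if "prime p" for p
  proof -
    \<comment> \<open>The two hypotheses on t bound one factor each.\<close>
    have "C * (t / \<mu> p)\<^sup>2 = (C * \<bar>t\<bar> / \<mu> p) * (\<bar>t\<bar> / \<mu> p)"
      by (simp add: power2_eq_square abs_mult_self_eq[of t] mult_ac)
    also have "\<dots> \<le> 1 * 1"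
      using C(1) \<mu>[of p] by (intro mult_mono) auto
    finally show ?thesis using vt1[OF that] by simp
  qed
  have \<psi>: "cmod (\<psi> p r t) \<le> exp (- s p)" if "prime p" for p
    unfolding s_def using vt2[OF that] by (intro cmod_\<psi>_le bt that) auto
  have ex: "cmod (exp (- (v p r * t\<^sup>2 / 2))) \<le> exp (- s p)" if "prime p" for p
    using e0[of p] unfolding s_def by (simp flip: exp_of_real)
  have diff: "cmod (\<psi> p r t - exp (- (v p r * t\<^sup>2 / 2))) * exp (s p) \<le> 3 * (C4 * \<bar>t\<bar> ^ 3) * (1 / \<mu> p ^ 3)"
    if p: "prime p" for p
  proof -
    define y where "y = v p r * t\<^sup>2 / 2"
    have y: "y \<ge> 0" "y \<le> 1" using v_nonneg[OF p] vt2[OF p] by (auto simp: y_def)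
    have "cmod (\<psi> p r t - exp (- y)) \<le> cmod (\<psi> p r t - complex_of_real (1 - y)) +
        cmod (complex_of_real (exp (- y)) - complex_of_real (1 - y))"
      using norm_triangle_ineq4[of "\<psi> p r t - complex_of_real (1 - y)" "complex_of_real (exp (- y)) - complex_of_real (1 - y)"]
      by (simp add: algebra_simps)
    also have "cmod (complex_of_real (exp (- y)) - complex_of_real (1 - y)) = \<bar>exp (- y) - (1 - y)\<bar>"
      unfolding of_real_diff[symmetric] by (rule norm_of_real)
    also have "\<dots> \<le> y\<^sup>2 / 2" by (rule exp_minus_Taylor1[OF y(1)])
    also have "cmod (\<psi> p r t - complex_of_real (1 - y)) \<le> b p r * \<bar>t\<bar> ^ 3 / 6"
      using finite_law.tchar_Taylor[OF finite_law[OF p], of "w p" r t] by (simp add: y_def)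
    also have "b p r * \<bar>t\<bar> ^ 3 / 6 \<le> e p / 6" using bt[OF p] by simp
    also have "y\<^sup>2 / 2 \<le> C\<^sup>2 / 8 * (\<bar>t\<bar> ^ 3 / \<mu> p ^ 3)"
    proof -
      have "y \<le> C * (t / \<mu> p)\<^sup>2 / 2" using vt1[OF p] by (simp add: y_def)
      hence "y\<^sup>2 \<le> (C * (t / \<mu> p)\<^sup>2 / 2)\<^sup>2" using y by (intro power_mono)
      also have "\<dots> = C\<^sup>2 / 4 * (\<bar>t\<bar> / \<mu> p) ^ 4" by (simp add: power2_eq_square eval_nat_numeral power_divide)
      also have "(\<bar>t\<bar> / \<mu> p) ^ 4 \<le> (\<bar>t\<bar> / \<mu> p) ^ 3"
        using \<mu>[of p] by (intro power_decreasing) auto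
      finally show ?thesis by (simp add: power_divide mult_left_mono)
    qed
    finally have "cmod (\<psi> p r t - exp (- y)) \<le> C4 * \<bar>t\<bar> ^ 3 / \<mu> p ^ 3"
      by (simp add: e_def C4_def algebra_simps add_divide_distrib)
    \<comment> \<open>Here \<open>s p\<close> is at most y <= 1, and exp 1 <= 3; together with the
      48 of the prime sum this produces the factor 144.\<close>
    moreover have "exp (s p) \<le> 3"
    proof -
      have "exp (s p) \<le> exp 1" using y e0[of p] unfolding s_def y_def[symmetric] by simp
      thus ?thesis using exp_le by (rule order.trans)
    qed
    ultimately have "cmod (\<psi> p r t - exp (- y)) * exp (s p) \<le> (C4 * \<bar>t\<bar> ^ 3 / \<mu> p ^ 3) * 3"
      using C4 \<mu>(2)[of p] by (intro mult_mono) (auto simp: less_imp_le)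
    thus ?thesis by (simp add: y_def mult_ac)
  qed
  define S3 where "S3 = 1 / (r\<^sup>2 * ln r)"
  have S3: "S3 > 0" using r by (simp add: S3_def)
  have cube: "(\<Sum>p\<in>primes_upto N. 1 / \<mu> p ^ 3) \<le> 48 * S3" for N
  proof -
    have "(\<Sum>p\<in>primes_upto N. 1 / \<mu> p ^ 3) \<le> 48 / (r\<^sup>2 * ln r)"
      unfolding \<mu>_def by (rule sum_primes_max_cube[OF r]) auto
    thus ?thesis by (simp add: S3_def)
  qed
  define V where "V = (\<lambda>N. \<Sum>p\<in>primes_upto N. v p r)"
  have V: "V \<longlonglongrightarrow> K2 r" unfolding V_def K2_def by (rule sum_primes_upto_tendsto[of "\<lambda>p. v p r", OF summable_v])
  have sums: "V N * t\<^sup>2 / 2 - 8 * C * \<bar>t\<bar> ^ 3 * S3 \<le> (\<Sum>p\<in>primes_upto N. s p)" for N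
  proof -
    have "(\<Sum>p\<in>primes_upto N. s p) = V N * t\<^sup>2 / 2 - C * \<bar>t\<bar> ^ 3 / 6 * (\<Sum>p\<in>primes_upto N. 1 / \<mu> p ^ 3)"
      unfolding s_def e_def V_def sum_subtractf
      by (simp add: sum_distrib_right sum_distrib_left sum_divide_distrib mult_ac)
    moreover have "C * \<bar>t\<bar> ^ 3 / 6 * (\<Sum>p\<in>primes_upto N. 1 / \<mu> p ^ 3) \<le> C * \<bar>t\<bar> ^ 3 / 6 * (48 * S3)"
      using cube C(1) by (intro mult_left_mono) auto
    ultimately show ?thesis by (simp add: mult_ac)
  qed
  have small: "8 * C * \<bar>t\<bar> ^ 3 * S3 \<le> K2 r * t\<^sup>2 / 4"
  proof -
    have "8 * C * \<bar>t\<bar> ^ 3 * S3 = (32 * C * \<bar>t\<bar> / (r\<^sup>2 * ln r)) * t\<^sup>2 / 4"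
      by (simp add: S3_def power3_eq_cube power2_eq_square abs_mult_self_eq)
    also have "\<dots> \<le> K2 r * t\<^sup>2 / 4" using K2 by (intro divide_right_mono mult_right_mono) auto
    finally show ?thesis .
  qed
  have lim2: "(\<lambda>N. exp (- (V N * t\<^sup>2 / 2 - 8 * C * \<bar>t\<bar> ^ 3 * S3)))
      \<longlonglongrightarrow> exp (- (K2 r * t\<^sup>2 / 2 - 8 * C * \<bar>t\<bar> ^ 3 * S3))"
    by (intro tendsto_intros V) auto
  have le: "exp (- (K2 r * t\<^sup>2 / 2 - 8 * C * \<bar>t\<bar> ^ 3 * S3)) \<le> exp (- (K2 r * t\<^sup>2 / 4))"
    using small by simp
  show "cmod L \<le> exp (- (K2 r * t\<^sup>2 / 4))"
  proof -
    have "cmod L \<le> exp (- (K2 r * t\<^sup>2 / 2 - 8 * C * \<bar>t\<bar> ^ 3 * S3))"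
    proof (rule LIMSEQ_le[OF tendsto_norm[OF lim] lim2], intro exI[of _ 0] allI impI)
      fix N
      have "cmod (?P N) \<le> (\<Prod>p\<in>primes_upto N. exp (- s p))"
        unfolding prod_norm[symmetric] using \<psi> by (intro prod_mono) auto
      also have "\<dots> = exp (- (\<Sum>p\<in>primes_upto N. s p))"
        by (simp add: exp_sum sum_negf[symmetric])
      also have "\<dots> \<le> exp (- (V N * t\<^sup>2 / 2 - 8 * C * \<bar>t\<bar> ^ 3 * S3))" using sums[of N] by simp
      finally show "cmod (?P N) \<le> exp (- (V N * t\<^sup>2 / 2 - 8 * C * \<bar>t\<bar> ^ 3 * S3))" .
    qed
    thus ?thesis using le by (rule order.trans)
  qed
  show "cmod (L - exp (- (K2 r * t\<^sup>2 / 2))) \<le>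
      144 * (C / 6 + C\<^sup>2 / 8) * \<bar>t\<bar> ^ 3 / (r\<^sup>2 * ln r) * exp (- (K2 r * t\<^sup>2 / 4))"
  proof -
    have "cmod (L - exp (- (K2 r * t\<^sup>2 / 2))) \<le>
        exp (- (K2 r * t\<^sup>2 / 2 - 8 * C * \<bar>t\<bar> ^ 3 * S3)) * (144 * C4 * \<bar>t\<bar> ^ 3 * S3)"
    proof (rule LIMSEQ_le, rule tendsto_norm, rule tendsto_diff[OF lim])
      show "(\<lambda>N. complex_of_real (exp (- (V N * t\<^sup>2 / 2)))) \<longlonglongrightarrow> exp (- (K2 r * t\<^sup>2 / 2))"
        unfolding exp_of_real[symmetric] by (intro tendsto_intros V) auto
      show "(\<lambda>N. exp (- (V N * t\<^sup>2 / 2 - 8 * C * \<bar>t\<bar> ^ 3 * S3)) * (144 * C4 * \<bar>t\<bar> ^ 3 * S3))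
        \<longlonglongrightarrow> exp (- (K2 r * t\<^sup>2 / 2 - 8 * C * \<bar>t\<bar> ^ 3 * S3)) * (144 * C4 * \<bar>t\<bar> ^ 3 * S3)"
        by (intro tendsto_mult_right lim2)
      show "\<exists>N0. \<forall>N\<ge>N0. cmod ((?P N) - complex_of_real (exp (- (V N * t\<^sup>2 / 2))))
          \<le> exp (- (V N * t\<^sup>2 / 2 - 8 * C * \<bar>t\<bar> ^ 3 * S3)) * (144 * C4 * \<bar>t\<bar> ^ 3 * S3)"
      proof (intro exI[of _ 0] allI impI)
        fix N
        have "complex_of_real (exp (- (V N * t\<^sup>2 / 2))) =
            (\<Prod>p\<in>primes_upto N. ?G p)"
          unfolding V_def sum_distrib_right sum_divide_distrib sum_negf[symmetric]
          by (subst exp_sum) auto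
        hence "cmod ((?P N) - complex_of_real (exp (- (V N * t\<^sup>2 / 2)))) \<le>
            exp (- (\<Sum>p\<in>primes_upto N. s p)) *
            (\<Sum>p\<in>primes_upto N. cmod (\<psi> p r t - ?G p) * exp (s p))"
          using \<psi> ex norm_prod_diff_weighted[of "primes_upto N" "\<lambda>p. \<psi> p r t" s "\<lambda>p. ?G p"]
          by simp
        also have "(\<Sum>p\<in>primes_upto N. cmod (\<psi> p r t - ?G p) * exp (s p))
            \<le> (\<Sum>p\<in>primes_upto N. 3 * (C4 * \<bar>t\<bar> ^ 3) * (1 / \<mu> p ^ 3))"
          using diff by (intro sum_mono) auto
        also have "\<dots> = 3 * (C4 * \<bar>t\<bar> ^ 3) * (\<Sum>p\<in>primes_upto N. 1 / \<mu> p ^ 3)"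
          by (simp add: sum_distrib_left)
        also have "\<dots> \<le> 3 * (C4 * \<bar>t\<bar> ^ 3) * (48 * S3)"
          using cube C4 by (intro mult_left_mono) auto
        also have "exp (- (\<Sum>p\<in>primes_upto N. s p)) \<le> exp (- (V N * t\<^sup>2 / 2 - 8 * C * \<bar>t\<bar> ^ 3 * S3))"
          using sums[of N] by simp
        finally show "cmod ((?P N) - complex_of_real (exp (- (V N * t\<^sup>2 / 2))))
          \<le> exp (- (V N * t\<^sup>2 / 2 - 8 * C * \<bar>t\<bar> ^ 3 * S3)) * (144 * C4 * \<bar>t\<bar> ^ 3 * S3)"
          using C4 S3 by (simp add: mult_left_mono mult_right_mono mult_ac)
      qed
    qed
    also have "\<dots> \<le> exp (- (K2 r * t\<^sup>2 / 4)) * (144 * C4 * \<bar>t\<bar> ^ 3 * S3)"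
      using le C4 S3 by (intro mult_right_mono) auto
    finally show ?thesis by (simp add: C4_def S3_def mult_ac)
  qed
qed

text \<open>All factors have modulus at most 1, so it is enough to keep finitely many primes above A
  |t|. For them |t|/p is small enough for the Taylor bound, each factor is at most exp (-c1 t^2/(4
  p^2)), and the tail sum of p^(-2) turns the product into exp (-c5 |t|/ln (A |t|)), which is
  eventually below t^(-4).\<close>

lemma char_prod_far:
  assumes C: "C > 0" "\<And>p r. prime p \<Longrightarrow> r \<ge> 1 \<Longrightarrow> b p r \<le> C / (max (real p) r) ^ 3"
    and c: "c > 0"
  obtains t0 where "t0 \<ge> 1"
    "\<And>r t L. r \<ge> 1 \<Longrightarrow> \<bar>t\<bar> \<ge> c * r \<Longrightarrow> \<bar>t\<bar> \<ge> t0 \<Longrightarrow>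
      (\<lambda>N. \<Prod>p\<in>primes_upto N. \<psi> p r t) \<longlonglongrightarrow> L \<Longrightarrow> cmod L \<le> 1 / t ^ 4"
proof -
  define c1 where "c1 = exp (- 2 * B) / 24 * g\<^sup>2"
  have c1: "c1 > 0" using g_pos by (simp add: c1_def)
  \<comment> \<open>Each summand has its own purpose: 104 for the prime sum; 1/c so that A |t| >= r
    and the primes kept exceed r; 2C/(3 c1) so that the cubic term takes at most half of the lower
    bound for the quadratic one; B so that v t^2 <= 1.\<close>
  define A where "A = 104 + 1 / c + 2 * C / (3 * c1) + B"
  have A: "A \<ge> 104" "A \<ge> 1 / c" "A \<ge> 2 * C / (3 * c1)" "A \<ge> B"
    using c C(1) c1 B_nonneg by (auto simp: A_def)
  define c5 where "c5 = c1 / (4 * 104\<^sup>2 * 2 * A)"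
  have c5: "c5 > 0" using c1 A by (simp add: c5_def)
  have "eventually (\<lambda>x. exp (- (c5 * x / ln (A * x))) \<le> 1 / x ^ 4) at_top"
    using c5 A by real_asymp
  then obtain t1 where t1: "\<And>x. x \<ge> t1 \<Longrightarrow> exp (- (c5 * x / ln (A * x))) \<le> 1 / x ^ 4"
    by (auto simp: eventually_at_top_linorder)
  have "cmod L \<le> 1 / t ^ 4" if r: "r \<ge> 1" and t: "\<bar>t\<bar> \<ge> c * r" "\<bar>t\<bar> \<ge> max 1 t1"
    and lim: "(\<lambda>N. \<Prod>p\<in>primes_upto N. \<psi> p r t) \<longlonglongrightarrow> L" for r t L
  proof -
    define x where "x = A * \<bar>t\<bar>"
    have t0: "\<bar>t\<bar> \<ge> 1" using t by simp
    have x: "x \<ge> 104" using mult_mono[of 104 A 1 "\<bar>t\<bar>"] A t0 by (simp add: x_def)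
    have xr: "x \<ge> r"
    proof -
      have "r = 1 / c * (c * r)" using c by simp
      also have "\<dots> \<le> A * \<bar>t\<bar>" using A t c r by (intro mult_mono) auto
      finally show ?thesis by (simp add: x_def)
    qed
    obtain F where F: "finite F" "\<And>p. p \<in> F \<Longrightarrow> prime p \<and> x < real p"
      "1 / (104\<^sup>2 * 2 * (x * ln x)) \<le> (\<Sum>p\<in>F. 1 / (real p)\<^sup>2)"
      using sum_primes_square_tail_lower[OF x] by blast
    have single: "cmod (\<psi> p r t) \<le> exp (- (c1 / 4 * t\<^sup>2 * (1 / (real p)\<^sup>2)))" if "p \<in> F" for p
    proof -
      have p: "prime p" "x < real p" using F that by auto
      have p0: "real p > 0" using p x by linarith
      have tp: "A * (\<bar>t\<bar> / real p) \<le> 1" using p p0 by (simp add: x_def field_simps)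
      define y where "y = \<bar>t\<bar> / real p"
      have y: "y \<ge> 0" "A * y \<le> 1" using tp by (auto simp: y_def)
      have y1: "y \<le> 1" using y A mult_right_mono[of 1 A y] by simp
      have "C * y / 6 \<le> c1 / 4"
      proof -
        have "2 * C / (3 * c1) * y \<le> 1" using A(3) y mult_right_mono[of "2 * C / (3 * c1)" A y] by simp
        thus ?thesis using c1 by (simp add: field_simps)
      qed
      hence "C * y ^ 3 / 6 \<le> c1 / 4 * y\<^sup>2"
        using mult_right_mono[of "C * y / 6" "c1 / 4" "y\<^sup>2"] by (simp add: power3_eq_cube power2_eq_square)
      moreover have "v p r * t\<^sup>2 \<ge> c1 * y\<^sup>2"
        using mult_right_mono[OF v_lower[OF p(1), of r], of "t\<^sup>2"] p(2) xr r
        by (simp add: y_def power_divide c1_def)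
      moreover have "b p r * \<bar>t\<bar> ^ 3 \<le> C * y ^ 3"
        using mult_right_mono[OF C(2)[OF p(1) r], of "\<bar>t\<bar> ^ 3"] p(2) xr
        by (simp add: y_def power_divide max_absorb1)
      moreover have "v p r * t\<^sup>2 \<le> 2"
      proof -
        have "v p r * t\<^sup>2 \<le> B\<^sup>2 / (real p)\<^sup>2 * t\<^sup>2" using v_le[OF p(1)] by (intro mult_right_mono) auto
        also have "\<dots> = (B * y)\<^sup>2" by (simp add: y_def power_divide power_mult_distrib)
        also have "\<dots> \<le> (A * y)\<^sup>2" using A y B_nonneg by (intro power_mono mult_right_mono) auto
        also have "\<dots> \<le> 1\<^sup>2" using A y by (intro power_mono) auto
        finally show ?thesis by simp
      qed
      ultimately have "cmod (\<psi> p r t) \<le> exp (- (v p r * t\<^sup>2 / 2 - C * y ^ 3 / 6))"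
        and "v p r * t\<^sup>2 / 2 - C * y ^ 3 / 6 \<ge> c1 / 4 * y\<^sup>2"
        using cmod_\<psi>_le[OF p(1), of r t "C * y ^ 3"] by (blast, linarith)
      hence "cmod (\<psi> p r t) \<le> exp (- (c1 / 4 * y\<^sup>2))"
        by (meson exp_le_cancel_iff neg_le_iff_le order.trans)
      thus ?thesis by (simp add: y_def power_divide)
    qed
    have "cmod L \<le> exp (- (c1 / 4 * t\<^sup>2 * (\<Sum>p\<in>F. 1 / (real p)\<^sup>2)))"
    proof (rule LIMSEQ_le_const2[OF tendsto_norm[OF lim]], intro exI[of _ "Max (insert 0 F)"] allI impI)
      fix N assume N: "Max (insert 0 F) \<le> N"
      have sub: "F \<subseteq> primes_upto N"
      proof
        fix p assume "p \<in> F"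
        moreover from this have "p \<le> Max (insert 0 F)" using F by (intro Max_ge) auto
        ultimately show "p \<in> primes_upto N" using F N by auto
      qed
      have "cmod (\<Prod>p\<in>primes_upto N. \<psi> p r t) = (\<Prod>p\<in>primes_upto N. cmod (\<psi> p r t))"
        by (simp add: prod_norm)
      also have "\<dots> \<le> (\<Prod>p\<in>F. cmod (\<psi> p r t))"
      proof -
        have "(\<Prod>p\<in>primes_upto N. cmod (\<psi> p r t)) =
            (\<Prod>p\<in>primes_upto N - F. cmod (\<psi> p r t)) * (\<Prod>p\<in>F. cmod (\<psi> p r t))"
          using sub by (intro prod.subset_diff) auto
        also have "\<dots> \<le> 1 * (\<Prod>p\<in>F. cmod (\<psi> p r t))"
          using finite_law.cmod_tchar_le_1[OF finite_law]
          by (intro mult_right_mono prod_le_1 prod_nonneg) auto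
        finally show ?thesis by simp
      qed
      also have "\<dots> \<le> (\<Prod>p\<in>F. exp (- (c1 / 4 * t\<^sup>2 * (1 / (real p)\<^sup>2))))"
        using single by (intro prod_mono) auto
      also have "\<dots> = exp (- (c1 / 4 * t\<^sup>2 * (\<Sum>p\<in>F. 1 / (real p)\<^sup>2)))"
        using F(1) by (simp only: exp_sum[symmetric] sum_distrib_left sum_negf)
      finally show "cmod (\<Prod>p\<in>primes_upto N. \<psi> p r t) \<le> exp (- (c1 / 4 * t\<^sup>2 * (\<Sum>p\<in>F. 1 / (real p)\<^sup>2)))" .
    qed
    also have "\<dots> \<le> exp (- (c1 / 4 * t\<^sup>2 * (1 / (104\<^sup>2 * 2 * (x * ln x)))))"
      unfolding exp_le_cancel_iff neg_le_iff_le using F(3) c1 by (intro mult_left_mono) auto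
    also have "c1 / 4 * t\<^sup>2 * (1 / (104\<^sup>2 * 2 * (x * ln x))) = c5 * \<bar>t\<bar> / ln (A * \<bar>t\<bar>)"
    proof -
      define u where "u = \<bar>t\<bar>"
      have u: "t\<^sup>2 = u * u" "u > 0" using t0 by (auto simp: u_def power2_eq_square)
      show ?thesis unfolding u(1) x_def c5_def u_def[symmetric] using u(2) A by simp
    qed
    also have "exp (- (c5 * \<bar>t\<bar> / ln (A * \<bar>t\<bar>))) \<le> 1 / \<bar>t\<bar> ^ 4" using t by (intro t1) auto
    finally show ?thesis by simp
  qed
  thus ?thesis using that[of "max 1 t1"] by simp
qed

lemma char_bounds:
  obtains c C r0 where "c > 0" "C > 0" "r0 \<ge> 104" "c * r0 \<ge> 1"
    "\<And>r t L. r \<ge> r0 \<Longrightarrow> (\<lambda>N. \<Prod>p\<in>primes_upto N. \<psi> p r t) \<longlonglongrightarrow> L \<Longrightarrow> \<bar>t\<bar> \<le> c * r \<Longrightarrow>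
      cmod (L - exp (- (K2 r * t\<^sup>2 / 2))) \<le> C * \<bar>t\<bar> ^ 3 / (r\<^sup>2 * ln r) * exp (- (K2 r * t\<^sup>2 / 4))"
    "\<And>r t L. r \<ge> r0 \<Longrightarrow> (\<lambda>N. \<Prod>p\<in>primes_upto N. \<psi> p r t) \<longlonglongrightarrow> L \<Longrightarrow> \<bar>t\<bar> \<le> c * r \<Longrightarrow>
      cmod L \<le> exp (- (K2 r * t\<^sup>2 / 4))"
    "\<And>r t L. r \<ge> r0 \<Longrightarrow> (\<lambda>N. \<Prod>p\<in>primes_upto N. \<psi> p r t) \<longlonglongrightarrow> L \<Longrightarrow> \<bar>t\<bar> \<ge> c * r \<Longrightarrow>
      cmod L \<le> 1 / t ^ 4"
proof -
  let ?P = "\<lambda>r t N. \<Prod>p\<in>primes_upto N. \<psi> p r t"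
  obtain C where C: "C > 0"
    "\<And>p r. prime p \<Longrightarrow> r \<ge> 1 \<Longrightarrow> v p r \<le> C / (max (real p) r)\<^sup>2"
    "\<And>p r. prime p \<Longrightarrow> r \<ge> 1 \<Longrightarrow> b p r \<le> C / (max (real p) r) ^ 3"
    using v_b_upper by blast
  obtain c3 where c3: "c3 > 0" "\<And>r. r \<ge> 104 \<Longrightarrow> c3 / (r * ln r) \<le> K2 r" using K2_lower by blast
  \<comment> \<open>The range |t| <= c r has to meet the three conditions of
    \<open>char_prod_near\<close>: |t| <= r, C |t| <= r, and the one on \<open>K2 r\<close>, for
    which c <= c3/(32 C) suffices in view of \<open>K2_lower\<close>. The bound t0/c in
    \<open>r0\<close> below then puts all |t| >= c r within reach of
    \<open>char_prod_far\<close>.\<close>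
  define c where "c = min 1 (min (1 / C) (c3 / (32 * C)))"
  have c: "c > 0" "c \<le> 1" "c \<le> 1 / C" "c \<le> c3 / (32 * C)" using C c3 by (auto simp: c_def)
  obtain t0 where t0: "t0 \<ge> 1" "\<And>r t L. r \<ge> 1 \<Longrightarrow> \<bar>t\<bar> \<ge> c * r \<Longrightarrow> \<bar>t\<bar> \<ge> t0 \<Longrightarrow>
      ?P r t \<longlonglongrightarrow> L \<Longrightarrow> cmod L \<le> 1 / t ^ 4"
    using char_prod_far[OF C(1) C(3) c(1)] by blast
  define r0 where "r0 = max 104 (t0 / c)"
  have r0: "r0 \<ge> 104" "c * r0 \<ge> t0" using c(1) by (auto simp: r0_def field_simps max_def)
  have hyp: "\<bar>t\<bar> \<le> r" "C * \<bar>t\<bar> \<le> r" "32 * C * \<bar>t\<bar> / (r\<^sup>2 * ln r) \<le> K2 r" "r \<ge> 2"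
    if r: "r \<ge> r0" and t: "\<bar>t\<bar> \<le> c * r" for r t
  proof -
    have r104: "r \<ge> 104" using r r0 by simp
    have le: "\<bar>t\<bar> \<le> a * r" if "c \<le> a" for a
      using t r104 mult_right_mono[OF that, of r] by linarith
    show "\<bar>t\<bar> \<le> r" "r \<ge> 2" using le[of 1] c r104 by auto
    show "C * \<bar>t\<bar> \<le> r" using mult_left_mono[OF le[OF c(3)], of C] C(1) by simp
    have "32 * C * \<bar>t\<bar> \<le> 32 * C * (c3 / (32 * C) * r)"
      using mult_left_mono[OF le[OF c(4)], of "32 * C"] C(1) by simp
    hence "32 * C * \<bar>t\<bar> / (r\<^sup>2 * ln r) \<le> 32 * C * (c3 / (32 * C) * r) / (r\<^sup>2 * ln r)"
      using r104 by (intro divide_right_mono) auto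
    also have "\<dots> = c3 / (r * ln r)" using C(1) r104 by (simp add: power2_eq_square)
    also have "\<dots> \<le> K2 r" by (rule c3(2)[OF r104])
    finally show "32 * C * \<bar>t\<bar> / (r\<^sup>2 * ln r) \<le> K2 r" .
  qed
  show ?thesis
  proof (rule that[of c "144 * (C / 6 + C\<^sup>2 / 8)" r0])
    fix r t L assume r: "r \<ge> r0" and lim: "?P r t \<longlonglongrightarrow> L"
    { assume t: "\<bar>t\<bar> \<le> c * r"
      note h = hyp[OF r t]
      show "cmod (L - exp (- (K2 r * t\<^sup>2 / 2))) \<le>
          144 * (C / 6 + C\<^sup>2 / 8) * \<bar>t\<bar> ^ 3 / (r\<^sup>2 * ln r) * exp (- (K2 r * t\<^sup>2 / 4))"
        by (rule char_prod_near(1)[OF C h(4) h(1-3) lim])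
      show "cmod L \<le> exp (- (K2 r * t\<^sup>2 / 4))"
        by (rule char_prod_near(2)[OF C h(4) h(1-3) lim]) }
    { assume t: "\<bar>t\<bar> \<ge> c * r"
      have "t0 \<le> c * r" using r0 mult_left_mono[OF r, of c] c(1) by linarith
      thus "cmod L \<le> 1 / t ^ 4" using t r r0 by (intro t0(2)[OF _ t _ lim]) auto }
  qed (use c r0 t0 C in \<open>auto intro: add_pos_nonneg\<close>)
qed

end

section \<open>The saddle point estimate\<close>

lemma has_bochner_integral_abs_odd_gaussian:
  assumes "a > (0::real)"
  shows "has_bochner_integral lborel (\<lambda>t. \<bar>t\<bar> ^ (2 * k + 1) * exp (- (a * t\<^sup>2 / 4))) (fact k * (4 / a) ^ (k + 1))"
proof -
  define s where "s = sqrt (2 / a)"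
  have s: "s > 0" "s\<^sup>2 = 2 / a" using assms by (auto simp: s_def)
  have "has_bochner_integral lborel
      (\<lambda>t. sqrt (2 * pi * s\<^sup>2) * (normal_density 0 s t * \<bar>t - 0\<bar> ^ (2 * k + 1)))
      (sqrt (2 * pi * s\<^sup>2) * (2 ^ k * s ^ (2 * k + 1) * fact k * sqrt (2 / pi)))"
    using s by (intro has_bochner_integral_mult_right normal_moment_abs_odd)
  moreover have "sqrt (2 * pi * s\<^sup>2) * (normal_density 0 s t * \<bar>t - 0\<bar> ^ (2 * k + 1)) =
      \<bar>t\<bar> ^ (2 * k + 1) * exp (- (a * t\<^sup>2 / 4))" for t
  proof -
    have "sqrt (2 * pi * s\<^sup>2) > 0" using s(1) by simp
    hence "sqrt (2 * pi * s\<^sup>2) * normal_density 0 s t = exp (- (t\<^sup>2 / (2 * s\<^sup>2)))"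
      unfolding normal_density_def using s(1) by simp
    also have "t\<^sup>2 / (2 * s\<^sup>2) = a * t\<^sup>2 / 4" using assms by (simp add: s(2) field_simps)
    finally show ?thesis by (simp add: mult_ac)
  qed
  moreover have "sqrt (2 * pi * s\<^sup>2) * (2 ^ k * s ^ (2 * k + 1) * fact k * sqrt (2 / pi)) =
      fact k * (4 / a) ^ (k + 1)"
  proof -
    have "sqrt (2 * pi * s\<^sup>2) * sqrt (2 / pi) = sqrt ((2 * s)\<^sup>2)"
      by (simp flip: real_sqrt_mult add: power_mult_distrib)
    also have "\<dots> = 2 * s" using s(1) real_sqrt_abs[of "2 * s"] by (simp only: abs_of_pos)
    finally have 1: "sqrt (2 * pi * s\<^sup>2) * sqrt (2 / pi) = 2 * s" .
    have 2: "s ^ (2 * k + 1) = s * (s\<^sup>2) ^ k" by (simp add: power_mult)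
    have "sqrt (2 * pi * s\<^sup>2) * (2 ^ k * s ^ (2 * k + 1) * fact k * sqrt (2 / pi)) =
       (sqrt (2 * pi * s\<^sup>2) * sqrt (2 / pi)) * 2 ^ k * s ^ (2 * k + 1) * fact k"
      by (simp only: mult_ac)
    also have "\<dots> = fact k * (2 * s\<^sup>2) ^ (k + 1)"
      unfolding 1 2 by (simp add: power_mult_distrib power2_eq_square)
    also have "2 * s\<^sup>2 = 4 / a" unfolding s(2) by simp
    finally show ?thesis .
  qed
  ultimately show ?thesis by (simp only:)
qed

lemma has_bochner_integral_inverse_1_plus_square:
  "has_bochner_integral lborel (\<lambda>t::real. 1 / (1 + t\<^sup>2)) pi"
  using integrable_inverse_1_plus_square LBINT_inverse_1_plus_square
  by (auto simp: has_bochner_integral_iff set_integrable_def set_lebesgue_integral_def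
      interval_lebesgue_integral_def inverse_eq_divide)

context prime_laws
begin

text \<open>The law \<nu> is kept abstract and enters only through its characteristic function;
  later it is the tilted law of the random sum. Relative to the main term 1/(r s sqrt (2 pi)), the
  two Fourier errors become s D and s J/r up to constants, where D is the L1 distance of the
  characteristic function from the Gaussian and J the integral of |t| |char|. Both are O(sqrt (ln
  r/r)).\<close>

lemma saddle_point_estimate:
  obtains C r0 where "C > 0" "r0 \<ge> 104"
    "\<And>r \<nu>. r \<ge> r0 \<Longrightarrow> real_distribution \<nu> \<Longrightarrow>
       (\<And>t. (\<lambda>N. \<Prod>p\<in>primes_upto N. \<psi> p r t) \<longlonglongrightarrow> char \<nu> t) \<Longrightarrow>
       \<bar>(\<integral>x. indicator {0<..} x * exp (- (r * x)) \<partial>\<nu>) - 1 / (r * sqrt (2 * pi * K2 r))\<bar> \<le>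
         C * (1 / (r * sqrt (2 * pi * K2 r)) * sqrt (ln r / r))"
proof -
  let ?J = "\<lambda>\<nu>. LBINT t. \<bar>t\<bar> * cmod (char \<nu> t)"
  let ?P = "\<lambda>r t N. \<Prod>p\<in>primes_upto N. \<psi> p r t"
  let ?N = "\<lambda>r. 1 / (r * sqrt (2 * pi * K2 r))"
  let ?I = "\<lambda>r \<nu>. \<integral>x. indicator {0<..} x * exp (- (r * x)) \<partial>\<nu>"
  obtain c C r0 where cC: "c > 0" "C > 0" "r0 \<ge> 104" "c * r0 \<ge> 1"
    and near: "\<And>r t L. r \<ge> r0 \<Longrightarrow> ?P r t \<longlonglongrightarrow> L \<Longrightarrow> \<bar>t\<bar> \<le> c * r \<Longrightarrow>
      cmod (L - exp (- (K2 r * t\<^sup>2 / 2))) \<le> C * \<bar>t\<bar> ^ 3 / (r\<^sup>2 * ln r) * exp (- (K2 r * t\<^sup>2 / 4))"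
    and near': "\<And>r t L. r \<ge> r0 \<Longrightarrow> ?P r t \<longlonglongrightarrow> L \<Longrightarrow> \<bar>t\<bar> \<le> c * r \<Longrightarrow>
      cmod L \<le> exp (- (K2 r * t\<^sup>2 / 4))"
    and far: "\<And>r t L. r \<ge> r0 \<Longrightarrow> ?P r t \<longlonglongrightarrow> L \<Longrightarrow> \<bar>t\<bar> \<ge> c * r \<Longrightarrow>
      cmod L \<le> 1 / t ^ 4"
    by (rule char_bounds, rule that)
  obtain c3 where c3: "c3 > 0" "\<And>r. r \<ge> 104 \<Longrightarrow> c3 / (r * ln r) \<le> K2 r" using K2_lower by blast
  \<comment> \<open>C serves for |t| <= c r. Beyond, the Gaussian itself is absorbed into the same
    majorant by 1 <= (|t|/(c r))^3, which asks for 1/c^3.\<close>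
  define Cs where "Cs = C + 1 / c ^ 3"
  have Cs: "Cs > 0" "C \<le> Cs" "1 / c ^ 3 \<le> Cs" using cC by (auto simp: Cs_def add_pos_pos)
  define \<kappa> where "\<kappa> = sqrt Kbound"
  \<comment> \<open>The summands come from \<open>e1\<close>, \<open>e2\<close> and the two parts of
    \<open>e3\<close>.\<close>
  define Cf where "Cf = 16 * Cs / sqrt c3 ^ 3 + 2 * pi / c\<^sup>2 * \<kappa> + 4 / sqrt c3 + 2 * pi * \<kappa>"
  have est: "\<bar>?I r \<nu> - ?N r\<bar> \<le>
         Cf * (?N r * sqrt (ln r / r))"
    if r: "r \<ge> r0" and \<nu>: "real_distribution \<nu>"
      and lim: "\<And>t. ?P r t \<longlonglongrightarrow> char \<nu> t" for r \<nu>
  proof -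
    interpret real_distribution \<nu> by (rule \<nu>)
    have r104: "r \<ge> 104" using r cC by simp
    have ln: "ln r \<ge> 1" using r104 exp_le by (subst ln_ge_iff) auto
    have cr: "c * r \<ge> 1" using cC mult_left_mono[OF r, of c] by linarith
    define V where "V = K2 r"
    have Vlow: "c3 / (r * ln r) \<le> V" unfolding V_def by (rule c3(2)[OF r104])
    have V: "V > 0"
    proof -
      have "0 < c3 / (r * ln r)" using c3 r104 ln by simp
      thus ?thesis using Vlow by linarith
    qed
    define s where "s = sqrt V"
    have s: "s > 0" "s\<^sup>2 = V" using V by (auto simp: s_def)
    define G where "G = (\<lambda>t::real. exp (- (V * t\<^sup>2 / 4)))"
    define d where "d = (\<lambda>t. cmod (char \<nu> t - exp (- (s\<^sup>2 * t\<^sup>2 / 2))))"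
    define S3 where "S3 = 1 / (r\<^sup>2 * ln r)"
    \<comment> \<open>One factor t^(-2) provides integrability, the other the gain (c r)^(-2). With
      the additional weight |t| only integrability is left, which is enough since J is divided by a
      further r.\<close>
    have tail: "1 / t ^ 4 \<le> 2 / (c * r)\<^sup>2 * (1 / (1 + t\<^sup>2))" "\<bar>t\<bar> * (1 / t ^ 4) \<le> 2 * (1 / (1 + t\<^sup>2))"
      if t: "\<bar>t\<bar> \<ge> c * r" for t
    proof -
      define u where "u = \<bar>t\<bar>"
      have u: "u \<ge> c * r" "u \<ge> 1" using t cr by (auto simp: u_def)
      have u2: "t\<^sup>2 = u\<^sup>2" "t ^ 4 = u ^ 4" by (auto simp: u_def)
      have 1: "1 / u\<^sup>2 \<le> 2 * (1 / (1 + u\<^sup>2))"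
        using u(2) by (simp add: field_simps power_le_one_iff add_pos_nonneg)
      have "1 / u\<^sup>2 \<le> 1 / (c * r)\<^sup>2"
        using u cr cC(1) r104 by (intro divide_left_mono power_mono mult_pos_pos zero_less_power) auto
      hence "1 / u\<^sup>2 * (1 / u\<^sup>2) \<le> 1 / (c * r)\<^sup>2 * (2 * (1 / (1 + u\<^sup>2)))" using 1 by (intro mult_mono) auto
      thus "1 / t ^ 4 \<le> 2 / (c * r)\<^sup>2 * (1 / (1 + t\<^sup>2))" unfolding u2 by (simp flip: power_add)
      have "u * (1 / u ^ 4) = 1 / u ^ 3" using u by (simp add: eval_nat_numeral)
      also have "\<dots> \<le> 1 / u\<^sup>2" using u by (intro divide_left_mono power_increasing) auto
      finally show "\<bar>t\<bar> * (1 / t ^ 4) \<le> 2 * (1 / (1 + t\<^sup>2))" using 1 unfolding u2 u_def[symmetric] by simp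
    qed
    have d_bound: "d t \<le> Cs * S3 * (\<bar>t\<bar> ^ 3 * G t) + 2 / (c * r)\<^sup>2 * (1 / (1 + t\<^sup>2))" for t
    proof (cases "\<bar>t\<bar> \<le> c * r")
      case True
      have "d t \<le> C * \<bar>t\<bar> ^ 3 / (r\<^sup>2 * ln r) * G t"
        unfolding d_def s(2) V_def G_def by (rule near[OF r lim True])
      also have "\<dots> = C * (S3 * (\<bar>t\<bar> ^ 3 * G t))" by (simp add: S3_def)
      also have "\<dots> \<le> Cs * (S3 * (\<bar>t\<bar> ^ 3 * G t))"
        using Cs r104 ln by (intro mult_right_mono mult_nonneg_nonneg) (auto simp: S3_def G_def)
      finally show ?thesis using add_increasing2[of "2 / (c * r)\<^sup>2 * (1 / (1 + t\<^sup>2))"]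
        by (simp add: mult_ac add_nonneg_nonneg)
    next
      case False
      hence t: "\<bar>t\<bar> \<ge> c * r" by simp
      have "d t \<le> cmod (char \<nu> t) + cmod (exp (- (s\<^sup>2 * t\<^sup>2 / 2)))"
        unfolding d_def by (rule norm_triangle_ineq4)
      also have "cmod (char \<nu> t) \<le> 2 / (c * r)\<^sup>2 * (1 / (1 + t\<^sup>2))"
        using far[OF r lim t] tail(1)[OF t] by simp
      also have "cmod (exp (- (s\<^sup>2 * t\<^sup>2 / 2))) = exp (- (V * t\<^sup>2 / 2))"
        by (simp only: norm_of_real s(2) abs_exp_cancel)
      also have "\<dots> \<le> Cs * S3 * (\<bar>t\<bar> ^ 3 * G t)"
      proof -
        have "1 \<le> (\<bar>t\<bar> / (c * r)) ^ 3" using t cr by (intro one_le_power) (auto simp: field_simps)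
        also have "\<dots> = 1 / c ^ 3 * (1 / r ^ 3) * \<bar>t\<bar> ^ 3" by (simp add: power_divide power_mult_distrib)
        also have "\<dots> \<le> Cs * S3 * \<bar>t\<bar> ^ 3"
        proof (intro mult_right_mono mult_mono Cs)
          have "r\<^sup>2 * ln r \<le> r\<^sup>2 * r" using r104 ln_bound[of r] by (intro mult_left_mono) auto
          thus "1 / r ^ 3 \<le> S3" unfolding S3_def using r104 ln
            by (intro divide_left_mono) (auto simp: power3_eq_cube power2_eq_square)
        qed (use Cs r104 in auto)
        finally have "1 * exp (- (V * t\<^sup>2 / 2)) \<le> Cs * S3 * \<bar>t\<bar> ^ 3 * G t"
          using V unfolding G_def by (intro mult_mono) (auto simp: mult_nonneg_nonneg)
        thus ?thesis by (simp add: mult_ac)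
      qed
      finally show ?thesis by simp
    qed
    have j_bound: "\<bar>t\<bar> * cmod (char \<nu> t) \<le> \<bar>t\<bar> ^ 1 * G t + 2 * (1 / (1 + t\<^sup>2))" for t
    proof (cases "\<bar>t\<bar> \<le> c * r")
      case True
      have "\<bar>t\<bar> * cmod (char \<nu> t) \<le> \<bar>t\<bar> * G t"
        unfolding G_def V_def by (intro mult_left_mono near'[OF r lim True]) auto
      thus ?thesis using add_nonneg_nonneg[of 1 "t\<^sup>2"] by (simp add: add_increasing2)
    next
      case False
      hence t: "\<bar>t\<bar> \<ge> c * r" by simp
      have "\<bar>t\<bar> * cmod (char \<nu> t) \<le> \<bar>t\<bar> * (1 / t ^ 4)"
        by (intro mult_left_mono far[OF r lim t]) auto
      also note tail(2)[OF t]
      finally have "\<bar>t\<bar> * cmod (char \<nu> t) \<le> 2 * (1 / (1 + t\<^sup>2))" .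
      moreover have "0 \<le> \<bar>t\<bar> ^ 1 * G t" by (simp add: G_def)
      ultimately show ?thesis by linarith
    qed
    have g3: "has_bochner_integral lborel (\<lambda>t. \<bar>t\<bar> ^ 3 * G t) (16 / V\<^sup>2)"
      using has_bochner_integral_abs_odd_gaussian[OF V, of 1] by (simp add: G_def power_divide numeral_3_eq_3 power2_eq_square)
    have g1: "has_bochner_integral lborel (\<lambda>t. \<bar>t\<bar> ^ 1 * G t) (4 / V)"
      using has_bochner_integral_abs_odd_gaussian[OF V, of 0] by (simp add: G_def)
    note q1 = has_bochner_integral_inverse_1_plus_square
    have D1: "has_bochner_integral lborel (\<lambda>t. Cs * S3 * (\<bar>t\<bar> ^ 3 * G t) + 2 / (c * r)\<^sup>2 * (1 / (1 + t\<^sup>2)))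
        (Cs * S3 * (16 / V\<^sup>2) + 2 / (c * r)\<^sup>2 * pi)"
      by (intro has_bochner_integral_add has_bochner_integral_mult_right g3 q1)
    have J1: "has_bochner_integral lborel (\<lambda>t. \<bar>t\<bar> ^ 1 * G t + 2 * (1 / (1 + t\<^sup>2))) (4 / V + 2 * pi)"
      by (intro has_bochner_integral_add has_bochner_integral_mult_right g1 q1)
    have [measurable]: "char \<nu> \<in> borel_measurable lborel" by simp
    have dint: "integrable lborel d"
    proof (rule Bochner_Integration.integrable_bound[OF integrable.intros[OF D1]])
      show "d \<in> borel_measurable lborel" unfolding d_def by measurable
      have "norm (d t) = d t" for t by (simp add: d_def)
      thus "AE t in lborel. norm (d t) \<le>
          norm (Cs * S3 * (\<bar>t\<bar> ^ 3 * G t) + 2 / (c * r)\<^sup>2 * (1 / (1 + t\<^sup>2)))"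
        unfolding real_norm_def using order.trans[OF d_bound abs_ge_self] by (intro AE_I2) simp
    qed
    have jint: "integrable lborel (\<lambda>t. \<bar>t\<bar> * cmod (char \<nu> t))"
    proof (rule Bochner_Integration.integrable_bound[OF integrable.intros[OF J1]])
      have "norm (\<bar>t\<bar> * cmod (char \<nu> t)) = \<bar>t\<bar> * cmod (char \<nu> t)" for t by (simp add: abs_mult)
      thus "AE t in lborel. norm (\<bar>t\<bar> * cmod (char \<nu> t)) \<le> norm (\<bar>t\<bar> ^ 1 * G t + 2 * (1 / (1 + t\<^sup>2)))"
        unfolding real_norm_def using order.trans[OF j_bound abs_ge_self] by (intro AE_I2) simp
    qed measurable
    have gint: "integrable lborel (\<lambda>t. complex_of_real (exp (- (s\<^sup>2 * t\<^sup>2 / 2))))"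
      using has_bochner_integral_gaussian[OF s(1)] by (auto simp: has_bochner_integral_iff)
    have cint: "integrable lborel (char \<nu>)"
    proof -
      have "integrable lborel (\<lambda>t. char \<nu> t - complex_of_real (exp (- (s\<^sup>2 * t\<^sup>2 / 2))))"
        using dint unfolding d_def by (subst (asm) integrable_norm_iff) auto
      from Bochner_Integration.integrable_add[OF this gint] show ?thesis by simp
    qed
    have D: "(LBINT t. d t) \<le> Cs * S3 * (16 / V\<^sup>2) + 2 / (c * r)\<^sup>2 * pi"
      using integral_mono[OF dint integrable.intros[OF D1] d_bound]
      unfolding has_bochner_integral_integral_eq[OF D1] .
    have J: "?J \<nu> \<le> 4 / V + 2 * pi"
      using integral_mono[OF jint integrable.intros[OF J1] j_bound]
      unfolding has_bochner_integral_integral_eq[OF J1] .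
    define \<delta> where "\<delta> = sqrt (ln r / r)"
    have main: "\<bar>?I r \<nu> - 1 / (r * s * sqrt (2 * pi))\<bar> \<le>
        (LBINT t. d t) / (2 * pi * r) + ?J \<nu> / (2 * pi * r\<^sup>2)"
      unfolding d_def using r104 by (intro integral_exp_gaussian_approx cint jint s) auto
    have \<delta>: "1 / r \<le> \<delta>" "\<delta> > 0"
    proof -
      have "1 / r = sqrt ((1 / r)\<^sup>2)" using r104 by simp
      also have "\<dots> \<le> \<delta>" unfolding \<delta>_def
      proof (rule real_sqrt_le_mono)
        have "(1 / r)\<^sup>2 = 1 / r * (1 / r)" by (simp add: power2_eq_square)
        also have "\<dots> \<le> ln r * (1 / r)" using r104 ln
          by (intro mult_right_mono order.trans[of "1 / r" 1 "ln r"]) auto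
        finally show "(1 / r)\<^sup>2 \<le> ln r / r" by simp
      qed
      finally show "1 / r \<le> \<delta>" .
      thus "\<delta> > 0" using r104 by (smt (verit) divide_pos_pos)
    qed
    \<comment> \<open>The error term of the theorem originates here: s >= sqrt (c3/(r ln r)), so
      1/(s r) is at most a constant times sqrt (ln r/r).\<close>
    have inv_s: "1 / (s * r) \<le> \<delta> / sqrt c3"
    proof -
      have "sqrt c3 / sqrt (r * ln r) \<le> s"
        unfolding s_def real_sqrt_divide[symmetric] using Vlow by (rule real_sqrt_le_mono)
      hence "1 / s \<le> sqrt (r * ln r) / sqrt c3"
        using s c3(1) r104 ln by (simp add: field_simps)
      hence "1 / s * (1 / r) \<le> sqrt (r * ln r) / sqrt c3 * (1 / r)" using r104 by (intro mult_right_mono) auto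
      also have "sqrt (r * ln r) / sqrt c3 * (1 / r) = \<delta> / sqrt c3"
      proof -
        have "sqrt r * sqrt r = r" using r104 by simp
        hence "sqrt r * (1 / r) = 1 / sqrt r" using r104 by (simp add: field_simps)
        hence "sqrt (ln r) / sqrt c3 * (sqrt r * (1 / r)) = sqrt (ln r) / sqrt c3 * (1 / sqrt r)" by simp
        thus ?thesis unfolding \<delta>_def real_sqrt_mult real_sqrt_divide by (simp add: mult_ac)
      qed
      finally show ?thesis by simp
    qed
    have s_le: "s \<le> \<kappa>" unfolding s_def \<kappa>_def V_def using K2_le by (rule real_sqrt_le_mono)
    \<comment> \<open>The left side is a constant times the cube of 1/(s r) times r/ln r. Of the
      three factors \<delta>, two cancel against r/ln r and one is left.\<close>
    have e1: "s * (Cs * S3 * (16 / V\<^sup>2)) \<le> 16 * Cs / sqrt c3 ^ 3 * \<delta>"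
    proof -
      have "s * (Cs * S3 * (16 / V\<^sup>2)) = 16 * Cs * ((1 / (s * r)) ^ 3 * (r / ln r))"
        unfolding s(2)[symmetric] S3_def using s(1) r104 ln
        by (simp add: power2_eq_square power3_eq_cube field_simps)
      also have "\<dots> \<le> 16 * Cs * ((\<delta> / sqrt c3) ^ 3 * (r / ln r))"
        using Cs s r104 ln by (intro mult_left_mono mult_right_mono power_mono inv_s) auto
      also have "(\<delta> / sqrt c3) ^ 3 * (r / ln r) = \<delta> / sqrt c3 ^ 3 * (\<delta>\<^sup>2 * (r / ln r))"
        by (simp add: power_divide power3_eq_cube power2_eq_square)
      also have "\<delta>\<^sup>2 * (r / ln r) = 1" unfolding \<delta>_def using r104 ln by simp
      finally show ?thesis by simp
    qed
    have e2: "s * (2 / (c * r)\<^sup>2 * pi) \<le> 2 * pi / c\<^sup>2 * \<kappa> * \<delta>"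
    proof -
      have "1 / r * (1 / r) \<le> \<delta> * 1" using \<delta> r104 by (intro mult_mono) auto
      hence "s * (1 / r * (1 / r)) \<le> \<kappa> * (\<delta> * 1)" using s s_le r104 \<delta>
        by (intro mult_mono) auto
      hence "2 * pi / c\<^sup>2 * (s * (1 / r * (1 / r))) \<le> 2 * pi / c\<^sup>2 * (\<kappa> * (\<delta> * 1))"
        by (intro mult_left_mono) auto
      thus ?thesis by (simp add: power2_eq_square mult_ac)
    qed
    have e3: "s * ((4 / V + 2 * pi) / r) \<le> 4 / sqrt c3 * \<delta> + 2 * pi * \<kappa> * \<delta>"
    proof -
      have "s * ((4 / V + 2 * pi) / r) = 4 * (1 / (s * r)) + 2 * pi * (s * (1 / r))"
        unfolding s(2)[symmetric] using s(1) r104 by (simp add: power2_eq_square field_simps)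
      also have "\<dots> \<le> 4 * (\<delta> / sqrt c3) + 2 * pi * (\<kappa> * \<delta>)"
        using inv_s s_le \<delta> s r104 by (intro add_mono mult_left_mono mult_mono) auto
      finally show ?thesis by simp
    qed
    have "s * ((LBINT t. d t) + ?J \<nu> / r) \<le>
        s * ((Cs * S3 * (16 / V\<^sup>2) + 2 / (c * r)\<^sup>2 * pi) + (4 / V + 2 * pi) / r)"
      using D J s r104 by (intro mult_left_mono add_mono divide_right_mono) auto
    also have "\<dots> \<le> Cf * \<delta>" using e1 e2 e3 unfolding Cf_def distrib_left distrib_right by linarith
    finally have fin: "s * ((LBINT t. d t) + ?J \<nu> / r) \<le> Cf * \<delta>" .
    have sq: "sqrt (2 * pi * K2 r) = s * sqrt (2 * pi)" unfolding s_def V_def by (simp add: real_sqrt_mult)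
    have "(LBINT t. d t) / (2 * pi * r) + ?J \<nu> / (2 * pi * r\<^sup>2) =
        s * ((LBINT t. d t) + ?J \<nu> / r) * (1 / (2 * pi * r * s))"
      using s r104 by (simp add: field_simps power2_eq_square)
    also have "\<dots> \<le> Cf * \<delta> * (1 / (2 * pi * r * s))"
      using fin s r104 by (intro mult_right_mono) auto
    also have "\<dots> \<le> Cf * \<delta> * (1 / (sqrt (2 * pi) * r * s))"
    proof -
      have "sqrt (2 * pi) \<le> 2 * pi"
        using pi_gt3 by (intro real_le_lsqrt) (auto simp: power2_eq_square)
      hence "1 / (2 * pi * r * s) \<le> 1 / (sqrt (2 * pi) * r * s)"
        using s r104 by (intro divide_left_mono mult_right_mono) auto
      moreover have "Cf * \<delta> \<ge> 0"
      proof -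
        have "0 \<le> s * ((LBINT t. d t) + ?J \<nu> / r)"
          using s r104 by (intro mult_nonneg_nonneg add_nonneg_nonneg divide_nonneg_nonneg integral_nonneg)
            (auto simp: d_def)
        thus ?thesis using fin by linarith
      qed
      ultimately show ?thesis by (rule mult_left_mono)
    qed
    finally show ?thesis using main unfolding sq \<delta>_def by (simp add: mult_ac)
  qed
  \<comment> \<open>The constant \<open>\<bar>Cf\<bar> + 1\<close> is positive whatever the sign of
    \<open>Cf\<close>.\<close>
  have "\<bar>?I r \<nu> - ?N r\<bar> \<le>
         (\<bar>Cf\<bar> + 1) * (?N r * sqrt (ln r / r))"
    if r: "r \<ge> r0" and \<nu>: "real_distribution \<nu>"
      and lim: "\<And>t. ?P r t \<longlonglongrightarrow> char \<nu> t" for r \<nu>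
  proof -
    have "r \<ge> 104" using r cC by simp
    moreover have "0 \<le> K2 r" using sum_v_le_K2[of "{}" r] by simp
    ultimately have "0 \<le> ?N r * sqrt (ln r / r)" by simp
    from mult_right_mono[OF _ this, of Cf "\<bar>Cf\<bar> + 1"] show ?thesis using est[OF that] by linarith
  qed
  thus ?thesis using that[of "\<bar>Cf\<bar> + 1" r0] cC by simp
qed

section \<open>Existence and uniqueness of the saddle point\<close>

lemma K2_pos:
  assumes "r \<ge> 0"
  shows "K2 r > 0"
proof -
  obtain p where p: "prime p" "p > nat \<lceil>r\<rceil>" using bigger_prime by blast
  hence "r \<le> real p" by linarith
  have "0 < exp (- 2 * B) / 24 * g\<^sup>2 / (real p)\<^sup>2"
    using g_pos prime_gt_0_nat[OF p(1)] by simp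
  also have "\<dots> \<le> v p r" by (rule v_lower) fact+
  also have "\<dots> \<le> K2 r" using sum_v_le_K2[of "{p}" r] p by simp
  finally show ?thesis .
qed

lemma K1_strict_mono: "0 \<le> x \<Longrightarrow> x < y \<Longrightarrow> K1 x < K1 y"
  using K1_deriv K2_pos by (intro DERIV_pos_imp_increasing[of x y K1]) (force)+

text \<open>The lower bound c/(r ln r) for the derivative \<open>K2\<close> integrates to c ln (ln
  r), which is unbounded; this is what provides a saddle point at every high level.\<close>

lemma K1_at_top: "filterlim K1 at_top at_top"
proof -
  obtain c where c: "c > 0" "\<And>r. r \<ge> 104 \<Longrightarrow> c / (r * ln r) \<le> K2 r" using K2_lower by blast
  define a where "a = K1 104 - c * ln (ln 104)"
  have le: "a + c * ln (ln r) \<le> K1 r" if r: "r \<ge> 104" for r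
  proof -
    have "K1 104 - c * ln (ln 104) \<le> K1 r - c * ln (ln r)"
    proof (rule DERIV_nonneg_imp_nondecreasing[OF r])
      fix x :: real assume x: "104 \<le> x"
      have "ln x > 0" using x by simp
      hence "((\<lambda>r. K1 r - c * ln (ln r)) has_real_derivative (K2 x - c / (x * ln x))) (at x)"
        using x by (auto intro!: derivative_eq_intros K1_deriv simp: field_simps)
      thus "\<exists>z. ((\<lambda>r. K1 r - c * ln (ln r)) has_real_derivative z) (at x) \<and> 0 \<le> z"
        using c(2)[OF x] by force
    qed
    thus ?thesis by (simp add: a_def)
  qed
  have "filterlim (\<lambda>r. a + c * ln (ln r)) at_top at_top" using c(1) by real_asymp
  thus ?thesis by (rule filterlim_at_top_mono) (use le in \<open>auto simp: eventually_at_top_linorder\<close>)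
qed

lemma K1_ex1:
  assumes "a > K1 0"
  shows "\<exists>!k. k > 0 \<and> K1 k = a"
proof -
  have "eventually (\<lambda>r. K1 r \<ge> a \<and> r \<ge> 0) at_top"
    using K1_at_top by (auto simp: filterlim_at_top eventually_conj_iff eventually_ge_at_top)
  then obtain R where R: "K1 R \<ge> a" "R \<ge> 0" using eventually_happens by force
  have "\<exists>k\<ge>0. k \<le> R \<and> K1 k = a"
    using assms R by (intro IVT) (auto intro!: DERIV_isCont[OF K1_deriv])
  then obtain k where "k \<ge> 0" "K1 k = a" by auto
  moreover have "k \<noteq> 0" using assms \<open>K1 k = a\<close> by auto
  ultimately have "k > 0 \<and> K1 k = a" by simp
  moreover have "x = y" if "x > 0 \<and> K1 x = a" "y > 0 \<and> K1 y = a" for x y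
    using that K1_strict_mono[of x y] K1_strict_mono[of y x] by (cases x y rule: linorder_cases) auto
  ultimately show ?thesis by blast
qed

end

section \<open>Tilting the random sum\<close>

text \<open>Bounded second moments give uniform integrability, which replaces a dominating function.
  Fatou's lemma places g in L2; then Y <= min Y c + Y^2/c for Y = |f n - g| splits the L1 distance
  into a part handled by bounded convergence and a part of at most 4B/c.\<close>

lemma (in finite_measure) tendsto_integral_of_L2_bounded:
  fixes f :: "nat \<Rightarrow> 'a \<Rightarrow> 'c::{banach, second_countable_topology}"
  assumes [measurable]: "\<And>n. f n \<in> borel_measurable M" "g \<in> borel_measurable M"
    and lim: "AE x in M. (\<lambda>n. f n x) \<longlonglongrightarrow> g x"
    and int: "\<And>n. integrable M (\<lambda>x. (norm (f n x))\<^sup>2)"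
    and bound: "\<And>n. (\<integral>x. (norm (f n x))\<^sup>2 \<partial>M) \<le> B"
  shows "integrable M g" and "(\<lambda>n. \<integral>x. f n x \<partial>M) \<longlonglongrightarrow> (\<integral>x. g x \<partial>M)"
proof -
  let ?e = "\<lambda>n x. ennreal ((norm (f n x))\<^sup>2)"
  have B: "B \<ge> 0" using bound[of 0] by (rule order.trans[rotated]) simp
  have "(\<integral>\<^sup>+x. ennreal ((norm (g x))\<^sup>2) \<partial>M) = (\<integral>\<^sup>+x. liminf (\<lambda>n. ?e n x) \<partial>M)"
  proof (rule nn_integral_cong_AE)
    show "AE x in M. ennreal ((norm (g x))\<^sup>2) = liminf (\<lambda>n. ?e n x)"
      using lim
    proof eventually_elim
      case (elim x)
      hence "(\<lambda>n. ?e n x) \<longlonglongrightarrow> ennreal ((norm (g x))\<^sup>2)"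
        by (intro tendsto_ennrealI tendsto_intros)
      from lim_imp_Liminf[OF trivial_limit_sequentially this] show ?case by (rule sym)
    qed
  qed
  also have "\<dots> \<le> liminf (\<lambda>n. \<integral>\<^sup>+x. ?e n x \<partial>M)"
    by (rule nn_integral_liminf) auto
  also have "\<dots> \<le> ennreal B"
  proof -
    have "(\<integral>\<^sup>+x. ?e n x \<partial>M) \<le> ennreal B" for n
      using bound[of n] int[of n] by (subst nn_integral_eq_integral) (auto intro: ennreal_leI)
    thus ?thesis by (intro Liminf_le) auto
  qed
  finally have nn: "(\<integral>\<^sup>+x. ennreal ((norm (g x))\<^sup>2) \<partial>M) \<le> ennreal B" .
  have g2: "integrable M (\<lambda>x. (norm (g x))\<^sup>2)"
    using nn by (intro integrableI_nonneg) (auto simp: less_top[symmetric] top_unique)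
  have g2B: "(\<integral>x. (norm (g x))\<^sup>2 \<partial>M) \<le> B"
    using nn B by (subst integral_eq_nn_integral) (auto intro: enn2real_leI)
  have L1: "integrable M h" if [measurable]: "h \<in> borel_measurable M" and h: "integrable M (\<lambda>x. (norm (h x))\<^sup>2)"
    for h :: "'a \<Rightarrow> 'c"
  proof (rule Bochner_Integration.integrable_bound)
    show "integrable M (\<lambda>x. 1 + (norm (h x))\<^sup>2)" using h by auto
    have "norm (h x) \<le> 1 + (norm (h x))\<^sup>2" for x
    proof -
      have "2 * norm (h x) \<le> 1 + (norm (h x))\<^sup>2"
        using zero_le_power2[of "norm (h x) - 1"] by (simp add: power2_eq_square algebra_simps)
      thus ?thesis using norm_ge_zero[of "h x"] by linarith
    qed
    thus "AE x in M. norm (h x) \<le> norm (1 + (norm (h x))\<^sup>2)" by (intro AE_I2) simp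
  qed auto
  show gint: "integrable M g" using g2 by (intro L1) auto
  have fint: "integrable M (f n)" for n using int by (intro L1) auto
  define Y where "Y = (\<lambda>n x. norm (f n x - g x))"
  have Ym[measurable]: "Y n \<in> borel_measurable M" for n unfolding Y_def by measurable
  have Y0: "Y n x \<ge> 0" for n x by (simp add: Y_def)
  have Ysq: "(Y n x)\<^sup>2 \<le> 2 * (norm (f n x))\<^sup>2 + 2 * (norm (g x))\<^sup>2" for n x
  proof -
    have "(Y n x)\<^sup>2 \<le> (norm (f n x) + norm (g x))\<^sup>2"
      unfolding Y_def by (intro power_mono norm_triangle_ineq4) auto
    also have "\<dots> \<le> 2 * (norm (f n x))\<^sup>2 + 2 * (norm (g x))\<^sup>2"
      using zero_le_power2[of "norm (f n x) - norm (g x)"] by (simp add: power2_eq_square algebra_simps)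
    finally show ?thesis .
  qed
  have sumint: "integrable M (\<lambda>x. 2 * (norm (f n x))\<^sup>2 + 2 * (norm (g x))\<^sup>2)" for n
    using int g2 by auto
  have Y2: "integrable M (\<lambda>x. (Y n x)\<^sup>2)" for n
    by (rule Bochner_Integration.integrable_bound[OF sumint[of n]]) (auto intro!: AE_I2 simp: Ysq)
  have Y2B: "(\<integral>x. (Y n x)\<^sup>2 \<partial>M) \<le> 4 * B" for n
  proof -
    have "(\<integral>x. (Y n x)\<^sup>2 \<partial>M) \<le> (\<integral>x. 2 * (norm (f n x))\<^sup>2 + 2 * (norm (g x))\<^sup>2 \<partial>M)"
      using Y2 sumint Ysq by (intro integral_mono) auto
    also have "\<dots> = 2 * (\<integral>x. (norm (f n x))\<^sup>2 \<partial>M) + 2 * (\<integral>x. (norm (g x))\<^sup>2 \<partial>M)"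
      using int g2 by simp
    finally show ?thesis using bound[of n] g2B by simp
  qed
  have Yint: "integrable M (Y n)" for n unfolding Y_def using fint gint by auto
  have lim0: "(\<lambda>n. \<integral>x. Y n x \<partial>M) \<longlonglongrightarrow> 0"
  proof (rule LIMSEQ_I)
    fix e :: real assume e: "e > 0"
    \<comment> \<open>This makes 4B/c <= e/2; the summand 1 keeps c positive when B = 0.\<close>
    define c where "c = 8 * B / e + 1"
    have c: "c > 0" using e B by (simp add: c_def add_nonneg_pos)
    have "(\<lambda>n. \<integral>x. min (Y n x) c \<partial>M) \<longlonglongrightarrow> (\<integral>x. 0 \<partial>M)"
    proof (rule integral_dominated_convergence[where w = "\<lambda>_. c"])
      show "AE x in M. (\<lambda>n. min (Y n x) c) \<longlonglongrightarrow> 0"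
        using lim
      proof eventually_elim
        case (elim x)
        hence "(\<lambda>n. min (Y n x) c) \<longlonglongrightarrow> min (norm (g x - g x)) c"
          unfolding Y_def by (intro tendsto_intros)
        thus ?case using c by simp
      qed
    qed (use c Y0 in auto)
    hence "eventually (\<lambda>n. (\<integral>x. min (Y n x) c \<partial>M) < e / 2) sequentially"
      using e by (intro order_tendstoD(2)[of _ 0]) auto
    then obtain N where N: "\<And>n. n \<ge> N \<Longrightarrow> (\<integral>x. min (Y n x) c \<partial>M) < e / 2"
      by (auto simp: eventually_sequentially)
    have "norm ((\<integral>x. Y n x \<partial>M) - 0) < e" if n: "n \<ge> N" for n
    proof -
      have mint: "integrable M (\<lambda>x. min (Y n x) c)"
        by (rule Bochner_Integration.integrable_bound[OF Yint[of n]]) (use c Y0 in \<open>auto intro!: AE_I2\<close>)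
      have "(\<integral>x. Y n x \<partial>M) \<le> (\<integral>x. min (Y n x) c + (Y n x)\<^sup>2 / c \<partial>M)"
      proof (intro integral_mono Yint Bochner_Integration.integrable_add mint)
        fix x
        show "Y n x \<le> min (Y n x) c + (Y n x)\<^sup>2 / c"
        proof (cases "Y n x \<le> c")
          case False
          hence "Y n x * c \<le> (Y n x)\<^sup>2" using Y0 by (simp add: power2_eq_square mult_left_mono)
          hence "Y n x \<le> (Y n x)\<^sup>2 / c" using c by (simp add: field_simps)
          thus ?thesis using False c by simp
        qed (use c in auto)
      qed (use Y2 in auto)
      also have "\<dots> = (\<integral>x. min (Y n x) c \<partial>M) + (\<integral>x. (Y n x)\<^sup>2 \<partial>M) / c"
        using mint Y2 by simp
      also have "(\<integral>x. (Y n x)\<^sup>2 \<partial>M) / c \<le> 4 * B / c" using Y2B c by (intro divide_right_mono) auto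
      finally have "(\<integral>x. Y n x \<partial>M) \<le> (\<integral>x. min (Y n x) c \<partial>M) + 4 * B / c" by simp
      moreover have "4 * B / c \<le> e / 2" using c e B by (simp add: c_def field_simps)
      ultimately have "(\<integral>x. Y n x \<partial>M) < e" using N[OF n] by linarith
      moreover have "(\<integral>x. Y n x \<partial>M) \<ge> 0" using Y0 by simp
      ultimately show ?thesis by simp
    qed
    thus "\<exists>no. \<forall>n\<ge>no. norm ((\<integral>x. Y n x \<partial>M) - 0) < e" by blast
  qed
  have le: "norm ((\<integral>x. f n x \<partial>M) - (\<integral>x. g x \<partial>M)) \<le> (\<integral>x. Y n x \<partial>M)" for n
  proof -
    have "(\<integral>x. f n x \<partial>M) - (\<integral>x. g x \<partial>M) = (\<integral>x. f n x - g x \<partial>M)" using fint gint by simp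
    thus ?thesis unfolding Y_def by (simp add: integral_norm_bound)
  qed
  show "(\<lambda>n. \<integral>x. f n x \<partial>M) \<longlonglongrightarrow> (\<integral>x. g x \<partial>M)"
    by (rule LIM_zero_cancel, rule Lim_null_comparison[OF _ lim0]) (intro always_eventually allI le)
qed

lemma (in prob_space) AE_finite_range:
  fixes X :: "'a \<Rightarrow> 'b::t2_space"
  assumes X[measurable]: "X \<in> borel_measurable M"
    and S: "finite S" and mass: "(\<Sum>z\<in>S. measure M {x \<in> space M. X x = z}) = 1"
  shows "{x \<in> space M. X x = z} \<in> sets M" and "AE x in M. X x \<in> S"
proof -
  have sets: "{x \<in> space M. X x = z} \<in> sets M" for z
  proof -
    have "X -` {z} \<inter> space M \<in> sets M" by (intro measurable_sets[OF X]) simp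
    moreover have "X -` {z} \<inter> space M = {x \<in> space M. X x = z}" by auto
    ultimately show ?thesis by simp
  qed
  thus "{x \<in> space M. X x = z} \<in> sets M" .
  define U where "U = (\<Union>z\<in>S. {x \<in> space M. X x = z})"
  have "measure M U = (\<Sum>z\<in>S. measure M {x \<in> space M. X x = z})"
    unfolding U_def using S sets by (intro finite_measure_finite_Union) (auto simp: disjoint_family_on_def)
  hence "prob U = 1" using mass by simp
  moreover have "U \<in> events" unfolding U_def using S sets by auto
  ultimately have "AE x in M. x \<in> U" by (simp add: prob_eq_1)
  thus "AE x in M. X x \<in> S" by eventually_elim (auto simp: U_def)
qed

lemma (in prob_space) expectation_finite_range:
  fixes X :: "'a \<Rightarrow> 'b::t2_space" and f :: "'b \<Rightarrow> 'c::{banach, second_countable_topology}"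
  assumes X[measurable]: "X \<in> borel_measurable M" and f[measurable]: "f \<in> borel_measurable borel"
    and S: "finite S" and mass: "(\<Sum>z\<in>S. measure M {x \<in> space M. X x = z}) = 1"
  shows "integrable M (\<lambda>x. f (X x))"
    and "(\<integral>x. f (X x) \<partial>M) = (\<Sum>z\<in>S. measure M {x \<in> space M. X x = z} *\<^sub>R f z)"
proof -
  have [measurable]: "{x \<in> space M. X x = z} \<in> sets M" for z
    by (rule AE_finite_range[OF X S mass])
  have "AE x in M. X x \<in> S \<and> x \<in> space M"
    using AE_finite_range(2)[OF X S mass] by simp
  hence ae: "AE x in M. f (X x) = (\<Sum>z\<in>S. indicator {x \<in> space M. X x = z} x *\<^sub>R f z)"
  proof eventually_elim
    case (elim x)
    hence x: "X x \<in> S" "x \<in> space M" by auto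
    have "(\<Sum>z\<in>S. indicator {x \<in> space M. X x = z} x *\<^sub>R f z) = (\<Sum>z\<in>{X x}. f z)"
      using x S by (intro sum.mono_neutral_cong_right) (auto simp: indicator_def)
    thus ?case by simp
  qed
  have int: "integrable M (\<lambda>x. \<Sum>z\<in>S. indicator {x \<in> space M. X x = z} x *\<^sub>R f z)"
    by (intro Bochner_Integration.integrable_sum integrable_scaleR_left integrable_real_indicator)
       (auto simp: less_top[symmetric])
  show "integrable M (\<lambda>x. f (X x))"
    using int ae by (subst integrable_cong_AE[OF _ _ ae]) auto
  have "(\<integral>x. f (X x) \<partial>M) = (\<integral>x. (\<Sum>z\<in>S. indicator {x \<in> space M. X x = z} x *\<^sub>R f z) \<partial>M)"
    using int ae by (intro integral_cong_AE) auto
  also have "\<dots> = (\<Sum>z\<in>S. \<integral>x. indicator {x \<in> space M. X x = z} x *\<^sub>R f z \<partial>M)"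
    by (intro Bochner_Integration.integral_sum integrable_scaleR_left integrable_real_indicator)
       (auto simp: less_top[symmetric])
  also have "\<dots> = (\<Sum>z\<in>S. measure M {x \<in> space M. X x = z} *\<^sub>R f z)"
    by (intro sum.cong refl) (subst integral_scaleR_left, auto simp: less_top[symmetric])
  finally show "(\<integral>x. f (X x) \<partial>M) = (\<Sum>z\<in>S. measure M {x \<in> space M. X x = z} *\<^sub>R f z)" .
qed


text \<open>\<open>W\<close> is given as an almost sure limit of partial sums over increasing
  primes, because terms of size 1/p have no summable bound. The point masses in \<open>X_law\<close>
  determine the law of \<open>X p\<close>: over S they add up to 1, so \<open>X p\<close> lies in S
  almost surely.\<close>

locale random_prime_sum = prob_space M + prime_laws S q w T B g
  for M :: "'a measure" and S :: "complex set" and q w T B g +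
  fixes X :: "nat \<Rightarrow> 'a \<Rightarrow> complex" and W :: "'a \<Rightarrow> real"
  assumes X_measurable: "\<And>p. prime p \<Longrightarrow> X p \<in> borel_measurable M"
    and w_measurable [measurable]: "\<And>p. w p \<in> borel_measurable borel"
    and X_indep: "indep_vars (\<lambda>_. borel) X {p. prime p}"
    and X_law: "\<And>p z. prime p \<Longrightarrow> z \<in> S \<Longrightarrow> measure M {x \<in> space M. X p x = z} = q p z"
    and W_measurable [measurable]: "W \<in> borel_measurable M"
    and W_limit: "AE x in M. (\<lambda>N. \<Sum>p\<in>primes_upto N. w p (X p x)) \<longlonglongrightarrow> W x"
begin

definition WN :: "nat \<Rightarrow> 'a \<Rightarrow> real" where
  "WN N \<omega> = (\<Sum>p\<in>primes_upto N. w p (X p \<omega>))"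

lemma WN_measurable [measurable]: "WN N \<in> borel_measurable M"
proof -
  have "(\<lambda>x. w p (X p x)) \<in> borel_measurable M" if "p \<in> primes_upto N" for p
    using that by (intro measurable_compose[OF X_measurable w_measurable]) auto
  thus ?thesis unfolding WN_def[abs_def] by (intro borel_measurable_sum)
qed

text \<open>The moment generating function at complex arguments: real s yields the moments, s = r +
  i t the characteristic function under the tilt r.\<close>

definition Zc :: "nat \<Rightarrow> complex \<Rightarrow> complex" where
  "Zc p s = (\<Sum>x\<in>S. complex_of_real (q p x) * exp (s * complex_of_real (w p x)))"

lemma Zc_of_real: "prime p \<Longrightarrow> Zc p (of_real r) = of_real (Z p r)"
  unfolding Zc_def finite_law.mgf_def[OF finite_law] by (simp flip: exp_of_real)

lemma expectation_exp_WN: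
  shows "integrable M (\<lambda>x. exp (s * complex_of_real (WN N x)))"
    and "(\<integral>x. exp (s * complex_of_real (WN N x)) \<partial>M) = (\<Prod>p\<in>primes_upto N. Zc p s)"
proof -
  define Y where "Y = (\<lambda>p x. exp (s * complex_of_real (w p (X p x))))"
  have eq: "exp (s * complex_of_real (WN N x)) = (\<Prod>p\<in>primes_upto N. Y p x)" for x
    unfolding WN_def Y_def by (simp add: sum_distrib_left exp_sum)
  have meas: "(\<lambda>z. exp (s * complex_of_real (w p z))) \<in> borel_measurable borel" for p
    by measurable
  have Y: "integrable M (Y p)" "(\<integral>x. Y p x \<partial>M) = Zc p s" if p: "prime p" for p
  proof -
    have "(\<Sum>z\<in>S. measure M {x \<in> space M. X p x = z}) = 1"
      using X_law[OF p] finite_law.q_sum[OF finite_law[OF p]] by simp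
    note * = expectation_finite_range[OF X_measurable[OF p] meas finite_law.finite_S[OF finite_law[OF p]] this]
    show "integrable M (Y p)" unfolding Y_def by (rule *)
    show "(\<integral>x. Y p x \<partial>M) = Zc p s"
      unfolding Y_def *(2) Zc_def using X_law[OF p] by (intro sum.cong) (auto simp: scaleR_conv_of_real)
  qed
  have indep: "indep_vars (\<lambda>_. borel) Y (primes_upto N)"
    unfolding Y_def
    by (rule indep_vars_compose2[OF indep_vars_subset[OF X_indep]]) (auto intro!: meas)
  show "integrable M (\<lambda>x. exp (s * complex_of_real (WN N x)))"
    unfolding eq using Y by (intro indep_vars_integrable indep) auto
  show "(\<integral>x. exp (s * complex_of_real (WN N x)) \<partial>M) = (\<Prod>p\<in>primes_upto N. Zc p s)"
    unfolding eq using Y by (subst indep_vars_lebesgue_integral[OF _ indep]) auto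
qed

lemma prod_Z_tendsto: "(\<lambda>N. \<Prod>p\<in>primes_upto N. Z p r) \<longlonglongrightarrow> exp (K r)"
proof -
  have "(\<lambda>N. exp (\<Sum>p\<in>primes_upto N. ln (Z p r))) \<longlonglongrightarrow> exp (K r)"
    unfolding K_def by (intro tendsto_exp sum_primes_upto_tendsto[of "\<lambda>p. ln (Z p r)"] summable_ln_Z)
  moreover have "exp (\<Sum>p\<in>primes_upto N. ln (Z p r)) = (\<Prod>p\<in>primes_upto N. Z p r)" for N
    by (subst exp_sum) (auto intro!: prod.cong simp: finite_law.mgf_pos[OF finite_law])
  ultimately show ?thesis by simp
qed

text \<open>Since |exp (s x)|^2 = exp (2 Re(s) x) for real x, the second moments for the partial
  sums are products of \<open>Z\<close> at 2 Re(s), which converge and are therefore bounded; this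
  is what the L2 criterion requires.\<close>

lemma expectation_exp_W:
  shows integrable_exp_W: "integrable M (\<lambda>y. exp (s * complex_of_real (W y)))"
    and prod_Zc_tendsto: "(\<lambda>N. \<Prod>p\<in>primes_upto N. Zc p s) \<longlonglongrightarrow> (\<integral>y. exp (s * complex_of_real (W y)) \<partial>M)"
proof -
  define r where "r = 2 * Re s"
  have sq: "(norm (exp (s * complex_of_real x)))\<^sup>2 = exp (r * x)" for x
    by (simp add: r_def power2_eq_square flip: exp_add)
  have rc: "complex_of_real (exp (r * x)) = exp (complex_of_real r * complex_of_real x)" for x
    by (simp flip: exp_of_real)
  have int: "integrable M (\<lambda>y. exp (r * WN N y))" for N
  proof -
    have "integrable M (\<lambda>y. complex_of_real (exp (r * WN N y)))"
      unfolding rc by (rule expectation_exp_WN)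
    from integrable_Re[OF this] show ?thesis by simp
  qed
  have val: "(\<integral>y. exp (r * WN N y) \<partial>M) = (\<Prod>p\<in>primes_upto N. Z p r)" for N
  proof -
    have "complex_of_real (\<integral>y. exp (r * WN N y) \<partial>M) = (\<integral>y. complex_of_real (exp (r * WN N y)) \<partial>M)"
      by simp
    also have "\<dots> = (\<Prod>p\<in>primes_upto N. Zc p (of_real r))" unfolding rc by (rule expectation_exp_WN)
    also have "\<dots> = complex_of_real (\<Prod>p\<in>primes_upto N. Z p r)"
      unfolding of_real_prod by (intro prod.cong) (auto simp: Zc_of_real)
    finally show ?thesis by (simp only: of_real_eq_iff)
  qed
  have "Bseq (\<lambda>N. \<Prod>p\<in>primes_upto N. Z p r)"
    using prod_Z_tendsto by (intro convergent_imp_Bseq) (auto simp: convergent_def)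
  then obtain C where C: "\<And>N. norm (\<Prod>p\<in>primes_upto N. Z p r) \<le> C" by (auto simp: Bseq_def)
  have C': "(\<Prod>p\<in>primes_upto N. Z p r) \<le> C" for N using C[of N] by simp
  have lim: "AE y in M. (\<lambda>N. exp (s * complex_of_real (WN N y))) \<longlonglongrightarrow> exp (s * complex_of_real (W y))"
    using W_limit unfolding WN_def[symmetric] by eventually_elim (intro tendsto_intros)
  note * = tendsto_integral_of_L2_bounded[OF _ _ lim, where B = C, unfolded sq val expectation_exp_WN, OF _ _ int C']
  show "integrable M (\<lambda>y. exp (s * complex_of_real (W y)))" by (rule *) auto
  show "(\<lambda>N. \<Prod>p\<in>primes_upto N. Zc p s) \<longlonglongrightarrow> (\<integral>y. exp (s * complex_of_real (W y)) \<partial>M)"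
    by (rule *) auto
qed

lemma mgf_W:
  shows "integrable M (\<lambda>y. exp (r * W y))" and "(\<integral>y. exp (r * W y) \<partial>M) = exp (K r)"
proof -
  have rc: "complex_of_real (exp (r * x)) = exp (complex_of_real r * complex_of_real x)" for x
    by (simp flip: exp_of_real)
  have "integrable M (\<lambda>y. complex_of_real (exp (r * W y)))" unfolding rc by (rule integrable_exp_W)
  from integrable_Re[OF this] show "integrable M (\<lambda>y. exp (r * W y))" by simp
  have "(\<Prod>p\<in>primes_upto N. Zc p (of_real r)) = complex_of_real (\<Prod>p\<in>primes_upto N. Z p r)" for N
    unfolding of_real_prod by (intro prod.cong) (auto simp: Zc_of_real)
  hence "(\<lambda>N. \<Prod>p\<in>primes_upto N. Zc p (of_real r)) \<longlonglongrightarrow> complex_of_real (exp (K r))"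
    using tendsto_of_real[OF prod_Z_tendsto[of r], where 'a = complex] by (simp only:)
  from LIMSEQ_unique[OF this prod_Zc_tendsto]
  have "complex_of_real (exp (K r)) = (\<integral>y. complex_of_real (exp (r * W y)) \<partial>M)" by (simp add: rc)
  also have "\<dots> = complex_of_real (\<integral>y. exp (r * W y) \<partial>M)" by simp
  finally show "(\<integral>y. exp (r * W y) \<partial>M) = exp (K r)" by (simp only: of_real_eq_iff)
qed

definition tilted :: "real \<Rightarrow> real measure" where
  "tilted r = distr (density M (\<lambda>\<omega>. ennreal (exp (r * W \<omega> - K r)))) borel (\<lambda>\<omega>. W \<omega> - K1 r)"

lemma real_distribution_tilted: "real_distribution (tilted r)"
proof -
  have "(\<integral>\<^sup>+x. ennreal (exp (r * W x - K r)) \<partial>M) = ennreal (\<integral>x. exp (r * W x - K r) \<partial>M)"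
    using mgf_W(1)[of r] by (intro nn_integral_eq_integral) (auto simp: exp_diff)
  also have "(\<integral>x. exp (r * W x - K r) \<partial>M) = 1" using mgf_W(2)[of r] by (simp add: exp_diff)
  finally interpret D: prob_space "density M (\<lambda>x. ennreal (exp (r * W x - K r)))"
    by (intro prob_spaceI) (simp add: emeasure_density nn_set_integral_space)
  show ?thesis unfolding tilted_def by (intro D.real_distribution_distr) simp
qed

lemma integral_tilted:
  fixes f :: "real \<Rightarrow> 'c::{banach, second_countable_topology}"
  assumes [measurable]: "f \<in> borel_measurable borel"
  shows "(\<integral>x. f x \<partial>tilted r) = (\<integral>y. exp (r * W y - K r) *\<^sub>R f (W y - K1 r) \<partial>M)"
proof -
  have "(\<integral>x. f x \<partial>tilted r) =
      (\<integral>y. f (W y - K1 r) \<partial>density M (\<lambda>y. ennreal (exp (r * W y - K r))))"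
    unfolding tilted_def by (rule integral_distr) measurable
  also have "\<dots> = (\<integral>y. exp (r * W y - K r) *\<^sub>R f (W y - K1 r) \<partial>M)"
    by (rule integral_density) auto
  finally show ?thesis .
qed

text \<open>By \<open>tchar_eq\<close> the partial product is a phase formed with the sum of the
  means, times the product of \<open>Zc\<close>, divided by the product of \<open>Z\<close>. In the
  limit these become the centring at \<open>K1 r\<close>, the expectation of exp ((r + i t) W) and
  the normalization exp (\<open>K r\<close>) of the tilted law.\<close>

lemma char_tilted: "(\<lambda>N. \<Prod>p\<in>primes_upto N. \<psi> p r t) \<longlonglongrightarrow> char (tilted r) t"
proof -
  let ?ex = "\<lambda>x. exp (Complex r t * complex_of_real (W x))"
  let ?PZ = "\<lambda>N. \<Prod>p\<in>primes_upto N. Zc p (Complex r t)"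
  have "(\<Prod>p\<in>primes_upto N. \<psi> p r t) = iexp (- (t * (\<Sum>p\<in>primes_upto N. m p r))) *
      ?PZ N / of_real (\<Prod>p\<in>primes_upto N. Z p r)" for N
  proof -
    have "(\<Prod>p\<in>primes_upto N. \<psi> p r t) =
        (\<Prod>p\<in>primes_upto N. iexp (- (t * m p r)) * Zc p (Complex r t) / of_real (Z p r))"
      by (intro prod.cong) (auto simp: finite_law.tchar_eq[OF finite_law] Zc_def)
    also have "\<dots> = (\<Prod>p\<in>primes_upto N. iexp (- (t * m p r))) *
        ?PZ N / of_real (\<Prod>p\<in>primes_upto N. Z p r)"
      by (simp only: prod_dividef prod.distrib of_real_prod)
    also have "(\<Prod>p\<in>primes_upto N. iexp (- (t * m p r))) = iexp (- (t * (\<Sum>p\<in>primes_upto N. m p r)))"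
      by (subst exp_sum[symmetric]) (auto simp: sum_distrib_left sum_negf)
    finally show ?thesis .
  qed
  moreover have "(\<lambda>N. iexp (- (t * (\<Sum>p\<in>primes_upto N. m p r))) *
      ?PZ N / of_real (\<Prod>p\<in>primes_upto N. Z p r))
      \<longlonglongrightarrow> iexp (- (t * K1 r)) * (\<integral>x. ?ex x \<partial>M) / of_real (exp (K r))"
    unfolding K1_def
    by (intro tendsto_intros prod_Zc_tendsto prod_Z_tendsto sum_primes_upto_tendsto[of "\<lambda>p. m p r"] summable_m) auto
  moreover have "iexp (- (t * K1 r)) * (\<integral>x. ?ex x \<partial>M) / of_real (exp (K r))
      = char (tilted r) t"
  proof -
    have "char (tilted r) t = (\<integral>x. exp (r * W x - K r) *\<^sub>R iexp (t * (W x - K1 r)) \<partial>M)"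
      unfolding char_def by (rule integral_tilted) measurable
    also have "\<dots> = (\<integral>x. (iexp (- (t * K1 r)) / of_real (exp (K r))) * ?ex x \<partial>M)"
    proof (intro Bochner_Integration.integral_cong refl)
      fix x
      have "?ex x = of_real (exp (r * W x)) * iexp (t * W x)"
        by (simp add: Complex_eq algebra_simps exp_add flip: exp_of_real)
      thus "exp (r * W x - K r) *\<^sub>R iexp (t * (W x - K1 r)) =
          (iexp (- (t * K1 r)) / of_real (exp (K r))) * ?ex x"
        by (simp add: scaleR_conv_of_real exp_diff right_diff_distrib exp_minus divide_inverse)
    qed
    also have "\<dots> = (iexp (- (t * K1 r)) / of_real (exp (K r))) * (\<integral>x. ?ex x \<partial>M)"
      by (rule integral_mult_right_zero)
    finally show ?thesis by simp
  qed
  ultimately show ?thesis by simp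
qed

lemma tail_eq_tilted:
  "measure M {y \<in> space M. W y > K1 r} =
     exp (K r - r * K1 r) * (\<integral>x. indicator {0<..} x * exp (- (r * x)) \<partial>tilted r)"
proof -
  let ?I = "\<integral>x. indicator {0<..} x * exp (- (r * x)) \<partial>tilted r"
  have "?I =
      (\<integral>y. exp (r * W y - K r) *\<^sub>R (indicator {0<..} (W y - K1 r) * exp (- (r * (W y - K1 r)))) \<partial>M)"
    by (rule integral_tilted) measurable
  also have "\<dots> = (\<integral>y. exp (r * K1 r - K r) * indicator {y \<in> space M. W y > K1 r} y \<partial>M)"
    by (intro Bochner_Integration.integral_cong refl)
       (auto simp: indicator_def algebra_simps simp flip: exp_add)
  also have "\<dots> = exp (r * K1 r - K r) * measure M {y \<in> space M. W y > K1 r}"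
    by (subst integral_mult_right_zero) (simp add: emeasure_eq_measure)
  finally have "?I =
      exp (r * K1 r - K r) * measure M {y \<in> space M. W y > K1 r}" .
  thus ?thesis by (simp add: mult.assoc[symmetric] flip: exp_add)
qed

lemma tail_estimate:
  obtains C r0 where "C > 0" "r0 \<ge> 104"
    "\<And>r. r \<ge> r0 \<Longrightarrow>
      \<bar>measure M {y \<in> space M. W y > K1 r} - exp (K r - r * K1 r) / (r * sqrt (2 * pi * K2 r))\<bar>
      \<le> C * (exp (K r - r * K1 r) / (r * sqrt (2 * pi * K2 r)) * sqrt (ln r / r))"
proof (rule saddle_point_estimate)
  let ?I = "\<lambda>r. \<integral>x. indicator {0<..} x * exp (- (r * x)) \<partial>tilted r"
  let ?N = "\<lambda>r. 1 / (r * sqrt (2 * pi * K2 r))"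
  fix C r0 :: real
  assume C: "C > 0" "r0 \<ge> 104"
    "\<And>r \<nu>. r \<ge> r0 \<Longrightarrow> real_distribution \<nu> \<Longrightarrow>
       (\<And>t. (\<lambda>N. \<Prod>p\<in>primes_upto N. \<psi> p r t) \<longlonglongrightarrow> char \<nu> t) \<Longrightarrow>
       \<bar>(\<integral>x. indicator {0<..} x * exp (- (r * x)) \<partial>\<nu>) - ?N r\<bar> \<le>
         C * (?N r * sqrt (ln r / r))"
  show thesis
  proof (rule that[OF C(1,2)])
    fix r assume r: "r \<ge> r0"
    define E where "E = exp (K r - r * K1 r)"
    have "\<bar>E * ?I r - E * (?N r)\<bar> =
        E * \<bar>?I r - ?N r\<bar>"
      unfolding right_diff_distrib[symmetric] abs_mult by (simp add: E_def)
    also have "\<dots> \<le> E * (C * (?N r * sqrt (ln r / r)))"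
      by (intro mult_left_mono C(3)[OF r real_distribution_tilted char_tilted]) (simp add: E_def)
    finally show "\<bar>measure M {y \<in> space M. W y > K1 r} - exp (K r - r * K1 r) / (r * sqrt (2 * pi * K2 r))\<bar>
      \<le> C * (exp (K r - r * K1 r) / (r * sqrt (2 * pi * K2 r)) * sqrt (ln r / r))"
      unfolding tail_eq_tilted E_def[symmetric] by (simp add: mult_ac)
  qed
qed

end

section \<open>The cubic model\<close>

context prob_space
begin

text \<open>
  The partial sums at cubes converge by a second moment bound, and the trivial bound
  $7Ck^2/k^3$ controls the sums between $k^3$ and $(k+1)^3$, so no maximal inequality is needed.
\<close>

lemma AE_convergent_orthogonal_series:
  fixes Y :: "nat \<Rightarrow> 'a \<Rightarrow> real"
  assumes meas[measurable]: "\<And>n. Y n \<in> borel_measurable M"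
    and bound: "\<And>n. AE x in M. \<bar>Y n x\<bar> \<le> C / real n"
    and orth: "\<And>i j. i \<noteq> j \<Longrightarrow> (\<integral>x. Y i x * Y j x \<partial>M) = 0"
  shows "AE x in M. convergent (\<lambda>N. \<Sum>n<N. Y n x)"
proof -
  let ?I = "\<lambda>i j. \<integral>x. Y i x * Y j x \<partial>M"
  let ?S = "\<lambda>N x. \<Sum>n<N. Y n x"
  have C: "C \<ge> 0"
  proof -
    have "AE x in M. C \<ge> 0" using bound[of 1] by eventually_elim auto
    thus ?thesis by simp
  qed
  have bounds: "AE x in M. \<forall>n. \<bar>Y n x\<bar> \<le> C / real n" using bound by (simp add: AE_all_countable)
  have int2: "integrable M (\<lambda>x. Y i x * Y j x)" for i j
  proof (rule integrable_const_bound[where B = "C / real i * (C / real j)"])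
    show "AE x in M. norm (Y i x * Y j x) \<le> C / real i * (C / real j)"
      using bounds
    proof eventually_elim
      case (elim x)
      hence "\<bar>Y i x\<bar> * \<bar>Y j x\<bar> \<le> C / real i * (C / real j)" using C by (intro mult_mono) auto
      thus ?case by (simp add: abs_mult)
    qed
  qed simp
  define A where "A = (\<lambda>k::nat. {k ^ 3..<(Suc k) ^ 3})"
  define D where "D = (\<lambda>k x. \<Sum>n\<in>A k. Y n x)"
  have cardA: "real (card (A k)) \<le> 7 * real k ^ 2" if "k \<ge> 1" for k
  proof -
    have "real k * 1 \<le> real k * real k" using that by (intro mult_left_mono) auto
    moreover have "1 \<le> real k * real k" using that mult_mono[of 1 "real k" 1 "real k"] by simp
    moreover have "real (card (A k)) = real (Suc k) ^ 3 - real k ^ 3"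
      unfolding A_def by (simp add: of_nat_diff power_mono)
    ultimately show ?thesis by (simp add: power3_eq_cube power2_eq_square algebra_simps)
  qed
  have nA: "C / real n \<le> C / real k ^ 3" if "n \<in> A k" "k \<ge> 1" for n k
  proof -
    have "k ^ 3 \<le> n" using that by (simp add: A_def)
    hence "real k ^ 3 \<le> real n" by (metis of_nat_le_iff of_nat_power)
    moreover have "real k ^ 3 > 0" using that(2) by simp
    ultimately show ?thesis using C by (intro divide_left_mono mult_pos_pos) linarith+
  qed
  have Dm[measurable]: "D k \<in> borel_measurable M" for k unfolding D_def by measurable
  have Dsq: "(D k x)\<^sup>2 = (\<Sum>i\<in>A k. \<Sum>j\<in>A k. Y i x * Y j x)" for k x
    unfolding D_def power2_eq_square sum_product ..
  have Dint: "integrable M (\<lambda>x. (D k x)\<^sup>2)" for k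
    unfolding Dsq by (intro Bochner_Integration.integrable_sum int2)
  \<comment> \<open>A block has at most 7 k^2 terms, each with second moment at most C^2/k^6, so by
    orthogonality its second moment is O(k^(-4)); the weight k^2 uses half of this power and leaves
    a summable bound.\<close>
  have DE: "(\<integral>x. (real k)\<^sup>2 * (D k x)\<^sup>2 \<partial>M) \<le> 7 * C\<^sup>2 / (real k)\<^sup>2" for k
  proof (cases "k \<ge> 1")
    case True
    have "(\<integral>x. (D k x)\<^sup>2 \<partial>M) = (\<Sum>i\<in>A k. \<Sum>j\<in>A k. ?I i j)"
      unfolding Dsq by (subst Bochner_Integration.integral_sum)
        (auto intro!: Bochner_Integration.integrable_sum int2 sum.cong Bochner_Integration.integral_sum)
    also have "\<dots> = (\<Sum>i\<in>A k. \<Sum>j\<in>{i}. ?I i j)"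
      by (intro sum.cong refl sum.mono_neutral_right) (auto simp: A_def orth)
    also have "\<dots> \<le> (\<Sum>i\<in>A k. (C / real k ^ 3)\<^sup>2)"
    proof (intro sum_mono)
      fix i assume i: "i \<in> A k"
      have "(\<integral>x. Y i x * Y i x \<partial>M) \<le> (\<integral>x. (C / real k ^ 3)\<^sup>2 \<partial>M)"
      proof (rule integral_mono_AE[OF int2])
        show "AE x in M. Y i x * Y i x \<le> (C / real k ^ 3)\<^sup>2"
          using bounds
        proof eventually_elim
          case (elim x)
          have "\<bar>Y i x\<bar> \<le> C / real k ^ 3" using elim nA[OF i True] by (meson order.trans)
          from power_mono[OF this abs_ge_zero, of 2] show ?case by (simp add: power2_eq_square)
        qed
      qed auto
      thus "(\<Sum>j\<in>{i}. ?I i j) \<le> (C / real k ^ 3)\<^sup>2" by (simp add: prob_space)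
    qed
    also have "\<dots> = real (card (A k)) * (C / real k ^ 3)\<^sup>2" by simp
    also have "\<dots> \<le> 7 * real k ^ 2 * (C / real k ^ 3)\<^sup>2" using cardA[OF True] by (intro mult_right_mono) auto
    finally have "(real k)\<^sup>2 * (\<integral>x. (D k x)\<^sup>2 \<partial>M) \<le> (real k)\<^sup>2 * (7 * real k ^ 2 * (C / real k ^ 3)\<^sup>2)"
      by (intro mult_left_mono) auto
    also have "\<dots> = 7 * C\<^sup>2 / (real k)\<^sup>2"
      using True by (simp add: power2_eq_square power3_eq_cube)
    finally show ?thesis by simp
  qed (auto simp: not_le)
  have "(\<integral>\<^sup>+x. (\<Sum>k. ennreal ((real k)\<^sup>2 * (D k x)\<^sup>2)) \<partial>M) =
      (\<Sum>k. \<integral>\<^sup>+x. ennreal ((real k)\<^sup>2 * (D k x)\<^sup>2) \<partial>M)"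
    by (rule nn_integral_suminf) measurable
  also have "\<dots> = (\<Sum>k. ennreal (\<integral>x. (real k)\<^sup>2 * (D k x)\<^sup>2 \<partial>M))"
    by (intro suminf_cong nn_integral_eq_integral integrable_mult_right Dint) auto
  also have "\<dots> \<le> (\<Sum>k. ennreal (7 * C\<^sup>2 / (real k)\<^sup>2))"
    by (intro suminf_le ennreal_leI DE) auto
  also have "\<dots> = ennreal (\<Sum>k. 7 * C\<^sup>2 / (real k)\<^sup>2)"
    by (intro suminf_ennreal2 summable_inverse_squares_scaled) auto
  also have "\<dots> < top" by simp
  finally have "(\<integral>\<^sup>+x. (\<Sum>k. ennreal ((real k)\<^sup>2 * (D k x)\<^sup>2)) \<partial>M) \<noteq> \<infinity>" by simp
  hence "AE x in M. (\<Sum>k. ennreal ((real k)\<^sup>2 * (D k x)\<^sup>2)) \<noteq> \<infinity>"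
    by (intro nn_integral_noteq_infinite) auto
  thus ?thesis using bounds
  proof eventually_elim
    case (elim x)
    have "summable (\<lambda>k. (real k)\<^sup>2 * (D k x)\<^sup>2)"
      using elim(1) by (intro summable_suminf_not_top) auto
    hence s2: "summable (\<lambda>k. 1 / (real k)\<^sup>2 + (real k)\<^sup>2 * (D k x)\<^sup>2)"
      by (intro summable_add summable_inverse_squares_scaled)
    have "summable (\<lambda>k. D k x)"
    proof (rule summable_comparison_test[OF _ s2], intro exI[of _ 1] allI impI)
      fix k :: nat assume k: "k \<ge> 1"
      define u where "u = real k * \<bar>D k x\<bar>"
      \<comment> \<open>Arithmetic-geometric mean: |D k x| is the product of 1/k and k |D k x|,
        hence dominated by 1/k^2 plus the weighted square, whose sum over k is finite almost
        surely.\<close>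
      have "0 \<le> (1 / real k - u)\<^sup>2" by simp
      hence "2 * (1 / real k * u) \<le> 1 / (real k)\<^sup>2 + u\<^sup>2" by (simp add: power2_eq_square algebra_simps)
      moreover have "1 / real k * u = \<bar>D k x\<bar>" "u\<^sup>2 = (real k)\<^sup>2 * (D k x)\<^sup>2"
        using k by (auto simp: u_def power_mult_distrib)
      ultimately show "norm (D k x) \<le> 1 / (real k)\<^sup>2 + (real k)\<^sup>2 * (D k x)\<^sup>2" by simp
    qed
    then obtain l where l: "(\<lambda>K. \<Sum>k<K. D k x) \<longlonglongrightarrow> l" by (auto simp: summable_def sums_def)
    have TK: "(\<Sum>k<K. D k x) = ?S (K ^ 3) x" for K
    proof (induction K)
      case (Suc K)
      have "K ^ 3 \<le> Suc K ^ 3" by (intro power_mono) auto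
      hence "(\<Sum>n<Suc K ^ 3. Y n x) = ?S (K ^ 3) x + D K x"
        unfolding D_def A_def
        using sum.atLeastLessThan_concat[of 0 "K ^ 3" "Suc K ^ 3" "\<lambda>n. Y n x"] by (simp only: lessThan_atLeast0)
      thus ?case using Suc by simp
    qed auto
    have "(\<lambda>N. \<Sum>n<N. Y n x) \<longlonglongrightarrow> l"
    proof (rule LIMSEQ_I)
      fix e :: real assume e: "e > 0"
      obtain K1 where K1: "\<And>K. K \<ge> K1 \<Longrightarrow> norm (?S (K ^ 3) x - l) < e / 2"
        using LIMSEQ_D[OF l, of "e / 2"] e unfolding TK by auto
      \<comment> \<open>The factor 14 keeps the incomplete block, which is at most 7C/k, below
        e/2.\<close>
      obtain K2 :: nat where K2: "14 * C / e < real K2" using reals_Archimedean2 by blast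
      define K where "K = max 1 (max K1 K2)"
      have "norm (?S N x - l) < e" if N: "N \<ge> K ^ 3" for N
      proof -
        define k where "k = (GREATEST k. k ^ 3 \<le> N)"
        have ex: "K ^ 3 \<le> N" using N .
        have bd: "\<forall>y. y ^ 3 \<le> N \<longrightarrow> y \<le> N"
        proof (intro allI impI)
          fix y :: nat assume "y ^ 3 \<le> N"
          moreover have "y \<le> y ^ 3" using self_le_power[of y 3] by (cases "y = 0") auto
          ultimately show "y \<le> N" by simp
        qed
        have k1: "k ^ 3 \<le> N" unfolding k_def by (rule GreatestI_nat[where P = "\<lambda>k. k ^ 3 \<le> N", OF ex]) (use bd in auto)
        have k2: "K \<le> k" unfolding k_def by (rule Greatest_le_nat[where P = "\<lambda>k. k ^ 3 \<le> N", OF ex]) (use bd in auto)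
        have k3: "N < Suc k ^ 3"
        proof (rule ccontr)
          assume "\<not> N < Suc k ^ 3"
          hence "Suc k ^ 3 \<le> N" by simp
          hence "Suc k \<le> k" unfolding k_def by (rule Greatest_le_nat[where P = "\<lambda>k. k ^ 3 \<le> N"]) (use bd in auto)
          thus False by simp
        qed
        have kpos: "k \<ge> 1" "k \<ge> K1" "k \<ge> K2" using k2 by (auto simp: K_def)
        have "?S N x = ?S (k ^ 3) x + (\<Sum>n\<in>{k ^ 3..<N}. Y n x)"
          using sum.atLeastLessThan_concat[of 0 "k ^ 3" N "\<lambda>n. Y n x"] k1 by (simp only: lessThan_atLeast0)
        hence "norm (?S N x - l) \<le> norm (?S (k ^ 3) x - l) + norm (\<Sum>n\<in>{k ^ 3..<N}. Y n x)"
          using norm_triangle_ineq[of "?S (k ^ 3) x - l" "\<Sum>n\<in>{k ^ 3..<N}. Y n x"]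
          by (simp add: algebra_simps)
        also have "norm (?S (k ^ 3) x - l) < e / 2" using K1 kpos by auto
        also have "norm (\<Sum>n\<in>{k ^ 3..<N}. Y n x) \<le> (\<Sum>n\<in>A k. C / real k ^ 3)"
        proof -
          have "norm (\<Sum>n\<in>{k ^ 3..<N}. Y n x) \<le> (\<Sum>n\<in>{k ^ 3..<N}. norm (Y n x))" by (rule norm_sum)
          also have "\<dots> \<le> (\<Sum>n\<in>A k. norm (Y n x))"
            using k3 by (intro sum_mono2) (auto simp: A_def)
          also have "\<dots> \<le> (\<Sum>n\<in>A k. C / real k ^ 3)"
          proof (intro sum_mono)
            fix n assume "n \<in> A k"
            thus "norm (Y n x) \<le> C / real k ^ 3" using nA[of n k] kpos elim(2) by (metis order.trans real_norm_def)
          qed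
          finally show ?thesis .
        qed
        also have "(\<Sum>n\<in>A k. C / real k ^ 3) = real (card (A k)) * (C / real k ^ 3)" by simp
        also have "\<dots> \<le> 7 * real k ^ 2 * (C / real k ^ 3)"
          using cardA kpos C by (intro mult_right_mono) auto
        also have "\<dots> = 7 * C / real k" using kpos by (simp add: power2_eq_square power3_eq_cube)
        also have "\<dots> \<le> e / 2"
        proof -
          have "14 * C / e \<le> real k" using K2 kpos by linarith
          thus ?thesis using e kpos by (simp add: field_simps)
        qed
        finally show ?thesis by simp
      qed
      thus "\<exists>no. \<forall>N\<ge>no. norm (?S N x - l) < e" by blast
    qed
    thus ?case by (auto simp: convergent_def)
  qed
qed

end

section \<open>Values, weights and logarithms at a single prime\<close>

lemma norm_omega3 [simp]: "norm omega3 = 1"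
  by (simp add: omega3_def)

lemma omega3_eq: "omega3 = Complex (- 1 / 2) (sqrt 3 / 2)"
proof -
  have "2 * pi / 3 = pi - pi / 3" by simp
  hence "cos (2 * pi / 3) = - 1 / 2" "sin (2 * pi / 3) = sqrt 3 / 2"
    by (simp_all only: cos_pi_minus sin_pi_minus cos_60 sin_60)
  thus ?thesis by (simp add: omega3_def complex_eq_iff)
qed

lemma omega3_sq_eq: "omega3\<^sup>2 = Complex (- 1 / 2) (- sqrt 3 / 2)"
  by (simp add: omega3_eq power2_eq_square complex_eq_iff)

lemma omega3_distinct [simp]:
  "omega3 \<noteq> 0" "omega3 \<noteq> 1" "omega3\<^sup>2 \<noteq> 1" "omega3\<^sup>2 \<noteq> omega3"
  "1 \<noteq> omega3" "1 \<noteq> omega3\<^sup>2" "omega3 \<noteq> omega3\<^sup>2" "0 \<noteq> omega3"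
proof -
  have im: "Im omega3 = sqrt 3 / 2" "Im (omega3\<^sup>2) = - (sqrt 3 / 2)"
    unfolding omega3_sq_eq by (simp_all add: omega3_eq)
  have "Im omega3 \<noteq> 0" "Im (omega3\<^sup>2) \<noteq> 0" "Im omega3 \<noteq> Im (omega3\<^sup>2)"
    unfolding im by simp_all
  thus "omega3 \<noteq> 0" "omega3 \<noteq> 1" "omega3\<^sup>2 \<noteq> 1" "omega3\<^sup>2 \<noteq> omega3"
    "1 \<noteq> omega3" "1 \<noteq> omega3\<^sup>2" "omega3 \<noteq> omega3\<^sup>2" "0 \<noteq> omega3"
    by (metis zero_complex.sel(2) one_complex.sel(2))+
qed

text \<open>The value 0 is listed for every prime, with weight 0 where X(p) cannot vanish, so that
  one set serves all laws.\<close>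

definition xvals :: "complex set" where
  "xvals = {0, 1, omega3, omega3\<^sup>2}"

lemma finite_xvals: "finite xvals"
  by (simp add: xvals_def)

lemma sum_xvals: "(\<Sum>z\<in>xvals. f z) = f 0 + f 1 + f omega3 + (f (omega3\<^sup>2) :: 'c::comm_monoid_add)"
  unfolding xvals_def by (simp add: add.assoc)

lemma norm_xvals: "z \<in> xvals \<Longrightarrow> norm z \<le> 1"
  unfolding xvals_def by (auto simp: norm_power)

lemma xweight_eq:
  "xweight p omega3 = xweight p 1" "xweight p (omega3\<^sup>2) = xweight p 1"
  "xweight p 0 + 3 * xweight p 1 = 1"
proof -
  have "2 / (real p + 2) + 3 * (real p / (3 * (real p + 2))) = (2 + real p) / (real p + 2)"
  proof -
    have "3 * (a / (3 * b)) = a / b" for a b :: real by simp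
    thus ?thesis by (simp only: add_divide_distrib)
  qed
  also have "\<dots> = 1" by simp
  finally show "xweight p 0 + 3 * xweight p 1 = 1" by (auto simp: xweight_def)
qed (auto simp: xweight_def)

text \<open>The expression p/(3(p+2)) increases in p and equals 1/6 at p = 2; this is the origin of
  the mass 1/6 demanded by \<open>gapped_finite_law\<close>.\<close>

lemma xweight_bounds:
  assumes "p \<ge> 2"
  shows "xweight p 0 \<ge> 0" "xweight p 1 \<ge> 1 / 6" "xweight p 1 \<le> 1 / 3"
  using assms by (auto simp: xweight_def field_simps)

lemma sum_xweight: "(\<Sum>z\<in>xvals. xweight p z) = 1"
  using xweight_eq(3)[of p] by (simp only: sum_xvals xweight_eq(1,2))

lemma sum_xweight_id: "(\<Sum>z\<in>xvals. xweight p z *\<^sub>R z) = 0"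
proof -
  have "1 + omega3 + omega3\<^sup>2 = 0" unfolding omega3_sq_eq unfolding omega3_eq by (simp add: complex_eq_iff)
  hence "xweight p 1 *\<^sub>R (1 + omega3 + omega3\<^sup>2) = 0" by simp
  thus ?thesis unfolding sum_xvals xweight_eq by (simp add: scaleR_add_right)
qed

text \<open>The contribution of p to 2 \<sigma> ln |L(1,X)|, where \<sigma> = 1 serves the upper and
  \<sigma> = -1 the lower tail. The factor 2 makes exp (r W) equal to |L(1,X)|^(2 \<sigma> r), the
  moment in \<open>Lcal\<close> and \<open>Ltil\<close>.\<close>

definition wval :: "real \<Rightarrow> nat \<Rightarrow> complex \<Rightarrow> real" where
  "wval \<sigma> p z = - 2 * \<sigma> * ln (norm (1 - z / of_nat p))"

lemma wval_eq:
  assumes p: "p \<ge> 2"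
  shows "wval s p 0 = 0" "wval s p 1 = s * (- 2 * ln (1 - 1 / p))"
    "wval s p omega3 = - s * ln (1 + 1 / p + (1 / p)\<^sup>2)"
    "wval s p (omega3\<^sup>2) = - s * ln (1 + 1 / p + (1 / p)\<^sup>2)"
proof -
  show "wval s p 0 = 0" by (simp add: wval_def)
  have "1 - 1 / of_nat p = complex_of_real (1 - 1 / p)" by simp
  hence "norm (1 - 1 / of_nat p :: complex) = 1 - 1 / p"
    using p by (simp only: norm_of_real) simp
  thus "wval s p 1 = s * (- 2 * ln (1 - 1 / p))" by (simp add: wval_def)
  have *: "wval s p (Complex (- 1 / 2) y) = - s * ln (1 + 1 / p + (1 / p)\<^sup>2)" if y: "y\<^sup>2 = 3 / 4" for y
  proof -
    have "Complex (- 1 / 2) y / of_nat p = Complex (- 1 / 2 / p) (y / p)"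
      using p by (simp add: complex_eq_iff Re_divide_of_nat Im_divide_of_nat)
    hence "norm (1 - Complex (- 1 / 2) y / of_nat p) = sqrt ((1 + 1 / 2 / p)\<^sup>2 + (y / p)\<^sup>2)"
      by (simp add: cmod_def)
    also have "(1 + 1 / 2 / p)\<^sup>2 + (y / p)\<^sup>2 = 1 + 1 / p + (1 / p)\<^sup>2"
    proof -
      have "(1 + u / 2)\<^sup>2 + (y * u)\<^sup>2 = 1 + u + (1 / 4 + y\<^sup>2) * u\<^sup>2" for u :: real
        by (simp add: power2_eq_square algebra_simps)
      from this[of "1 / p"] show ?thesis using y by (simp add: mult.commute)
    qed
    finally have "ln (norm (1 - Complex (- 1 / 2) y / of_nat p)) = ln (1 + 1 / p + (1 / p)\<^sup>2) / 2"
      by (simp add: ln_sqrt add_pos_nonneg)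
    thus ?thesis by (simp add: wval_def)
  qed
  show "wval s p omega3 = - s * ln (1 + 1 / p + (1 / p)\<^sup>2)"
    unfolding omega3_eq by (rule *) (simp add: power_divide)
  show "wval s p (omega3\<^sup>2) = - s * ln (1 + 1 / p + (1 / p)\<^sup>2)"
    unfolding omega3_sq_eq by (rule *) (simp add: power_divide)
qed

lemma ln_bounds:
  fixes x :: real
  assumes x: "0 < x" "x \<le> 1 / 2"
  shows "2 * x \<le> - 2 * ln (1 - x)" "- 2 * ln (1 - x) \<le> 2 * x + 4 * x\<^sup>2"
    "x - x\<^sup>2 \<le> ln (1 + x + x\<^sup>2)" "ln (1 + x + x\<^sup>2) \<le> x + x\<^sup>2"
proof -
  show 1: "2 * x \<le> - 2 * ln (1 - x)" using ln_one_minus_pos_upper_bound[of x] x by simp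
  show "- 2 * ln (1 - x) \<le> 2 * x + 4 * x\<^sup>2" using ln_one_minus_pos_lower_bound[of x] x by simp
  show "ln (1 + x + x\<^sup>2) \<le> x + x\<^sup>2" using ln_add_one_self_le_self[of "x + x\<^sup>2"] x by (simp add: add.assoc)
  have x2: "x\<^sup>2 \<le> 1 / 4" using power_mono[of x "1/2" 2] x by (simp add: power2_eq_square)
  have x3: "x ^ 3 \<le> x\<^sup>2 / 2" using mult_left_mono[OF x(2), of "x\<^sup>2"] by (simp add: power3_eq_cube power2_eq_square)
  have x6: "(x ^ 3)\<^sup>2 \<le> x\<^sup>2 / 16"
  proof -
    have "(x ^ 3)\<^sup>2 = x\<^sup>2 * (x\<^sup>2 * x\<^sup>2)" by (simp add: power2_eq_square power3_eq_cube)
    also have "\<dots> \<le> x\<^sup>2 * (1 / 4 * (1 / 4))" using x2 by (intro mult_left_mono mult_mono) auto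
    finally show ?thesis by simp
  qed
  \<comment> \<open>This factorization reduces the lower bound for ln (1 + x + x^2) to bounds for ln
    (1 - x) and ln (1 - x^3).\<close>
  have "(1 - x) * (1 + x + x\<^sup>2) = 1 - x ^ 3" by (simp add: algebra_simps power2_eq_square power3_eq_cube)
  hence "ln (1 - x) + ln (1 + x + x\<^sup>2) = ln (1 - x ^ 3)"
    using x ln_mult_pos[of "1 - x" "1 + x + x\<^sup>2"] by (simp add: add_pos_nonneg)
  moreover have "- (x ^ 3) - 2 * (x ^ 3)\<^sup>2 \<le> ln (1 - x ^ 3)"
    using x x3 x2 by (intro ln_one_minus_pos_lower_bound) auto
  ultimately show "x - x\<^sup>2 \<le> ln (1 + x + x\<^sup>2)" using 1 x3 x6 zero_le_power2[of x] by linarith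
qed

text \<open>With x = 1/p the values are 0, s a at 1 and -s b at the two other cube roots of unity,
  where a = 2x + O(x^2) and b = x + O(x^2); all are at most 4x in size. The top value is a for s = 1
  and b for s = -1, the next one is 0, and the smaller gap b >= x - x^2 >= x/2 is the origin of 1/2.
  The mean is a multiple of a - 2b = O(x^2): the linear terms cancel because X(p) has mean
  zero.\<close>

lemma prime_laws_xweight:
  assumes s: "s = 1 \<or> s = -1"
  shows "prime_laws xvals xweight (wval s) (\<lambda>p. if s = 1 then wval s p 1 else wval s p omega3) 4 (1 / 2)"
proof (rule prime_laws.intro)
  fix p :: nat assume p: "prime p"
  have p2: "p \<ge> 2" using prime_ge_2_nat[OF p] .
  define x where "x = 1 / real p"
  have x: "0 < x" "x \<le> 1 / 2" using p2 by (auto simp: x_def field_simps)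
  define a where "a = - 2 * ln (1 - x)"
  define b where "b = ln (1 + x + x\<^sup>2)"
  have ab: "2 * x \<le> a" "a \<le> 2 * x + 4 * x\<^sup>2" "x - x\<^sup>2 \<le> b" "b \<le> x + x\<^sup>2"
    unfolding a_def b_def by (rule ln_bounds[OF x])+
  have x2: "x\<^sup>2 \<le> x / 2" using mult_left_mono[OF x(2), of x] x by (simp add: power2_eq_square)
  have w: "wval s p 0 = 0" "wval s p 1 = s * a" "wval s p omega3 = - s * b" "wval s p (omega3\<^sup>2) = - s * b"
    using wval_eq[OF p2, of s] by (simp_all add: a_def b_def x_def)
  note xb = xweight_bounds[OF p2]
  define T where "T = (if s = 1 then wval s p 1 else wval s p omega3)"
  have qnn: "xweight p z \<ge> 0" if "z \<in> xvals" for z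
    using that xb unfolding xvals_def by (auto simp: xweight_eq)
  have mass: "1 / 6 \<le> (\<Sum>z\<in>{z\<in>xvals. P z}. xweight p z)" if "P z0" "z0 \<in> xvals" "z0 \<noteq> 0" for P z0
  proof -
    have "1 / 6 \<le> xweight p z0" using that xb by (auto simp: xvals_def xweight_eq)
    also have "\<dots> \<le> (\<Sum>z\<in>{z\<in>xvals. P z}. xweight p z)"
      using that finite_xvals qnn by (intro member_le_sum) auto
    finally show ?thesis .
  qed
  show "gapped_finite_law xvals (xweight p) (wval s p) (4 / real p)
      (if s = 1 then wval s p 1 else wval s p omega3) (1 / 2 / real p)"
    unfolding T_def[symmetric]
  proof
    show "finite xvals" by (rule finite_xvals)
    show "xweight p z \<ge> 0" if "z \<in> xvals" for z by (rule qnn[OF that])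
    show "(\<Sum>z\<in>xvals. xweight p z) = 1" by (rule sum_xweight)
    show "\<bar>wval s p z\<bar> \<le> 4 / real p" if "z \<in> xvals" for z
    proof -
      have "4 / real p = 4 * x" by (simp add: x_def)
      thus ?thesis using that s w ab x x2 unfolding xvals_def by (elim insertE) (auto simp: abs_if)
    qed
    show "wval s p z = T \<or> wval s p z \<le> T - 1 / 2 / real p" if "z \<in> xvals" for z
    proof -
      have "1 / 2 / real p = x / 2" by (simp add: x_def)
      thus ?thesis using that s w ab x x2 unfolding xvals_def T_def by (elim insertE) auto
    qed
    show "0 < 1 / 2 / real p" using p2 by simp
    have ne: "s * a \<noteq> - s * b" using s ab x x2 by auto
    show "1 / 6 \<le> (\<Sum>z\<in>{z\<in>xvals. wval s p z = T}. xweight p z)"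
      by (rule mass[of _ "if s = 1 then 1 else omega3"]) (auto simp: T_def xvals_def)
    show "1 / 6 \<le> (\<Sum>z\<in>{z\<in>xvals. wval s p z \<noteq> T}. xweight p z)"
      by (rule mass[of _ "if s = 1 then omega3 else 1"]) (use ne w in \<open>auto simp: T_def xvals_def\<close>)
  qed
  have "(\<Sum>z\<in>xvals. xweight p z * wval s p z) = xweight p 1 * (s * (a - 2 * b))"
    by (simp add: sum_xvals xweight_eq w algebra_simps)
  also have "\<bar>\<dots>\<bar> = xweight p 1 * \<bar>a - 2 * b\<bar>" using xb s by (auto simp: abs_mult)
  also have "\<dots> \<le> 1 / 3 * (6 * x\<^sup>2)" using xb ab by (intro mult_mono) auto
  also have "\<dots> \<le> 4 * x\<^sup>2" by simp
  finally show "\<bar>\<Sum>z\<in>xvals. xweight p z * wval s p z\<bar> \<le> 4 / (real p)\<^sup>2"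
    by (simp add: x_def power_divide)
qed

section \<open>Almost sure convergence of the Euler product\<close>

lemma Euler_product_limit:
  fixes x :: "nat \<Rightarrow> complex"
  assumes x: "\<And>p. prime p \<Longrightarrow> norm (x p) \<le> 1"
    and re: "convergent (\<lambda>N. \<Sum>n<N. if prime n then Re (x n) / real n else 0)"
    and im: "convergent (\<lambda>N. \<Sum>n<N. if prime n then Im (x n) / real n else 0)"
  obtains \<Xi> where "(\<lambda>N. \<Prod>p\<in>primes_upto N. inverse (1 - x p / of_nat p)) \<longlonglongrightarrow> exp \<Xi>"
    "\<And>s. (\<lambda>N. \<Sum>p\<in>primes_upto N. wval s p (x p)) \<longlonglongrightarrow> 2 * s * Re \<Xi>"
proof -
  define y where "y = (\<lambda>n. if prime n then x n / of_nat n else 0)"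
  define \<xi> where "\<xi> = (\<lambda>p. - Ln (1 - x p / of_nat p))"
  have "summable y"
    unfolding summable_complex_iff summable_iff_convergent y_def
    using re im by (simp add: if_distrib[of Re] if_distrib[of Im] cong: if_cong)
  have small: "norm (x p / of_nat p) \<le> 1 / real p" "1 / real p \<le> 1 / 2" if "prime p" for p
    using x[OF that] prime_ge_2_nat[OF that] by (auto simp: norm_divide divide_right_mono field_simps)
  \<comment> \<open>The logarithm of an Euler factor differs from its linear term by O(1/n^2), so
    convergence of the sums of x(p)/p carries over to the logarithms; the product is then an
    exponential and its limit cannot vanish.\<close>
  have "summable (\<lambda>n. (if prime n then \<xi> n else 0) - y n)"
  proof (rule summable_comparison_test)
    show "summable (\<lambda>n. 2 / (real n)\<^sup>2)" by (rule summable_inverse_squares_scaled)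
    have "norm ((if prime n then \<xi> n else 0) - y n) \<le> 2 / (real n)\<^sup>2" for n
    proof (cases "prime n")
      case True
      define u where "u = - x n / of_nat n"
      have u: "norm u \<le> 1 / real n" "norm u \<le> 1 / 2" using small[OF True] by (auto simp: u_def)
      have "norm (ln (1 + u) - u) \<le> norm u ^ 2 / (1 - norm u)" using u by (intro Ln_approx_linear) auto
      also have "\<dots> \<le> (1 / real n)\<^sup>2 / (1 / 2)" using u by (intro frac_le power_mono) auto
      finally have "norm (ln (1 + u) - u) \<le> 2 / (real n)\<^sup>2" by (simp add: power_divide)
      moreover have "(if prime n then \<xi> n else 0) - y n = - (ln (1 + u) - u)"
        using True by (simp add: \<xi>_def y_def u_def)
      ultimately show ?thesis by (simp only: norm_minus_cancel)
    qed (simp add: y_def)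
    thus "\<exists>N. \<forall>n\<ge>N. norm ((if prime n then \<xi> n else 0) - y n) \<le> 2 / (real n)\<^sup>2" by blast
  qed
  from summable_add[OF this \<open>summable y\<close>] have "summable (\<lambda>n. if prime n then \<xi> n else 0)" by simp
  from sum_primes_upto_tendsto[OF this]
  obtain \<Xi> where \<Xi>: "(\<lambda>N. \<Sum>p\<in>primes_upto N. \<xi> p) \<longlonglongrightarrow> \<Xi>" by blast
  have nz: "1 - x p / of_nat p \<noteq> 0" if "prime p" for p
  proof
    assume "1 - x p / of_nat p = 0"
    hence "norm (x p / of_nat p) = 1" by simp
    thus False using small[OF that] by simp
  qed
  have "exp (\<xi> p) = inverse (1 - x p / of_nat p)" if "prime p" for p
    unfolding \<xi>_def using nz[OF that] by (simp add: exp_minus)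
  hence "(\<Prod>p\<in>primes_upto N. inverse (1 - x p / of_nat p)) = exp (\<Sum>p\<in>primes_upto N. \<xi> p)" for N
    by (subst exp_sum) (auto intro!: prod.cong)
  hence 1: "(\<lambda>N. \<Prod>p\<in>primes_upto N. inverse (1 - x p / of_nat p)) \<longlonglongrightarrow> exp \<Xi>"
    using tendsto_exp[OF \<Xi>] by simp
  have 2: "(\<lambda>N. \<Sum>p\<in>primes_upto N. wval s p (x p)) \<longlonglongrightarrow> 2 * s * Re \<Xi>" for s
  proof -
    have "wval s p (x p) = 2 * s * Re (\<xi> p)" if "prime p" for p
      unfolding wval_def \<xi>_def using nz[OF that] by simp
    hence "(\<Sum>p\<in>primes_upto N. wval s p (x p)) = 2 * s * Re (\<Sum>p\<in>primes_upto N. \<xi> p)" for N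
      by (simp add: sum_distrib_left)
    thus ?thesis using tendsto_Re[OF \<Xi>] by (auto intro!: tendsto_intros)
  qed
  show ?thesis by (rule that[OF 1 2])
qed

locale cubic_random_model = prob_space M for M :: "'a measure" +
  fixes X :: "nat \<Rightarrow> 'a \<Rightarrow> complex"
  assumes X_measurable: "\<And>p. prime p \<Longrightarrow> X p \<in> borel_measurable M"
    and X_indep: "indep_vars (\<lambda>_. borel) X {p. prime p}"
    and X_law: "\<And>p z. prime p \<Longrightarrow> measure M {x \<in> space M. X p x = z} = xweight p z"
begin

lemma X_mass: "prime p \<Longrightarrow> (\<Sum>z\<in>xvals. measure M {x \<in> space M. X p x = z}) = 1"
  by (simp add: X_law sum_xweight)

lemma AE_X_le_1: "AE x in M. \<forall>p. prime p \<longrightarrow> norm (X p x) \<le> 1"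
  unfolding AE_all_countable
proof
  fix p
  show "AE x in M. prime p \<longrightarrow> norm (X p x) \<le> 1"
  proof (cases "prime p")
    case True
    from AE_finite_range(2)[OF X_measurable[OF True] finite_xvals X_mass[OF True]]
    show ?thesis by eventually_elim (use norm_xvals in auto)
  qed auto
qed

text \<open>Independence and mean zero make the terms orthogonal. The function f is real because the
  lemma is applied to the real and the imaginary part.\<close>

lemma AE_convergent_X:
  assumes f[measurable]: "f \<in> borel_measurable borel" and le: "\<And>z. \<bar>f z\<bar> \<le> norm z"
    and mean: "\<And>p. (\<Sum>z\<in>xvals. xweight p z *\<^sub>R f z) = (0::real)"
  shows "AE x in M. convergent (\<lambda>N. \<Sum>n<N. if prime n then f (X n x) / real n else 0)"
proof -
  define Y where "Y = (\<lambda>n x. if prime n then f (X n x) / real n else 0)"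
  have m[measurable]: "(\<lambda>x. f (X n x)) \<in> borel_measurable M" if "prime n" for n
    by (rule measurable_compose[OF X_measurable[OF that] f])
  have "AE x in M. convergent (\<lambda>N. \<Sum>n<N. Y n x)"
  proof (rule AE_convergent_orthogonal_series[where C = 1])
    show "Y n \<in> borel_measurable M" for n
      unfolding Y_def by (cases "prime n") (auto intro!: borel_measurable_divide m)
    show "AE x in M. \<bar>Y n x\<bar> \<le> 1 / real n" for n
      using AE_X_le_1
    proof eventually_elim
      case (elim x)
      show ?case
      proof (cases "prime n")
        case True
        hence "\<bar>f (X n x)\<bar> \<le> 1" using le[of "X n x"] elim by (meson order.trans)
        thus ?thesis using True by (simp add: Y_def divide_right_mono)
      qed (simp add: Y_def)
    qed
    fix i j :: nat assume ij: "i \<noteq> j"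
    show "(\<integral>x. Y i x * Y j x \<partial>M) = 0"
    proof (cases "prime i \<and> prime j")
      case True
      have fX: "integrable M (\<lambda>x. f (X p x))" "(\<integral>x. f (X p x) \<partial>M) = 0" if p: "prime p" for p
        using expectation_finite_range[OF X_measurable[OF p] f finite_xvals X_mass[OF p]] mean[of p]
        by (simp_all add: X_law[OF p])
      have indep: "indep_vars (\<lambda>_. borel) (\<lambda>p x. f (X p x)) {i, j}"
        by (rule indep_vars_compose2[OF indep_vars_subset[OF X_indep]]) (use True in auto)
      have "(\<integral>x. (\<Prod>p\<in>{i, j}. f (X p x)) \<partial>M) = (\<Prod>p\<in>{i, j}. \<integral>x. f (X p x) \<partial>M)"
        using True fX by (intro indep_vars_lebesgue_integral indep) auto
      also have "\<dots> = 0" using True fX by simp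
      finally have "(\<integral>x. f (X i x) * f (X j x) \<partial>M) = 0" using ij by simp
      moreover have "(\<lambda>x. Y i x * Y j x) = (\<lambda>x. f (X i x) * f (X j x) / (real i * real j))"
        using True by (simp add: Y_def fun_eq_iff)
      ultimately show ?thesis by simp
    qed (auto simp: Y_def)
  qed
  thus ?thesis by (simp add: Y_def)
qed

lemma Lone_measurable [measurable]: "Lone X \<in> borel_measurable M"
  unfolding Lone_def[abs_def]
proof (rule borel_measurable_lim_metric)
  fix N
  show "(\<lambda>x. \<Prod>p\<in>primes_upto N. inverse (1 - X p x / of_nat p)) \<in> borel_measurable M"
    using X_measurable by (intro borel_measurable_prod borel_measurable_inverse borel_measurable_diff
        borel_measurable_divide) auto
qed

text \<open>One null set serves all s, since all limits come from the same complex logarithm \<Xi>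
  of the product.\<close>

lemma AE_Lone:
  "AE x in M. Lone X x \<noteq> 0 \<and>
    (\<forall>s. (\<lambda>N. \<Sum>p\<in>primes_upto N. wval s p (X p x)) \<longlonglongrightarrow> 2 * s * ln (norm (Lone X x)))"
proof -
  have "(\<Sum>z\<in>xvals. xweight p z *\<^sub>R Re z) = 0" "(\<Sum>z\<in>xvals. xweight p z *\<^sub>R Im z) = 0" for p
    using arg_cong[OF sum_xweight_id[of p], of Re] arg_cong[OF sum_xweight_id[of p], of Im] by simp_all
  hence "AE x in M. convergent (\<lambda>N. \<Sum>n<N. if prime n then Re (X n x) / real n else 0)"
    "AE x in M. convergent (\<lambda>N. \<Sum>n<N. if prime n then Im (X n x) / real n else 0)"
    by (intro AE_convergent_X; auto simp: abs_Re_le_cmod abs_Im_le_cmod)+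
  thus ?thesis using AE_X_le_1
  proof eventually_elim
    case (elim x)
    obtain \<Xi> where \<Xi>: "(\<lambda>N. \<Prod>p\<in>primes_upto N. inverse (1 - X p x / of_nat p)) \<longlonglongrightarrow> exp \<Xi>"
      "\<And>s. (\<lambda>N. \<Sum>p\<in>primes_upto N. wval s p (X p x)) \<longlonglongrightarrow> 2 * s * Re \<Xi>"
      using Euler_product_limit[of "\<lambda>p. X p x"] elim by blast
    have "Lone X x = exp \<Xi>" unfolding Lone_def using \<Xi>(1) by (rule limI)
    thus ?case using \<Xi>(2) by simp
  qed
qed

lemma random_prime_sum_Lone:
  assumes "s = 1 \<or> s = -1"
  shows "random_prime_sum M xvals xweight (wval s)
    (\<lambda>p. if s = 1 then wval s p 1 else wval s p omega3) 4 (1 / 2) X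
    (\<lambda>x. 2 * s * ln (norm (Lone X x)))"
proof -
  interpret prime_laws xvals xweight "wval s" "\<lambda>p. if s = 1 then wval s p 1 else wval s p omega3" 4 "1 / 2"
    by (rule prime_laws_xweight[OF assms])
  show ?thesis
  proof
    show "wval s p \<in> borel_measurable borel" for p unfolding wval_def[abs_def] by measurable
    show "AE x in M. (\<lambda>N. \<Sum>p\<in>primes_upto N. wval s p (X p x)) \<longlonglongrightarrow> 2 * s * ln (norm (Lone X x))"
      using AE_Lone by eventually_elim auto
  qed (auto intro: X_measurable X_indep X_law)
qed

text \<open>Both tails are instances: s selects the sign and \<open>a\<close> the level, of which
  only the growth to infinity is used. The event asks for \<open>Lone X x \<noteq> 0\<close> so that
  the default value of \<open>ln 0\<close> does not enter the comparison.\<close>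

lemma saddle_point_asymptotics:
  fixes s :: real and a :: "real \<Rightarrow> real"
  assumes s: "s = 1 \<or> s = -1" and a: "filterlim a at_top at_top"
  defines "mom \<equiv> (\<lambda>r. \<integral>x. norm (Lone X x) powr (2 * s * r) \<partial>M)"
  defines "L \<equiv> (\<lambda>r. ln (mom r))"
  defines "k \<equiv> (\<lambda>\<tau>. THE k. k > 0 \<and> deriv L k = a \<tau>)"
  defines "R \<equiv> (\<lambda>\<tau>. mom (k \<tau>) * exp (- (k \<tau> * a \<tau>)) / (k \<tau> * sqrt (2 * pi * deriv (deriv L) (k \<tau>))))"
  obtains C where "\<forall>\<^sub>F \<tau> in at_top. \<exists>!k. k > 0 \<and> deriv L k = a \<tau>"
    "\<forall>\<^sub>F \<tau> in at_top. \<bar>measure M {x \<in> space M. Lone X x \<noteq> 0 \<and> 2 * s * ln (norm (Lone X x)) > a \<tau>} - R \<tau>\<bar>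
        \<le> C * \<bar>R \<tau> * sqrt (ln (k \<tau>) / k \<tau>)\<bar>"
proof -
  let ?W = "\<lambda>x. 2 * s * ln (norm (Lone X x))"
  interpret rps: random_prime_sum M xvals xweight "wval s"
    "\<lambda>p. if s = 1 then wval s p 1 else wval s p omega3" 4 "1 / 2" X "\<lambda>x. ?W x"
    by (rule random_prime_sum_Lone[OF s])
  have mom: "mom r = exp (rps.K r)" for r
  proof -
    have "mom r = (\<integral>x. exp (r * (?W x)) \<partial>M)"
      unfolding mom_def
    proof (rule integral_cong_AE)
      \<comment> \<open>Where \<open>Lone X x = 0\<close> the left side is 0 while an exponential is
        positive; that set is null.\<close>
      show "AE x in M. norm (Lone X x) powr (2 * s * r) = exp (r * (?W x))"
        using AE_Lone by eventually_elim (auto simp: powr_def mult_ac)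
    qed measurable
    thus ?thesis by (simp add: rps.mgf_W)
  qed
  have L: "L = rps.K" by (simp add: L_def mom fun_eq_iff)
  have dL: "deriv L = rps.K1" unfolding L using DERIV_imp_deriv[OF rps.K_deriv] by (simp add: fun_eq_iff)
  have ddL: "deriv (deriv L) = rps.K2"
    unfolding dL using DERIV_imp_deriv[OF rps.K1_deriv] by (simp add: fun_eq_iff)
  have "\<forall>\<^sub>F \<tau> in at_top. a \<tau> > rps.K1 0" using a by (simp add: filterlim_at_top_dense)
  hence ex1: "\<forall>\<^sub>F \<tau> in at_top. \<exists>!k. k > 0 \<and> deriv L k = a \<tau>"
    unfolding dL by eventually_elim (rule rps.K1_ex1)
  obtain C r0 where C: "C > 0" "r0 \<ge> 104" "\<And>r. r \<ge> r0 \<Longrightarrow>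
      \<bar>measure M {x \<in> space M. ?W x > rps.K1 r}
        - exp (rps.K r - r * rps.K1 r) / (r * sqrt (2 * pi * rps.K2 r))\<bar>
      \<le> C * (exp (rps.K r - r * rps.K1 r) / (r * sqrt (2 * pi * rps.K2 r)) * sqrt (ln r / r))"
    using rps.tail_estimate by blast
  \<comment> \<open>By monotonicity of \<open>K1\<close> this will force \<open>k \<tau>\<close>
    above r0, into the range of the tail estimate.\<close>
  have r0: "\<forall>\<^sub>F \<tau> in at_top. a \<tau> > rps.K1 r0" using a by (simp add: filterlim_at_top_dense)
  have meas: "measure M {x \<in> space M. Lone X x \<noteq> 0 \<and> ?W x > c} =
      measure M {x \<in> space M. ?W x > c}" for c
  proof (rule measure_eq_AE)
    show "AE x in M. (x \<in> {x \<in> space M. Lone X x \<noteq> 0 \<and> ?W x > c}) =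
        (x \<in> {x \<in> space M. ?W x > c})"
      using AE_Lone by eventually_elim auto
  qed measurable
  have "\<forall>\<^sub>F \<tau> in at_top. \<bar>measure M {x \<in> space M. Lone X x \<noteq> 0 \<and> ?W x > a \<tau>} - R \<tau>\<bar>
        \<le> C * \<bar>R \<tau> * sqrt (ln (k \<tau>) / k \<tau>)\<bar>"
    using ex1 r0
  proof eventually_elim
    case (elim \<tau>)
    have k: "k \<tau> > 0 \<and> rps.K1 (k \<tau>) = a \<tau>" using theI'[OF elim(1)] unfolding k_def dL .
    have R: "R \<tau> = exp (rps.K (k \<tau>) - k \<tau> * a \<tau>) / (k \<tau> * sqrt (2 * pi * rps.K2 (k \<tau>)))"
      unfolding R_def mom ddL by (simp flip: exp_add)
    have kr0: "k \<tau> \<ge> r0"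
    proof (rule ccontr)
      assume "\<not> k \<tau> \<ge> r0"
      hence "rps.K1 (k \<tau>) < rps.K1 r0" using k by (intro rps.K1_strict_mono) auto
      thus False using k elim(2) by simp
    qed
    hence "k \<tau> \<ge> 104" using C(2) by simp
    moreover have "0 \<le> rps.K2 (k \<tau>)" using rps.K2_pos[of "k \<tau>"] k by simp
    ultimately have nn: "0 \<le> R \<tau> * sqrt (ln (k \<tau>) / k \<tau>)" unfolding R by simp
    show ?case unfolding meas abs_of_nonneg[OF nn] unfolding R using C(3)[OF kr0] k by simp
  qed
  thus ?thesis using that ex1 by blast
qed

end

theorem theorem4p1:
  fixes M :: "'a measure" and X :: "nat \<Rightarrow> 'a \<Rightarrow> complex"
  assumes "prob_space M"
    and "\<And>p. prime p \<Longrightarrow> X p \<in> borel_measurable M"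
    and "prob_space.indep_vars M (\<lambda>_. borel) X {p. prime p}"
    and "\<And>p z. prime p \<Longrightarrow> measure M {\<omega> \<in> space M. X p \<omega> = z} = xweight p z"
  shows "(\<forall>\<^sub>F \<tau> in at_top. \<exists>!k. k > 0 \<and> deriv (Lcal M X) k = 2 * (ln \<tau> + euler_mascheroni))
    \<and> (\<forall>\<^sub>F \<tau> in at_top. \<exists>!k. k > 0 \<and>
          deriv (Ltil M X) k = 2 * ln \<tau> + euler_mascheroni - ln zeta3)
    \<and> (\<lambda>\<tau>. Phi M X \<tau> -
          (\<integral>\<omega>. norm (Lone X \<omega>) powr (2 * kappa M X \<tau>) \<partial>M)
            * (exp euler_mascheroni * \<tau>) powr (- 2 * kappa M X \<tau>)
            / (kappa M X \<tau> * sqrt (2 * pi * deriv (deriv (Lcal M X)) (kappa M X \<tau>))))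
      \<in> O[at_top](\<lambda>\<tau>.
          (\<integral>\<omega>. norm (Lone X \<omega>) powr (2 * kappa M X \<tau>) \<partial>M)
            * (exp euler_mascheroni * \<tau>) powr (- 2 * kappa M X \<tau>)
            / (kappa M X \<tau> * sqrt (2 * pi * deriv (deriv (Lcal M X)) (kappa M X \<tau>)))
          * sqrt (ln (kappa M X \<tau>) / kappa M X \<tau>))
    \<and> (\<lambda>\<tau>. Psi M X \<tau> -
          (\<integral>\<omega>. norm (Lone X \<omega>) powr (- 2 * kappat M X \<tau>) \<partial>M) * zeta3 powr (kappat M X \<tau>)
            / (kappat M X \<tau> * sqrt (2 * pi * deriv (deriv (Ltil M X)) (kappat M X \<tau>))
               * (exp euler_mascheroni * \<tau>\<^sup>2) powr (kappat M X \<tau>)))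
      \<in> O[at_top](\<lambda>\<tau>.
          (\<integral>\<omega>. norm (Lone X \<omega>) powr (- 2 * kappat M X \<tau>) \<partial>M) * zeta3 powr (kappat M X \<tau>)
            / (kappat M X \<tau> * sqrt (2 * pi * deriv (deriv (Ltil M X)) (kappat M X \<tau>))
               * (exp euler_mascheroni * \<tau>\<^sup>2) powr (kappat M X \<tau>))
          * sqrt (ln (kappat M X \<tau>) / kappat M X \<tau>))"
proof -
  interpret cubic_random_model M X
    using assms unfolding cubic_random_model_def cubic_random_model_axioms_def by blast
  have z3: "zeta3 > 0"
  proof -
    have "summable (\<lambda>n. 1 / real (Suc n) ^ 3)"
      using summable_ignore_initial_segment[OF inverse_power_summable[of 3, where 'a = real], of 1]
      by (simp add: inverse_eq_divide)
    thus ?thesis unfolding zeta3_def by (intro suminf_pos) auto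
  qed
  define \<gamma> :: real where "\<gamma> = euler_mascheroni"
  define a1 where "a1 = (\<lambda>\<tau>. 2 * (ln \<tau> + \<gamma>))"
  define a2 where "a2 = (\<lambda>\<tau>. 2 * ln \<tau> + \<gamma> - ln zeta3)"
  have lim: "filterlim a1 at_top at_top" "filterlim a2 at_top at_top"
    unfolding a1_def a2_def by real_asymp+
  \<comment> \<open>The trivial factors 1 and -1 bring both functionals into the form 2 * s * r
    shared by the two tails.\<close>
  have L1: "Lcal M X = (\<lambda>r. ln (\<integral>\<omega>. norm (Lone X \<omega>) powr (2 * 1 * r) \<partial>M))"
    by (simp add: Lcal_def fun_eq_iff)
  have L2: "Ltil M X = (\<lambda>r. ln (\<integral>\<omega>. norm (Lone X \<omega>) powr (2 * (- 1) * r) \<partial>M))"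
    by (simp add: Ltil_def fun_eq_iff)
  have k1: "kappa M X = (\<lambda>\<tau>. THE k. k > 0 \<and> deriv (Lcal M X) k = a1 \<tau>)"
    by (simp add: kappa_def a1_def \<gamma>_def fun_eq_iff)
  have k2: "kappat M X = (\<lambda>\<tau>. THE k. k > 0 \<and> deriv (Ltil M X) k = a2 \<tau>)"
    by (simp add: kappat_def a2_def \<gamma>_def fun_eq_iff)
  let ?mom = "\<lambda>r. \<integral>\<omega>. norm (Lone X \<omega>) powr r \<partial>M"
  let ?D1 = "\<lambda>\<tau>. kappa M X \<tau> * sqrt (2 * pi * deriv (deriv (Lcal M X)) (kappa M X \<tau>))"
  let ?D2 = "\<lambda>\<tau>. kappat M X \<tau> * sqrt (2 * pi * deriv (deriv (Ltil M X)) (kappat M X \<tau>))"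
  let ?d1 = "\<lambda>\<tau>. sqrt (ln (kappa M X \<tau>) / kappa M X \<tau>)"
  let ?d2 = "\<lambda>\<tau>. sqrt (ln (kappat M X \<tau>) / kappat M X \<tau>)"
  let ?S1 = "\<lambda>\<tau>. ?mom (2 * 1 * kappa M X \<tau>) * exp (- (kappa M X \<tau> * a1 \<tau>)) / ?D1 \<tau>"
  let ?S2 = "\<lambda>\<tau>. ?mom (2 * (- 1) * kappat M X \<tau>) * exp (- (kappat M X \<tau> * a2 \<tau>)) / ?D2 \<tau>"
  let ?R1 = "\<lambda>\<tau>. ?mom (2 * kappa M X \<tau>) * (exp euler_mascheroni * \<tau>) powr (- 2 * kappa M X \<tau>) / ?D1 \<tau>"
  let ?R2 = "\<lambda>\<tau>. ?mom (- 2 * kappat M X \<tau>) * zeta3 powr (kappat M X \<tau>)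
      / (?D2 \<tau> * (exp euler_mascheroni * \<tau>\<^sup>2) powr (kappat M X \<tau>))"
  let ?T = "\<lambda>\<sigma> c. {\<omega> \<in> space M. Lone X \<omega> \<noteq> 0 \<and> 2 * \<sigma> * ln (norm (Lone X \<omega>)) > c}"
  obtain C1 where C1: "\<forall>\<^sub>F \<tau> in at_top. \<exists>!k. k > 0 \<and> deriv (Lcal M X) k = a1 \<tau>"
    "\<forall>\<^sub>F \<tau> in at_top. \<bar>measure M (?T 1 (a1 \<tau>)) - ?S1 \<tau>\<bar> \<le> C1 * \<bar>?S1 \<tau> * ?d1 \<tau>\<bar>"
    unfolding k1 L1 by (rule saddle_point_asymptotics[of 1, OF _ lim(1)]) auto
  obtain C2 where C2: "\<forall>\<^sub>F \<tau> in at_top. \<exists>!k. k > 0 \<and> deriv (Ltil M X) k = a2 \<tau>"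
    "\<forall>\<^sub>F \<tau> in at_top. \<bar>measure M (?T (- 1) (a2 \<tau>)) - ?S2 \<tau>\<bar> \<le> C2 * \<bar>?S2 \<tau> * ?d2 \<tau>\<bar>"
    unfolding k2 L2 by (rule saddle_point_asymptotics[of "-1", OF _ lim(2)]) auto
  have AE0: "AE \<omega> in M. Lone X \<omega> \<noteq> 0" using AE_Lone by eventually_elim auto
  have "(\<lambda>\<tau>. Phi M X \<tau> - ?R1 \<tau>) \<in> O[at_top](\<lambda>\<tau>. ?R1 \<tau> * ?d1 \<tau>)"
  proof (rule bigoI[of _ C1])
    show "\<forall>\<^sub>F \<tau> in at_top. norm (Phi M X \<tau> - ?R1 \<tau>) \<le> C1 * norm (?R1 \<tau> * ?d1 \<tau>)"
      using C1(2) eventually_gt_at_top[of 0]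
    proof eventually_elim
      case (elim \<tau>)
      have pw: "(exp euler_mascheroni * \<tau>) powr (- 2 * kappa M X \<tau>) = exp (- (kappa M X \<tau> * a1 \<tau>))"
        using elim(2) by (simp add: powr_def ln_mult a1_def \<gamma>_def algebra_simps)
      have "Phi M X \<tau> = measure M (?T 1 (a1 \<tau>))"
      proof -
        \<comment> \<open>For \<tau> > 0 the two events coincide pointwise: a zero of
          \<open>Lone X\<close> lies in neither.\<close>
        have "(norm (Lone X \<omega>) > exp euler_mascheroni * \<tau>) =
            (Lone X \<omega> \<noteq> 0 \<and> 2 * 1 * ln (norm (Lone X \<omega>)) > a1 \<tau>)" for \<omega>
        proof (cases "Lone X \<omega> = 0")
          case False
          have "(norm (Lone X \<omega>) > exp euler_mascheroni * \<tau>) =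
              (ln (norm (Lone X \<omega>)) > ln (exp euler_mascheroni * \<tau>))"
            using False elim(2) by (subst ln_less_cancel_iff) auto
          also have "ln (exp euler_mascheroni * \<tau>) = a1 \<tau> / 2"
            using elim(2) by (simp add: ln_mult a1_def \<gamma>_def)
          finally show ?thesis using False by auto
        next
          case True
          have "0 < exp (euler_mascheroni :: real) * \<tau>" using elim(2) by simp
          thus ?thesis using True by simp
        qed
        thus ?thesis unfolding Phi_def by simp
      qed
      thus ?case using elim(1) unfolding pw by simp
    qed
  qed
  moreover have "(\<lambda>\<tau>. Psi M X \<tau> - ?R2 \<tau>) \<in> O[at_top](\<lambda>\<tau>. ?R2 \<tau> * ?d2 \<tau>)"
  proof (rule bigoI[of _ C2])
    show "\<forall>\<^sub>F \<tau> in at_top. norm (Psi M X \<tau> - ?R2 \<tau>) \<le> C2 * norm (?R2 \<tau> * ?d2 \<tau>)"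
      using C2(2) eventually_gt_at_top[of 0]
    proof eventually_elim
      case (elim \<tau>)
      \<comment> \<open>The reason is exp (\<open>a2 \<tau>\<close>) = e^\<gamma> \<tau>^2/zeta(3),
        the inverse square of the threshold in \<open>Psi\<close>.\<close>
      have pw: "A * zeta3 powr k / (D * (exp euler_mascheroni * \<tau>\<^sup>2) powr k) = A * exp (- (k * a2 \<tau>)) / D"
        for A D k :: real
      proof -
        have "exp (- (k * a2 \<tau>)) = zeta3 powr k / (exp euler_mascheroni * \<tau>\<^sup>2) powr k"
          using elim(2) z3
          by (simp add: powr_def ln_mult ln_realpow a2_def \<gamma>_def algebra_simps flip: exp_diff)
        thus ?thesis by simp
      qed
      have "Psi M X \<tau> = measure M (?T (- 1) (a2 \<tau>))"
        unfolding Psi_def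
      \<comment> \<open>Here a zero of \<open>Lone X\<close> lies in the left event but not in the
        right one, so the events agree only up to a null set.\<close>
      proof (rule measure_eq_AE)
        define b where "b = sqrt (zeta3 / exp euler_mascheroni) * inverse \<tau>"
        have b: "b > 0" "ln b = - a2 \<tau> / 2"
          using z3 elim(2) by (auto simp: b_def ln_mult ln_sqrt ln_div ln_inverse a2_def \<gamma>_def field_simps)
        show "AE \<omega> in M. (\<omega> \<in> {\<omega> \<in> space M. norm (Lone X \<omega>) < sqrt (zeta3 / exp euler_mascheroni) * inverse \<tau>}) =
           (\<omega> \<in> ?T (- 1) (a2 \<tau>))"
          using AE0
        proof eventually_elim
          case (elim \<omega>)
          hence "(norm (Lone X \<omega>) < b) = (ln (norm (Lone X \<omega>)) < ln b)"
            using b by (subst ln_less_cancel_iff) auto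
          thus ?case using elim unfolding b_def[symmetric] b(2) by auto
        qed
      qed measurable
      thus ?case using elim(1) unfolding pw by simp
    qed
  qed
  ultimately show ?thesis using C1(1) C2(1) unfolding a1_def a2_def \<gamma>_def by blast
qed

end
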